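(* Let $n\ge0$. Let $\mathcal C_n$ be the commutative unital $\mathbb C(q)$-algebra with generators $\gamma_0,\gamma_1,\dots,\gamma_{\lfloor n/2\rfloor}$ and relations $\gamma_k\gamma_l=\delta_{kl}\gamma_k$ and $\gamma_0+\gamma_1+\cdots+\gamma_{\lfloor n/2\rfloor}=1$. Then the natural algebra map $$\psi_{0,\mathcal C,n}:\mathcal C_n\to\mathrm{End}_{\mathbf{2Weyl}}(\mathbb 1_n),\qquad \gamma_k\mapsto c_k \ (\text{the bubble labelled } k),$$ is an isomorphism. Here $\mathbf{2Weyl}$, its 1-morphism $\mathbb 1_n\in\mathrm{Hom}_{\mathbf{2Weyl}}(n,n)$, and the bubbles $c_k$ are defined in the context.
   Context: Ground field $\mathbb C(q)$; $[n]=\frac{q^n-q^{-n}}{q-q^{-1}}$. **The category $\mathbf W'$.** $\mathbf W'$ is the additive $\mathbb C(q)$-linear strict monoidal category, with unit object $\mathbb 1$, whose objects are finite direct sums of tensor words in two objects $Q_+,Q_-$. Write $1_\pm$ for the identity of $Q_\pm$. (Diagrammatically, $Q_+$ is an upward strand, $Q_-$ a downward strand.) Morphisms are generated, under composition, tensor product and linear combination, by - $\eta:\mathbb 1\to Q_-\otimes Q_+$, $\varepsilon: Q_-\otimes Q_+\to\mathbb 1$, $\eta':\mathbb 1\to Q_+\otimes Q_-$, $\varepsilon':Q_+\otimes Q_-\to\mathbb 1$ (oriented cups and caps); - $E:Q_+\otimes Q_+\to Q_+\otimes Q_+$; - $b_k\in\mathrm{End}(\mathbb 1)$ for $k\in\mathbb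 Z$. An element $z\in\mathrm{End}(\mathbb 1)$ may be tensored on the left or on the right of, or inserted between, other morphisms. Planar isotopy relations: $(\varepsilon'\otimes 1_+)(1_+\otimes\eta)=1_+=(1_+\otimes\varepsilon)(\eta'\otimes1_+)$, $(1_-\otimes\varepsilon')(\eta\otimes1_-)=1_-=(\varepsilon\otimes1_-)(1_-\otimes\eta')$, and the left and right mates of $E$ (its rotations by $\pm180^\circ$ using the cups and caps) coincide; call the common mate $E^*:Q_-\otimes Q_-\to Q_-\otimes Q_-$. Notation. - $b_k^\dagger:=\varepsilon\eta-b_{k-1}$ for $k\in\mathbb Z$. - $P:=1_+-[2]\,(1_+\otimes\varepsilon')(E\otimes1_-)(1_+\otimes\eta')$. - Bubbles $c_k\in\mathrm{End}(\mathbb 1)$: $c_0:=\varepsilon\circ\big(1_-\otimes[\varepsilon'(P\otimes1_-)\eta']\otimes1_+\big)\circ\eta$; $c_{k+1}:=\varepsilon'(1_+\otimes\varepsilon'\otimes1_-)(E\otimes c_k\otimes1_-\otimes1_-)(1_+\otimes\eta'\otimes1_-)\eta'$ for $k\ge0$; $c_k:=0$ for $k<0$. Relations (for all integers $k,j\ge0$ unless said otherwise): 1. $[2]^3(E\otimes1_+)(1_+\otimes E)(E\otimes1_+)=[2]\,E\otimes1_+$ and $[2]^3(1_+\otimes E)(E\otimes1_+)(1_+\otimes E)=[2]\,1_+\otimes E$. 2. $[2]^2(E\otimes1_-)(1_+\otimes\eta'\varepsilon')(E\otimes1_-)=[2]\,E\otimes1_-$ and $[2]^2(1_-\otimes E)(\eta\varepsilon\otimes1_+)(1_-\otimes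 E)=[2]\,1_-\otimes E$. 3. $[2](\varepsilon\otimes1_+)(1_-\otimes E)(\eta\otimes1_+)=1_+$ and $[2](1_+\otimes\varepsilon')(E\otimes1_-)(1_+\otimes\eta')=(1-c_0)\otimes1_+$. 4. $\varepsilon\eta=[2]$; $\ \varepsilon(1_-\otimes c_k\otimes1_+)\eta=b_{-2k+1}c_{k-1}+b_{-2k}^\dagger c_k$. 5. $\varepsilon'\eta'=[2]-c_0b_0^\dagger$; $\ \varepsilon'(1_+\otimes c_k\otimes1_-)\eta'=b_{-2k-1}c_k+b_{-2k-2}^\dagger c_{k+1}$. 6. $c_k\otimes1_+=c_k\otimes1_+\otimes(c_k+c_{k-1})$; $\ 1_+\otimes c_k=(c_k+c_{k+1})\otimes1_+\otimes c_k$. 7. $\big[(1_-\otimes1_-\otimes E)(1_-\otimes\eta\otimes1_+)\eta\big]\circ\big[\varepsilon(1_-\otimes\varepsilon\otimes1_+)(1_-\otimes1_-\otimes E)\big]=E^*\otimes E$; $\ c_0\otimes E=0$. 8. $c_kc_j=\delta_{kj}c_k$; $\ b_k\otimes1_+=1_+\otimes b_{k+1}$ for all $k\in\mathbb Z$. 9. $b_k^\dagger b_k=1$ for $k\ge0$. 10. $c_k\otimes1_-\otimes c_k\otimes1_+\otimes c_k=(1_-\otimes c_k\otimes1_+)\,\eta\,(c_kb_{-2k})\,\varepsilon\,(1_-\otimes c_k\otimes1_+)$; $c_{k-1}\otimes1_-\otimes c_k\otimes1_+\otimes c_{k-1}=(1_-\otimes c_k\otimes1_+)\,\eta\,(c_{k-1}b_{-2k+1}^\dagger)\,\varepsilon\,(1_-\otimes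 c_k\otimes1_+)$. 11. Writing juxtaposition for $\otimes$ and $1$ for $1_+$: $[2]\,E\circ(1\,c_k\,1)=[2]\,\big((1\,c_{k+1}\,1)\circ E\big)\,c_k+[2]\,c_k\,\big((1\,c_{k-1}\,1)\circ E\big)+c_{k+1}1c_k1c_k\,b_{-2k}^\dagger+c_k1c_k1c_{k-1}\,b_{-2k+1}-c_{k+1}1c_{k+1}1c_k\,b_{-2k-1}-c_k1c_{k-1}1c_{k-1}\,b_{-2k+2}^\dagger$. **The 2-category $\mathbf{2Weyl}$.** First define $\mathbf{2Weyl}'$. Objects: $\{\nabla\}\sqcup\mathbb Z_{\ge0}$; Hom-categories to or from the null object $\nabla$ are trivial. For $n,m\ge0$ the objects of $\mathrm{Hom}(n,m)$ are finite direct sums of $Q_\epsilon=Q_{\epsilon_\ell}\otimes\cdots\otimes Q_{\epsilon_1}$ with $m=n+\sum_i\epsilon_i$ and $n+\sum_{i\le j}\epsilon_i\ge0$ for all $j$ (signs read as $\pm1$); $\mathbb 1_n$ is the empty word at $n$. 2-morphisms are those of $\mathbf W'$ with regions of diagrams labelled by nonnegative integers: the rightmost region is labelled $n$, crossing an upward strand from right to left raises the label by 1 and crossing a downward strand lowers it by 1 (diagrams with a negatively labelled region are zero). They satisfy all relations of $\mathbf W'$ above and, in addition, in $\mathrm{End}(\mathbb 1_n)$: - $c_k=0$ if $2k>n$; - $\sum_{k=0}^{\lfloor n/2\rfloor}c_k=1$; - $b_k=\frac{[n+k+1]}{[n+k+2]}$ if $n+k\ge0$ and $b_k=0$ if $n+k+1\le0$.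 $\mathbf{2Weyl}$ has the same objects, with each Hom-category replaced by its Karoubi envelope. *)

theory Defs
  imports
    "HOL-Computational_Algebra.Computational_Algebra"
    "HOL-Library.Poly_Mapping"
    "HOL-Algebra.Algebraic_Closure_Type"
begin

section \<open>The ground field\<close>

type_synonym Cq = "complex poly fract"

definition qvar :: Cq where
  "qvar = Fract [:0, 1:] 1"

definition qint :: "int \<Rightarrow> Cq" where
  "qint n = (qvar powi n - qvar powi (- n)) / (qvar - qvar powi (-1))"

section \<open>Diagrams\<close>

datatype sign = Up | Dn

text \<open>
  A word lists the tensor factors from left to right, so that the head of the list is the
  leftmost strand and the end of the list is adjacent to the rightmost region.
\<close>

type_synonym word = "sign list"

fun sgn_val :: "sign \<Rightarrow> int" where
  "sgn_val Up = 1"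
| "sgn_val Dn = -1"

definition wt :: "word \<Rightarrow> int" where
  "wt w = (\<Sum>s\<leftarrow>w. sgn_val s)"

text \<open>
  Formal expressions for morphisms. \<open>g \<circ>\<^sub>d f\<close> is vertical composition (first \<open>f\<close>, then \<open>g\<close>),
  \<open>g \<otimes>\<^sub>d f\<close> is the tensor product with \<open>g\<close> on the left, and \<open>Eta, Eps, Eta', Eps'\<close> are the
  cups and caps \<open>1 \<rightarrow> Q\<^sub>-Q\<^sub>+\<close>, \<open>Q\<^sub>-Q\<^sub>+ \<rightarrow> 1\<close>, \<open>1 \<rightarrow> Q\<^sub>+Q\<^sub>-\<close>, \<open>Q\<^sub>+Q\<^sub>- \<rightarrow> 1\<close>.
\<close>

datatype diag =
    Ident word
  | Eta | Eps | Eta' | Eps'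
  | EE
  | Bk int
  | Comp diag diag  (infixr "\<circ>\<^sub>d" 70)
  | Tens diag diag  (infixr "\<otimes>\<^sub>d" 75)
  | Zero word word
  | Add diag diag   (infixl "+\<^sub>d" 65)
  | Scal Cq diag    (infixr "*\<^sub>d" 68)

primrec dm :: "diag \<Rightarrow> word" where
  "dm (Ident w) = w"
| "dm Eta = []"
| "dm Eps = [Dn, Up]"
| "dm Eta' = []"
| "dm Eps' = [Up, Dn]"
| "dm EE = [Up, Up]"
| "dm (Bk k) = []"
| "dm (g \<circ>\<^sub>d f) = dm f"
| "dm (g \<otimes>\<^sub>d f) = dm g @ dm f"
| "dm (Zero U V) = U"
| "dm (f +\<^sub>d g) = dm f"
| "dm (a *\<^sub>d f) = dm f"

primrec cd :: "diag \<Rightarrow> word" where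
  "cd (Ident w) = w"
| "cd Eta = [Dn, Up]"
| "cd Eps = []"
| "cd Eta' = [Up, Dn]"
| "cd Eps' = []"
| "cd EE = [Up, Up]"
| "cd (Bk k) = []"
| "cd (g \<circ>\<^sub>d f) = cd g"
| "cd (g \<otimes>\<^sub>d f) = cd g @ cd f"
| "cd (Zero U V) = V"
| "cd (f +\<^sub>d g) = cd f"
| "cd (a *\<^sub>d f) = cd f"

text \<open>
  \<open>Zero U V\<close> is only allowed between words of equal weight: otherwise the regions at its left
  would get two different labels. (No other diagrams exist between words of unequal weight.)
\<close>

primrec typed :: "diag \<Rightarrow> bool" where
  "typed (Ident w) = True"
| "typed Eta = True"
| "typed Eps = True"
| "typed Eta' = True"
| "typed Eps' = True"
| "typed EE = True"
| "typed (Bk k) = True"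
| "typed (g \<circ>\<^sub>d f) = (typed g \<and> typed f \<and> dm g = cd f)"
| "typed (g \<otimes>\<^sub>d f) = (typed g \<and> typed f)"
| "typed (Zero U V) = (wt U = wt V)"
| "typed (f +\<^sub>d g) = (typed f \<and> typed g \<and> dm f = dm g \<and> cd f = cd g)"
| "typed (a *\<^sub>d f) = typed f"

abbreviation minus_diag :: "diag \<Rightarrow> diag \<Rightarrow> diag"  (infixl "-\<^sub>d" 65) where
  "f -\<^sub>d g \<equiv> f +\<^sub>d (-1 :: Cq) *\<^sub>d g"

abbreviation idP :: diag where "idP \<equiv> Ident [Up]"
abbreviation idM :: diag where "idM \<equiv> Ident [Dn]"
abbreviation id0 :: diag where "id0 \<equiv> Ident []"
abbreviation zero0 :: diag where "zero0 \<equiv> Zero [] []"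

definition bdag :: "int \<Rightarrow> diag" where
  "bdag k = Eps \<circ>\<^sub>d Eta -\<^sub>d Bk (k - 1)"

definition PP :: diag where
  "PP = idP -\<^sub>d qint 2 *\<^sub>d ((idP \<otimes>\<^sub>d Eps') \<circ>\<^sub>d (EE \<otimes>\<^sub>d idM) \<circ>\<^sub>d (idP \<otimes>\<^sub>d Eta'))"

primrec cnat :: "nat \<Rightarrow> diag" where
  "cnat 0 = Eps \<circ>\<^sub>d (idM \<otimes>\<^sub>d (Eps' \<circ>\<^sub>d (PP \<otimes>\<^sub>d idM) \<circ>\<^sub>d Eta') \<otimes>\<^sub>d idP) \<circ>\<^sub>d Eta"
| "cnat (Suc k) =
     Eps' \<circ>\<^sub>d (idP \<otimes>\<^sub>d Eps' \<otimes>\<^sub>d idM) \<circ>\<^sub>d (EE \<otimes>\<^sub>d cnat k \<otimes>\<^sub>d idM \<otimes>\<^sub>d idM) \<circ>\<^sub>d (idP \<otimes>\<^sub>d Eta' \<otimes>\<^sub>d idM) \<circ>\<^sub>d Eta'"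

definition cc :: "int \<Rightarrow> diag" where
  "cc k = (if k < 0 then zero0 else cnat (nat k))"

text \<open>The two mates of \<open>EE\<close>: the strands are bent round on the left, or on the right, of \<open>EE\<close>.\<close>

definition mateL :: diag where
  "mateL = (idM \<otimes>\<^sub>d idM \<otimes>\<^sub>d Eps') \<circ>\<^sub>d (idM \<otimes>\<^sub>d idM \<otimes>\<^sub>d idP \<otimes>\<^sub>d Eps' \<otimes>\<^sub>d idM)
         \<circ>\<^sub>d (idM \<otimes>\<^sub>d idM \<otimes>\<^sub>d EE \<otimes>\<^sub>d idM \<otimes>\<^sub>d idM)
         \<circ>\<^sub>d (idM \<otimes>\<^sub>d Eta \<otimes>\<^sub>d idP \<otimes>\<^sub>d idM \<otimes>\<^sub>d idM) \<circ>\<^sub>d (Eta \<otimes>\<^sub>d idM \<otimes>\<^sub>d idM)"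

definition mateR :: diag where
  "mateR = (Eps \<otimes>\<^sub>d idM \<otimes>\<^sub>d idM) \<circ>\<^sub>d (idM \<otimes>\<^sub>d Eps \<otimes>\<^sub>d idP \<otimes>\<^sub>d idM \<otimes>\<^sub>d idM)
         \<circ>\<^sub>d (idM \<otimes>\<^sub>d idM \<otimes>\<^sub>d EE \<otimes>\<^sub>d idM \<otimes>\<^sub>d idM)
         \<circ>\<^sub>d (idM \<otimes>\<^sub>d idM \<otimes>\<^sub>d idP \<otimes>\<^sub>d Eta' \<otimes>\<^sub>d idM) \<circ>\<^sub>d (idM \<otimes>\<^sub>d idM \<otimes>\<^sub>d Eta')"

section \<open>The defining relations\<close>

inductive weyl_rel :: "diag \<Rightarrow> diag \<Rightarrow> bool" where
  zigzag1: "weyl_rel ((Eps' \<otimes>\<^sub>d idP) \<circ>\<^sub>d (idP \<otimes>\<^sub>d Eta)) idP"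
| zigzag2: "weyl_rel ((idP \<otimes>\<^sub>d Eps) \<circ>\<^sub>d (Eta' \<otimes>\<^sub>d idP)) idP"
| zigzag3: "weyl_rel ((idM \<otimes>\<^sub>d Eps') \<circ>\<^sub>d (Eta \<otimes>\<^sub>d idM)) idM"
| zigzag4: "weyl_rel ((Eps \<otimes>\<^sub>d idM) \<circ>\<^sub>d (idM \<otimes>\<^sub>d Eta')) idM"
| mates: "weyl_rel mateL mateR"
| r1a: "weyl_rel (qint 2 ^ 3 *\<^sub>d (EE \<otimes>\<^sub>d idP) \<circ>\<^sub>d (idP \<otimes>\<^sub>d EE) \<circ>\<^sub>d (EE \<otimes>\<^sub>d idP)) (qint 2 *\<^sub>d EE \<otimes>\<^sub>d idP)"
| r1b: "weyl_rel (qint 2 ^ 3 *\<^sub>d (idP \<otimes>\<^sub>d EE) \<circ>\<^sub>d (EE \<otimes>\<^sub>d idP) \<circ>\<^sub>d (idP \<otimes>\<^sub>d EE)) (qint 2 *\<^sub>d idP \<otimes>\<^sub>d EE)"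
| r2a: "weyl_rel (qint 2 ^ 2 *\<^sub>d (EE \<otimes>\<^sub>d idM) \<circ>\<^sub>d (idP \<otimes>\<^sub>d (Eta' \<circ>\<^sub>d Eps')) \<circ>\<^sub>d (EE \<otimes>\<^sub>d idM))
                 (qint 2 *\<^sub>d EE \<otimes>\<^sub>d idM)"
| r2b: "weyl_rel (qint 2 ^ 2 *\<^sub>d (idM \<otimes>\<^sub>d EE) \<circ>\<^sub>d ((Eta \<circ>\<^sub>d Eps) \<otimes>\<^sub>d idP) \<circ>\<^sub>d (idM \<otimes>\<^sub>d EE))
                 (qint 2 *\<^sub>d idM \<otimes>\<^sub>d EE)"
| r3a: "weyl_rel (qint 2 *\<^sub>d (Eps \<otimes>\<^sub>d idP) \<circ>\<^sub>d (idM \<otimes>\<^sub>d EE) \<circ>\<^sub>d (Eta \<otimes>\<^sub>d idP)) idP"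
| r3b: "weyl_rel (qint 2 *\<^sub>d (idP \<otimes>\<^sub>d Eps') \<circ>\<^sub>d (EE \<otimes>\<^sub>d idM) \<circ>\<^sub>d (idP \<otimes>\<^sub>d Eta')) ((id0 -\<^sub>d cc 0) \<otimes>\<^sub>d idP)"
| r4a: "weyl_rel (Eps \<circ>\<^sub>d Eta) (qint 2 *\<^sub>d id0)"
| r4b: "0 \<le> k \<Longrightarrow> weyl_rel (Eps \<circ>\<^sub>d (idM \<otimes>\<^sub>d cc k \<otimes>\<^sub>d idP) \<circ>\<^sub>d Eta)
          (Bk (- 2 * k + 1) \<circ>\<^sub>d cc (k - 1) +\<^sub>d bdag (- 2 * k) \<circ>\<^sub>d cc k)"
| r5a: "weyl_rel (Eps' \<circ>\<^sub>d Eta') (qint 2 *\<^sub>d id0 -\<^sub>d cc 0 \<circ>\<^sub>d bdag 0)"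
| r5b: "0 \<le> k \<Longrightarrow> weyl_rel (Eps' \<circ>\<^sub>d (idP \<otimes>\<^sub>d cc k \<otimes>\<^sub>d idM) \<circ>\<^sub>d Eta')
          (Bk (- 2 * k - 1) \<circ>\<^sub>d cc k +\<^sub>d bdag (- 2 * k - 2) \<circ>\<^sub>d cc (k + 1))"
| r6a: "0 \<le> k \<Longrightarrow> weyl_rel (cc k \<otimes>\<^sub>d idP) (cc k \<otimes>\<^sub>d idP \<otimes>\<^sub>d (cc k +\<^sub>d cc (k - 1)))"
| r6b: "0 \<le> k \<Longrightarrow> weyl_rel (idP \<otimes>\<^sub>d cc k) ((cc k +\<^sub>d cc (k + 1)) \<otimes>\<^sub>d idP \<otimes>\<^sub>d cc k)"
| r7a: "weyl_rel (((idM \<otimes>\<^sub>d idM \<otimes>\<^sub>d EE) \<circ>\<^sub>d (idM \<otimes>\<^sub>d Eta \<otimes>\<^sub>d idP) \<circ>\<^sub>d Eta)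
                  \<circ>\<^sub>d (Eps \<circ>\<^sub>d (idM \<otimes>\<^sub>d Eps \<otimes>\<^sub>d idP) \<circ>\<^sub>d (idM \<otimes>\<^sub>d idM \<otimes>\<^sub>d EE)))
                 (mateL \<otimes>\<^sub>d EE)"
| r7b: "weyl_rel (cc 0 \<otimes>\<^sub>d EE) (Zero [Up, Up] [Up, Up])"
| r8a: "0 \<le> k \<Longrightarrow> 0 \<le> j \<Longrightarrow> weyl_rel (cc k \<circ>\<^sub>d cc j) (if k = j then cc k else zero0)"
| r8b: "weyl_rel (Bk k \<otimes>\<^sub>d idP) (idP \<otimes>\<^sub>d Bk (k + 1))"
| r9: "0 \<le> k \<Longrightarrow> weyl_rel (bdag k \<circ>\<^sub>d Bk k) id0"
| r10a: "0 \<le> k \<Longrightarrow> weyl_rel (cc k \<otimes>\<^sub>d idM \<otimes>\<^sub>d cc k \<otimes>\<^sub>d idP \<otimes>\<^sub>d cc k)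
          ((idM \<otimes>\<^sub>d cc k \<otimes>\<^sub>d idP) \<circ>\<^sub>d Eta \<circ>\<^sub>d (cc k \<circ>\<^sub>d Bk (- 2 * k)) \<circ>\<^sub>d Eps \<circ>\<^sub>d (idM \<otimes>\<^sub>d cc k \<otimes>\<^sub>d idP))"
| r10b: "0 \<le> k \<Longrightarrow> weyl_rel (cc (k - 1) \<otimes>\<^sub>d idM \<otimes>\<^sub>d cc k \<otimes>\<^sub>d idP \<otimes>\<^sub>d cc (k - 1))
          ((idM \<otimes>\<^sub>d cc k \<otimes>\<^sub>d idP) \<circ>\<^sub>d Eta \<circ>\<^sub>d (cc (k - 1) \<circ>\<^sub>d bdag (- 2 * k + 1)) \<circ>\<^sub>d Eps
            \<circ>\<^sub>d (idM \<otimes>\<^sub>d cc k \<otimes>\<^sub>d idP))"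
| r11: "0 \<le> k \<Longrightarrow> weyl_rel (qint 2 *\<^sub>d EE \<circ>\<^sub>d (idP \<otimes>\<^sub>d cc k \<otimes>\<^sub>d idP))
          (qint 2 *\<^sub>d ((idP \<otimes>\<^sub>d cc (k + 1) \<otimes>\<^sub>d idP) \<circ>\<^sub>d EE) \<otimes>\<^sub>d cc k
           +\<^sub>d qint 2 *\<^sub>d cc k \<otimes>\<^sub>d ((idP \<otimes>\<^sub>d cc (k - 1) \<otimes>\<^sub>d idP) \<circ>\<^sub>d EE)
           +\<^sub>d cc (k + 1) \<otimes>\<^sub>d idP \<otimes>\<^sub>d cc k \<otimes>\<^sub>d idP \<otimes>\<^sub>d cc k \<otimes>\<^sub>d bdag (- 2 * k)
           +\<^sub>d cc k \<otimes>\<^sub>d idP \<otimes>\<^sub>d cc k \<otimes>\<^sub>d idP \<otimes>\<^sub>d cc (k - 1) \<otimes>\<^sub>d Bk (- 2 * k + 1)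
           -\<^sub>d cc (k + 1) \<otimes>\<^sub>d idP \<otimes>\<^sub>d cc (k + 1) \<otimes>\<^sub>d idP \<otimes>\<^sub>d cc k \<otimes>\<^sub>d Bk (- 2 * k - 1)
           -\<^sub>d cc k \<otimes>\<^sub>d idP \<otimes>\<^sub>d cc (k - 1) \<otimes>\<^sub>d idP \<otimes>\<^sub>d cc (k - 1) \<otimes>\<^sub>d bdag (- 2 * k + 2))"

text \<open>
  \<open>weyl_eq n f g\<close>: the diagrams \<open>f\<close> and \<open>g\<close>, with rightmost region labelled \<open>n\<close>, are equal.
  It is the congruence generated by the axioms of a linear strict monoidal category, by the
  relations above with every labelling of the regions, and by the relations special to labelled
  diagrams. Labels range over the integers because \<open>g \<otimes>\<^sub>d f\<close> puts \<open>g\<close> at the label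
  \<open>n + wt (dm f)\<close>, which may be negative; \<open>negative\<close> makes every diagram having a region with a
  negative label zero, as such a region can be isolated as a tensor factor \<open>id0\<close> of some
  identity in a horizontal slice.
\<close>

inductive weyl_eq :: "int \<Rightarrow> diag \<Rightarrow> diag \<Rightarrow> bool" where
  refl: "typed f \<Longrightarrow> weyl_eq n f f"
| sym: "weyl_eq n f g \<Longrightarrow> weyl_eq n g f"
| trans: "weyl_eq n f g \<Longrightarrow> weyl_eq n g h \<Longrightarrow> weyl_eq n f h"
| cong_comp: "weyl_eq n g g' \<Longrightarrow> weyl_eq n f f' \<Longrightarrow> dm g = cd f \<Longrightarrow> weyl_eq n (g \<circ>\<^sub>d f) (g' \<circ>\<^sub>d f')"
| cong_tens: "weyl_eq (n + wt (dm f)) g g' \<Longrightarrow> weyl_eq n f f' \<Longrightarrow> weyl_eq n (g \<otimes>\<^sub>d f) (g' \<otimes>\<^sub>d f')"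
| cong_add: "weyl_eq n f f' \<Longrightarrow> weyl_eq n g g' \<Longrightarrow> dm f = dm g \<Longrightarrow> cd f = cd g
     \<Longrightarrow> weyl_eq n (f +\<^sub>d g) (f' +\<^sub>d g')"
| cong_scal: "weyl_eq n f f' \<Longrightarrow> weyl_eq n (a *\<^sub>d f) (a *\<^sub>d f')"

| comp_assoc: "typed (h \<circ>\<^sub>d g \<circ>\<^sub>d f) \<Longrightarrow> weyl_eq n ((h \<circ>\<^sub>d g) \<circ>\<^sub>d f) (h \<circ>\<^sub>d g \<circ>\<^sub>d f)"
| comp_id_left: "typed f \<Longrightarrow> weyl_eq n (Ident (cd f) \<circ>\<^sub>d f) f"
| comp_id_right: "typed f \<Longrightarrow> weyl_eq n (f \<circ>\<^sub>d Ident (dm f)) f"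
| tens_assoc: "typed (h \<otimes>\<^sub>d g \<otimes>\<^sub>d f) \<Longrightarrow> weyl_eq n ((h \<otimes>\<^sub>d g) \<otimes>\<^sub>d f) (h \<otimes>\<^sub>d g \<otimes>\<^sub>d f)"
| tens_unit_left: "typed f \<Longrightarrow> weyl_eq n (id0 \<otimes>\<^sub>d f) f"
| tens_unit_right: "typed f \<Longrightarrow> weyl_eq n (f \<otimes>\<^sub>d id0) f"
| tens_id: "weyl_eq n (Ident U \<otimes>\<^sub>d Ident V) (Ident (U @ V))"
| interchange: "typed (g' \<circ>\<^sub>d g) \<Longrightarrow> typed (f' \<circ>\<^sub>d f)
     \<Longrightarrow> weyl_eq n ((g' \<otimes>\<^sub>d f') \<circ>\<^sub>d (g \<otimes>\<^sub>d f)) ((g' \<circ>\<^sub>d g) \<otimes>\<^sub>d (f' \<circ>\<^sub>d f))"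

| add_assoc: "typed (f +\<^sub>d g +\<^sub>d h) \<Longrightarrow> weyl_eq n (f +\<^sub>d g +\<^sub>d h) (f +\<^sub>d (g +\<^sub>d h))"
| add_commute: "typed (f +\<^sub>d g) \<Longrightarrow> weyl_eq n (f +\<^sub>d g) (g +\<^sub>d f)"
| add_zero: "typed f \<Longrightarrow> weyl_eq n (Zero (dm f) (cd f) +\<^sub>d f) f"
| scal_zero: "typed f \<Longrightarrow> weyl_eq n (0 *\<^sub>d f) (Zero (dm f) (cd f))"
| scal_one: "typed f \<Longrightarrow> weyl_eq n (1 *\<^sub>d f) f"
| scal_scal: "typed f \<Longrightarrow> weyl_eq n (a *\<^sub>d b *\<^sub>d f) ((a * b) *\<^sub>d f)"
| scal_add_left: "typed f \<Longrightarrow> weyl_eq n ((a + b) *\<^sub>d f) (a *\<^sub>d f +\<^sub>d b *\<^sub>d f)"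
| scal_add_right: "typed (f +\<^sub>d g) \<Longrightarrow> weyl_eq n (a *\<^sub>d (f +\<^sub>d g)) (a *\<^sub>d f +\<^sub>d a *\<^sub>d g)"
| comp_add_left: "typed ((g +\<^sub>d g') \<circ>\<^sub>d f) \<Longrightarrow> weyl_eq n ((g +\<^sub>d g') \<circ>\<^sub>d f) (g \<circ>\<^sub>d f +\<^sub>d g' \<circ>\<^sub>d f)"
| comp_add_right: "typed (g \<circ>\<^sub>d (f +\<^sub>d f')) \<Longrightarrow> weyl_eq n (g \<circ>\<^sub>d (f +\<^sub>d f')) (g \<circ>\<^sub>d f +\<^sub>d g \<circ>\<^sub>d f')"
| comp_scal_left: "typed (g \<circ>\<^sub>d f) \<Longrightarrow> weyl_eq n ((a *\<^sub>d g) \<circ>\<^sub>d f) (a *\<^sub>d g \<circ>\<^sub>d f)"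
| comp_scal_right: "typed (g \<circ>\<^sub>d f) \<Longrightarrow> weyl_eq n (g \<circ>\<^sub>d (a *\<^sub>d f)) (a *\<^sub>d g \<circ>\<^sub>d f)"
| tens_add_left: "typed ((g +\<^sub>d g') \<otimes>\<^sub>d f) \<Longrightarrow> weyl_eq n ((g +\<^sub>d g') \<otimes>\<^sub>d f) (g \<otimes>\<^sub>d f +\<^sub>d g' \<otimes>\<^sub>d f)"
| tens_add_right: "typed (g \<otimes>\<^sub>d (f +\<^sub>d f')) \<Longrightarrow> weyl_eq n (g \<otimes>\<^sub>d (f +\<^sub>d f')) (g \<otimes>\<^sub>d f +\<^sub>d g \<otimes>\<^sub>d f')"
| tens_scal_left: "typed (g \<otimes>\<^sub>d f) \<Longrightarrow> weyl_eq n ((a *\<^sub>d g) \<otimes>\<^sub>d f) (a *\<^sub>d g \<otimes>\<^sub>d f)"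
| tens_scal_right: "typed (g \<otimes>\<^sub>d f) \<Longrightarrow> weyl_eq n (g \<otimes>\<^sub>d (a *\<^sub>d f)) (a *\<^sub>d g \<otimes>\<^sub>d f)"

| relation: "weyl_rel f g \<Longrightarrow> weyl_eq n f g"

| negative: "n < 0 \<Longrightarrow> weyl_eq n id0 zero0"
| bubble_zero: "0 \<le> n \<Longrightarrow> n < 2 * k \<Longrightarrow> weyl_eq n (cc k) zero0"
| bubble_sum: "0 \<le> n \<Longrightarrow> weyl_eq n (foldr Add (map cc [0..n div 2]) zero0) id0"
| b_pos: "0 \<le> n \<Longrightarrow> 0 \<le> n + k \<Longrightarrow> weyl_eq n (Bk k) ((qint (n + k + 1) / qint (n + k + 2)) *\<^sub>d id0)"
| b_neg: "0 \<le> n \<Longrightarrow> n + k + 1 \<le> 0 \<Longrightarrow> weyl_eq n (Bk k) zero0"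

text \<open>No relation is vacuous or identifies diagrams between different words.\<close>

lemma cnat_typed: "typed (cnat k) \<and> dm (cnat k) = [] \<and> cd (cnat k) = []"
  by (induction k) (auto simp: PP_def)

lemma cc_typed [simp]: "typed (cc k)" "dm (cc k) = []" "cd (cc k) = []"
  using cnat_typed by (auto simp: cc_def)

lemma bdag_typed [simp]: "typed (bdag k)" "dm (bdag k) = []" "cd (bdag k) = []"
  by (auto simp: bdag_def)

lemma mate_typed [simp]:
  "typed mateL" "dm mateL = [Dn, Dn]" "cd mateL = [Dn, Dn]"
  "typed mateR" "dm mateR = [Dn, Dn]" "cd mateR = [Dn, Dn]"
  by (auto simp: mateL_def mateR_def)

lemma weyl_rel_typed:
  "weyl_rel f g \<Longrightarrow> typed f \<and> typed g \<and> dm f = dm g \<and> cd f = cd g"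
  by (induction rule: weyl_rel.induct) (auto split: if_splits)

lemma bubble_sum_typed [simp]:
  "typed (foldr Add (map cc ks) zero0)"
  "dm (foldr Add (map cc ks) zero0) = []"
  "cd (foldr Add (map cc ks) zero0) = []"
  by (induction ks) auto

lemma weight_cd: "typed f \<Longrightarrow> wt (cd f) = wt (dm f)"
  by (induction f) (auto simp: wt_def)

lemma weyl_eq_typed:
  "weyl_eq n f g \<Longrightarrow> typed f \<and> typed g \<and> dm f = dm g \<and> cd f = cd g"
proof (induction rule: weyl_eq.induct)
  case (bubble_sum n)
  then show ?case by (simp del: foldr_map)
next
  case (relation f g n)
  then show ?case using weyl_rel_typed by blast
qed (auto simp: weight_cd)

definition weyl_cls :: "int \<Rightarrow> diag \<Rightarrow> diag set" where
  "weyl_cls n f = {g. weyl_eq n f g}"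

section \<open>Linear categories, additive closure, Karoubi envelope\<close>

text \<open>
  \<open>Cmp C U V W g f\<close> is the composite of \<open>f\<close> from \<open>U\<close> to \<open>V\<close> with \<open>g\<close> from \<open>V\<close> to \<open>W\<close>.
\<close>

record ('o, 'm) lin_cat =
  Ob :: "'o set"
  Hom :: "'o \<Rightarrow> 'o \<Rightarrow> 'm set"
  Idm :: "'o \<Rightarrow> 'm"
  Cmp :: "'o \<Rightarrow> 'o \<Rightarrow> 'o \<Rightarrow> 'm \<Rightarrow> 'm \<Rightarrow> 'm"
  Zer :: "'o \<Rightarrow> 'o \<Rightarrow> 'm"
  Pls :: "'o \<Rightarrow> 'o \<Rightarrow> 'm \<Rightarrow> 'm \<Rightarrow> 'm"
  Scl :: "'o \<Rightarrow> 'o \<Rightarrow> Cq \<Rightarrow> 'm \<Rightarrow> 'm"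

type_synonym 'm matrix_mor = "nat \<Rightarrow> nat \<Rightarrow> 'm"

definition mk_mat :: "nat \<Rightarrow> nat \<Rightarrow> (nat \<Rightarrow> nat \<Rightarrow> 'm) \<Rightarrow> 'm matrix_mor" where
  "mk_mat r c M = (\<lambda>j i. if j < r \<and> i < c then M j i else undefined)"

text \<open>
  Objects are formal finite direct sums (lists) of objects of \<open>C\<close>; a morphism is the matrix with
  \<open>(j, i)\<close> entry in \<open>Hom C (Xs ! i) (Ys ! j)\<close>.
\<close>

definition additive_closure :: "('o, 'm) lin_cat \<Rightarrow> ('o list, 'm matrix_mor) lin_cat" where
  "additive_closure C = \<lparr>
     Ob = {Xs. set Xs \<subseteq> Ob C},
     Hom = (\<lambda>Xs Ys. {mk_mat (length Ys) (length Xs) M | M.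
              \<forall>j < length Ys. \<forall>i < length Xs. M j i \<in> Hom C (Xs ! i) (Ys ! j)}),
     Idm = (\<lambda>Xs. mk_mat (length Xs) (length Xs)
              (\<lambda>j i. if i = j then Idm C (Xs ! i) else Zer C (Xs ! i) (Xs ! j))),
     Cmp = (\<lambda>Xs Ys Zs N M. mk_mat (length Zs) (length Xs)
              (\<lambda>k i. foldr (Pls C (Xs ! i) (Zs ! k))
                 (map (\<lambda>j. Cmp C (Xs ! i) (Ys ! j) (Zs ! k) (N k j) (M j i)) [0..<length Ys])
                 (Zer C (Xs ! i) (Zs ! k)))),
     Zer = (\<lambda>Xs Ys. mk_mat (length Ys) (length Xs) (\<lambda>j i. Zer C (Xs ! i) (Ys ! j))),
     Pls = (\<lambda>Xs Ys M N. mk_mat (length Ys) (length Xs)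
              (\<lambda>j i. Pls C (Xs ! i) (Ys ! j) (M j i) (N j i))),
     Scl = (\<lambda>Xs Ys a M. mk_mat (length Ys) (length Xs)
              (\<lambda>j i. Scl C (Xs ! i) (Ys ! j) a (M j i)))\<rparr>"

definition karoubi :: "('o, 'm) lin_cat \<Rightarrow> ('o \<times> 'm, 'm) lin_cat" where
  "karoubi C = \<lparr>
     Ob = {(U, e). U \<in> Ob C \<and> e \<in> Hom C U U \<and> Cmp C U U U e e = e},
     Hom = (\<lambda>(U, e) (V, e'). {f \<in> Hom C U V. Cmp C U U V (Cmp C U V V e' f) e = f}),
     Idm = (\<lambda>(U, e). e),
     Cmp = (\<lambda>(U, _) (V, _) (W, _). Cmp C U V W),
     Zer = (\<lambda>(U, _) (V, _). Zer C U V),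
     Pls = (\<lambda>(U, _) (V, _). Pls C U V),
     Scl = (\<lambda>(U, _) (V, _). Scl C U V)\<rparr>"

definition End_alg :: "('o, 'm) lin_cat \<Rightarrow> 'o \<Rightarrow> (Cq, 'm) module" where
  "End_alg C U = \<lparr>
     carrier = Hom C U U, monoid.mult = Cmp C U U U, one = Idm C U,
     zero = Zer C U U, add = Pls C U U, module.smult = Scl C U U\<rparr>"

section \<open>The Hom-categories of 2Weyl\<close>

datatype weyl_ob = Nabla | Reg nat

text \<open>
  The full subcategory of the Hom-category of 2Weyl' on single words. For \<open>Nabla\<close> there
  are none, so that the additive closure has only the empty direct sum, i.e. is trivial.
\<close>

fun weyl_words :: "weyl_ob \<Rightarrow> weyl_ob \<Rightarrow> (word, diag set) lin_cat" where
  "weyl_words (Reg n) (Reg m) = \<lparr>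
     Ob = {w. int n + wt w = int m \<and> (\<forall>j. 0 \<le> int n + wt (drop j w))},
     Hom = (\<lambda>U V. {weyl_cls (int n) f | f. typed f \<and> dm f = U \<and> cd f = V}),
     Idm = (\<lambda>U. weyl_cls (int n) (Ident U)),
     Cmp = (\<lambda>U V W G F. \<Union>g\<in>G. \<Union>f\<in>F. weyl_cls (int n) (g \<circ>\<^sub>d f)),
     Zer = (\<lambda>U V. weyl_cls (int n) (Zero U V)),
     Pls = (\<lambda>U V F G. \<Union>f\<in>F. \<Union>g\<in>G. weyl_cls (int n) (f +\<^sub>d g)),
     Scl = (\<lambda>U V a F. \<Union>f\<in>F. weyl_cls (int n) (a *\<^sub>d f))\<rparr>"
| "weyl_words _ _ = \<lparr>
     Ob = {}, Hom = (\<lambda>U V. {}), Idm = (\<lambda>U. {}), Cmp = (\<lambda>U V W G F. {}),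
     Zer = (\<lambda>U V. {}), Pls = (\<lambda>U V F G. {}), Scl = (\<lambda>U V a F. {})\<rparr>"

definition Weyl2' :: "weyl_ob \<Rightarrow> weyl_ob \<Rightarrow> (word list, diag set matrix_mor) lin_cat" where
  "Weyl2' a b = additive_closure (weyl_words a b)"

definition Weyl2 ::
    "weyl_ob \<Rightarrow> weyl_ob \<Rightarrow> (word list \<times> diag set matrix_mor, diag set matrix_mor) lin_cat" where
  "Weyl2 a b = karoubi (Weyl2' a b)"

definition unit_mor :: "nat \<Rightarrow> word list \<times> diag set matrix_mor" where
  "unit_mor n = ([[]], Idm (Weyl2' (Reg n) (Reg n)) [[]])"

definition bubble :: "nat \<Rightarrow> nat \<Rightarrow> diag set matrix_mor" where
  "bubble n k = mk_mat 1 1 (\<lambda>_ _. weyl_cls (int n) (cc (int k)))"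

definition End_unit :: "nat \<Rightarrow> (Cq, diag set matrix_mor) module" where
  "End_unit n = End_alg (Weyl2 (Reg n) (Reg n)) (unit_mor n)"

section \<open>The algebra given by generators and relations\<close>

abbreviation Cq_ring :: "Cq ring" where
  "Cq_ring \<equiv> ring_of_type_algebra"

type_synonym mpol = "(nat \<Rightarrow>\<^sub>0 nat) \<Rightarrow>\<^sub>0 Cq"

definition gvar :: "nat \<Rightarrow> mpol" where
  "gvar k = Poly_Mapping.single (Poly_Mapping.single k 1) 1"

definition gconst :: "Cq \<Rightarrow> mpol" where
  "gconst a = Poly_Mapping.single 0 a"

definition gpoly_ring :: "nat \<Rightarrow> mpol ring" where
  "gpoly_ring n = ring_of_type_algebra
     \<lparr>carrier := {p. \<forall>m \<in> Poly_Mapping.keys p. Poly_Mapping.keys m \<subseteq> {..n div 2}}\<rparr>"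

definition grel_ideal :: "nat \<Rightarrow> mpol set" where
  "grel_ideal n = Idl\<^bsub>gpoly_ring n\<^esub>
     ({gvar k * gvar l - (if k = l then gvar k else 0) | k l. k \<le> n div 2 \<and> l \<le> n div 2}
      \<union> {(\<Sum>k\<le>n div 2. gvar k) - 1})"

definition gcoset :: "nat \<Rightarrow> mpol \<Rightarrow> mpol set" where
  "gcoset n p = grel_ideal n +>\<^bsub>gpoly_ring n\<^esub> p"

definition Calg :: "nat \<Rightarrow> (Cq, mpol set) module" where
  "Calg n = (let Q = gpoly_ring n Quot grel_ideal n
     in ring.extend Q (module.fields (\<lambda>a U. gcoset n (gconst a) \<otimes>\<^bsub>Q\<^esub> U)))"

definition gamma :: "nat \<Rightarrow> nat \<Rightarrow> mpol set" where
  "gamma n k = gcoset n (gvar k)"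

section \<open>Algebra maps\<close>

definition algebra_hom ::
    "(Cq, 'a) module \<Rightarrow> (Cq, 'b) module \<Rightarrow> ('a \<Rightarrow> 'b) set" where
  "algebra_hom A A' = {h \<in> ring_hom A A'.
     \<forall>a. \<forall>x \<in> carrier A. h (a \<odot>\<^bsub>A\<^esub> x) = a \<odot>\<^bsub>A'\<^esub> h x}"

text \<open>
  The natural map is pinned down by its values on the generators; extensionality only fixes
  its irrelevant values off the carrier.
\<close>

definition is_natural_map :: "nat \<Rightarrow> (mpol set \<Rightarrow> diag set matrix_mor) \<Rightarrow> bool" where
  "is_natural_map n \<psi> \<longleftrightarrow>
     \<psi> \<in> algebra_hom (Calg n) (End_unit n) \<and>
     \<psi> \<in> extensional (carrier (Calg n)) \<and>
     (\<forall>k \<le> n div 2. \<psi> (gamma n k) = bubble n k)"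

end

theory Submission
  imports Defs
begin

text \<open>
  Both algebras have coordinates indexed by the \<open>k\<close> with \<open>2 * k \<le> n\<close>, the vertices at level \<open>n\<close> of
  the Bratteli diagram of two-row partitions; an edge either keeps \<open>k\<close> or raises it by one.

  The bubbles span. Each path in the diagram, upward strands being steps up and downward strands
  steps down, carries an inclusion and a projection, and by the relations the identity of any word
  tensored with a primitive idempotent \<open>ev n k\<close> is the sum of the products \<open>inclusion * projection\<close>
  over the paths starting at \<open>(n, k)\<close>. Hence every diagram tensored with \<open>ev n k\<close> is a combination
  of matrix units, a closed diagram \<open>f\<close> acts on \<open>ev n k\<close> by a scalar, and closing up the strands of
  \<open>ev n k\<close> turns this into the statement that \<open>f\<close> times the bubble \<open>k\<close> is a multiple of the bubble \<open>k\<close>.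
  As the bubbles add up to one, \<open>f\<close> is a combination of bubbles.

  The bubbles are nonzero, hence independent as orthogonal idempotents, because the category is
  represented on functions on paths, with matrix entries given by quotients of quantum integers,
  and the bubble \<open>k\<close> acts as the projection to the paths at \<open>k\<close>.
\<close>

section \<open>The ring of all 2-morphisms\<close>

text \<open>The rightmost label is kept at 0, where (0, 0) is the only vertex: one chosen path to
  (n, k) then gives an idempotent \<open>ev n k\<close> made of upward strands and bubbles, and a
  diagram over a region labelled n is placed to the left of it. The obstacle is that the relations
  do not name an isomorphism between the two orders of the steps "stay at k" and "raise k", which
  every other path to the same vertex requires. It is the off-diagonal part of \<open>E\<close>.
  Relations give the diagonal entries of \<open>E\<close>; invertibility follows because a cap and a
  cup between two copies of \<open>E\<close> amount to a scalar once the bubbles around them are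
  fixed, and the downward strand used for this can be closed up again. So [2] \<open>E\<close> is a
  matrix of rank one with known nonzero diagonal. In the representation the scalars come from the
  dimensions [m] with m = n - 2k + 1: \<open>Eps\<close> and \<open>Eta'\<close> carry ratios of
  neighbouring dimensions, \<open>Eta\<close> and \<open>Eps'\<close> carry 1, so that zigzags
  cancel, while [m + 1] + [m - 1] = [2] [m] evaluates circles and makes \<open>EE\<close> an
  idempotent of rank at most one for each pair of end vertices.\<close>

declare weyl_eq.trans [trans]

lemma weyl_cls_eq_iff: "typed f \<Longrightarrow> weyl_cls N f = weyl_cls N g \<longleftrightarrow> weyl_eq N f g"
  unfolding weyl_cls_def by (auto intro: weyl_eq.intros)

lemma weyl_cls_untyped: "\<not> typed f \<Longrightarrow> weyl_cls N f = {}"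
  unfolding weyl_cls_def using weyl_eq_typed by blast

lemma mem_weyl_cls: "g \<in> weyl_cls N f \<longleftrightarrow> weyl_eq N f g"
  by (simp add: weyl_cls_def)

lemma mem_weyl_cls_typed:
  "g \<in> weyl_cls N f \<Longrightarrow> typed f \<and> typed g \<and> dm g = dm f \<and> cd g = cd f"
  using weyl_eq_typed by (fastforce simp: weyl_cls_def)

lemma weyl_cls_cong: "weyl_eq N f g \<Longrightarrow> weyl_cls N f = weyl_cls N g"
  by (simp add: weyl_cls_eq_iff weyl_eq_typed)

text \<open>The operations of the Hom-categories are unions over all representatives. An operation
  that respects \<open>weyl_eq\<close> makes all the sets in such a union equal, so that one
  representative computes it.\<close>

lemma UN_weyl_cls:
  assumes "typed f" "\<And>g. weyl_eq N f g \<Longrightarrow> weyl_eq M (F f) (F g)"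
  shows "(\<Union>g\<in>weyl_cls N f. weyl_cls M (F g)) = weyl_cls M (F f)"
proof -
  have "weyl_cls M (F g) = weyl_cls M (F f)" if "g \<in> weyl_cls N f" for g
    using assms(2)[of g] that by (auto simp: mem_weyl_cls dest: weyl_cls_cong)
  moreover have "f \<in> weyl_cls N f" using assms(1) by (simp add: mem_weyl_cls weyl_eq.refl)
  ultimately show ?thesis by blast
qed

text \<open>The value \<open>{{}}\<close> for unequal weights keeps \<open>cls_zero\<close> inside
  \<open>cls_hom\<close>: there \<open>Zero U V\<close> is untyped and its class is empty.\<close>

definition cls_hom :: "int \<Rightarrow> word \<Rightarrow> word \<Rightarrow> diag set set" where
  "cls_hom N U V =
     (if wt U = wt V then {weyl_cls N f | f. typed f \<and> dm f = U \<and> cd f = V} else {{}})"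

definition cls_zero :: "int \<Rightarrow> word \<Rightarrow> word \<Rightarrow> diag set" where
  "cls_zero N U V = weyl_cls N (Zero U V)"

definition cls_add :: "int \<Rightarrow> diag set \<Rightarrow> diag set \<Rightarrow> diag set" where
  "cls_add N S Y = (\<Union>f\<in>S. \<Union>g\<in>Y. weyl_cls N (f +\<^sub>d g))"

definition cls_scal :: "int \<Rightarrow> Cq \<Rightarrow> diag set \<Rightarrow> diag set" where
  "cls_scal N a S = (\<Union>f\<in>S. weyl_cls N (a *\<^sub>d f))"

definition cls_comp :: "int \<Rightarrow> diag set \<Rightarrow> diag set \<Rightarrow> diag set" where
  "cls_comp N S Y = (\<Union>g\<in>S. \<Union>f\<in>Y. weyl_cls N (g \<circ>\<^sub>d f))"

definition cls_whisk :: "int \<Rightarrow> diag \<Rightarrow> diag set \<Rightarrow> diag set" where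
  "cls_whisk N f S = (\<Union>x\<in>S. weyl_cls N (f \<otimes>\<^sub>d x))"

section \<open>Linear structure on the classes of diagrams\<close>

lemma cls_hom_cases:
  assumes "S \<in> cls_hom N U V"
  obtains "wt U \<noteq> wt V" "S = {}"
  | f where "wt U = wt V" "typed f" "dm f = U" "cd f = V" "S = weyl_cls N f"
  using assms by (auto simp: cls_hom_def split: if_splits)

lemma cls_hom_rep:
  assumes "S \<in> cls_hom N U V" "wt U = wt V"
  obtains f where "typed f" "dm f = U" "cd f = V" "S = weyl_cls N f"
  using assms cls_hom_cases by metis

lemma cls_in_hom: "typed f \<Longrightarrow> weyl_cls N f \<in> cls_hom N (dm f) (cd f)"
  using weight_cd[of f] by (auto simp: cls_hom_def)

lemma cls_add_cls:
  assumes "typed (f +\<^sub>d g)"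
  shows "cls_add N (weyl_cls N f) (weyl_cls N g) = weyl_cls N (f +\<^sub>d g)"
proof -
  have "(\<Union>g'\<in>weyl_cls N g. weyl_cls N (f' +\<^sub>d g')) = weyl_cls N (f' +\<^sub>d g)"
    if "f' \<in> weyl_cls N f" for f'
    using that assms mem_weyl_cls_typed[OF that]
    by (intro UN_weyl_cls) (auto intro!: weyl_eq.cong_add weyl_eq.refl)
  moreover have "(\<Union>f'\<in>weyl_cls N f. weyl_cls N (f' +\<^sub>d g)) = weyl_cls N (f +\<^sub>d g)"
    using assms by (intro UN_weyl_cls) (auto intro!: weyl_eq.cong_add weyl_eq.refl)
  ultimately show ?thesis unfolding cls_add_def by simp
qed

lemma cls_comp_cls:
  assumes "typed (g \<circ>\<^sub>d f)"
  shows "cls_comp N (weyl_cls N g) (weyl_cls N f) = weyl_cls N (g \<circ>\<^sub>d f)"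
proof -
  have "(\<Union>f'\<in>weyl_cls N f. weyl_cls N (g' \<circ>\<^sub>d f')) = weyl_cls N (g' \<circ>\<^sub>d f)"
    if "g' \<in> weyl_cls N g" for g'
    using that assms mem_weyl_cls_typed[OF that]
    by (intro UN_weyl_cls) (auto intro!: weyl_eq.cong_comp weyl_eq.refl)
  moreover have "(\<Union>g'\<in>weyl_cls N g. weyl_cls N (g' \<circ>\<^sub>d f)) = weyl_cls N (g \<circ>\<^sub>d f)"
    using assms by (intro UN_weyl_cls) (auto intro!: weyl_eq.cong_comp weyl_eq.refl)
  ultimately show ?thesis unfolding cls_comp_def by simp
qed

lemma cls_scal_cls: "typed f \<Longrightarrow> cls_scal N a (weyl_cls N f) = weyl_cls N (a *\<^sub>d f)"
  unfolding cls_scal_def by (intro UN_weyl_cls) (auto intro!: weyl_eq.cong_scal)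

lemma cls_whisk_cls:
  "typed f \<Longrightarrow> typed x \<Longrightarrow> cls_whisk N f (weyl_cls N x) = weyl_cls N (f \<otimes>\<^sub>d x)"
  unfolding cls_whisk_def by (intro UN_weyl_cls) (auto intro!: weyl_eq.cong_tens weyl_eq.refl)

lemma cls_empty [simp]:
  "cls_add N {} Y = {}" "cls_add N S {} = {}" "cls_scal N a {} = {}" "cls_whisk N f {} = {}"
  by (auto simp: cls_add_def cls_scal_def cls_whisk_def)

lemma cls_zero_in_hom [simp]: "cls_zero N U V \<in> cls_hom N U V"
proof (cases "wt U = wt V")
  case True
  then show ?thesis using cls_in_hom[of "Zero U V" N] by (simp add: cls_zero_def)
next
  case False
  then show ?thesis by (simp add: cls_zero_def cls_hom_def weyl_cls_untyped)
qed

lemma cls_zero_mismatch: "wt U \<noteq> wt V \<Longrightarrow> cls_zero N U V = {}"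
  by (simp add: cls_zero_def weyl_cls_untyped)

lemma cls_add_in_hom:
  assumes "S \<in> cls_hom N U V" "Y \<in> cls_hom N U V"
  shows "cls_add N S Y \<in> cls_hom N U V"
  using assms(1)
proof (cases rule: cls_hom_cases)
  case 1
  then show ?thesis using assms by simp
next
  case f: (2 f)
  show ?thesis using assms(2)
  proof (cases rule: cls_hom_cases)
    case 1
    then show ?thesis using f by simp
  next
    case (2 g)
    then show ?thesis using f cls_in_hom[of "f +\<^sub>d g" N] by (simp add: cls_add_cls)
  qed
qed

lemma cls_scal_in_hom:
  assumes "S \<in> cls_hom N U V"
  shows "cls_scal N a S \<in> cls_hom N U V"
  using assms
proof (cases rule: cls_hom_cases)
  case 1
  then show ?thesis using assms by simp
next
  case (2 f)
  then show ?thesis using cls_in_hom[of "a *\<^sub>d f" N] by (simp add: cls_scal_cls)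
qed

lemma cls_comp_in_hom:
  assumes "S \<in> cls_hom N V W" "Y \<in> cls_hom N U V" "wt U = wt V" "wt V = wt W"
  shows "cls_comp N S Y \<in> cls_hom N U W"
proof -
  from assms(1,4) obtain g where g: "typed g" "dm g = V" "cd g = W" "S = weyl_cls N g"
    by (auto elim: cls_hom_cases)
  from assms(2,3) obtain f where f: "typed f" "dm f = U" "cd f = V" "Y = weyl_cls N f"
    by (auto elim: cls_hom_cases)
  show ?thesis using f g cls_in_hom[of "g \<circ>\<^sub>d f" N] by (simp add: cls_comp_cls)
qed

lemma cls_whisk_in_hom:
  assumes "S \<in> cls_hom N U V" "typed f"
  shows "cls_whisk N f S \<in> cls_hom N (dm f @ U) (cd f @ V)"
  using assms(1)
proof (cases rule: cls_hom_cases)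
  case 1
  then show ?thesis using weight_cd[OF assms(2)] by (simp add: cls_hom_def wt_def)
next
  case (2 g)
  then show ?thesis using assms(2) cls_in_hom[of "f \<otimes>\<^sub>d g" N] by (simp add: cls_whisk_cls)
qed

lemma cls_add_zero: "S \<in> cls_hom N U V \<Longrightarrow> cls_add N (cls_zero N U V) S = S"
  by (erule cls_hom_cases)
     (auto simp: cls_zero_def cls_add_cls weyl_cls_eq_iff intro!: weyl_eq.add_zero)

lemma cls_add_commute:
  "S \<in> cls_hom N U V \<Longrightarrow> Y \<in> cls_hom N U V \<Longrightarrow> cls_add N S Y = cls_add N Y S"
  by (elim cls_hom_cases) (auto simp: cls_add_cls weyl_cls_eq_iff intro!: weyl_eq.add_commute)

lemma cls_add_assoc:
  "S \<in> cls_hom N U V \<Longrightarrow> Y \<in> cls_hom N U V \<Longrightarrow> Z \<in> cls_hom N U V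
    \<Longrightarrow> cls_add N (cls_add N S Y) Z = cls_add N S (cls_add N Y Z)"
  by (elim cls_hom_cases) (auto simp: cls_add_cls weyl_cls_eq_iff intro!: weyl_eq.add_assoc)

lemma cls_scal_zero: "S \<in> cls_hom N U V \<Longrightarrow> cls_scal N 0 S = cls_zero N U V"
  by (erule cls_hom_cases)
     (auto simp: cls_zero_def cls_scal_cls weyl_cls_eq_iff weyl_cls_untyped intro!: weyl_eq.scal_zero)

lemma cls_scal_one: "S \<in> cls_hom N U V \<Longrightarrow> cls_scal N 1 S = S"
  by (erule cls_hom_cases) (auto simp: cls_scal_cls weyl_cls_eq_iff intro!: weyl_eq.scal_one)

lemma cls_scal_scal: "S \<in> cls_hom N U V \<Longrightarrow> cls_scal N a (cls_scal N b S) = cls_scal N (a * b) S"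
  by (erule cls_hom_cases) (auto simp: cls_scal_cls weyl_cls_eq_iff intro!: weyl_eq.scal_scal)

lemma cls_scal_add_left:
  "S \<in> cls_hom N U V \<Longrightarrow> cls_scal N (a + b) S = cls_add N (cls_scal N a S) (cls_scal N b S)"
  by (erule cls_hom_cases)
     (auto simp: cls_scal_cls cls_add_cls weyl_cls_eq_iff intro!: weyl_eq.scal_add_left)

lemma cls_scal_add_right:
  "S \<in> cls_hom N U V \<Longrightarrow> Y \<in> cls_hom N U V
    \<Longrightarrow> cls_scal N a (cls_add N S Y) = cls_add N (cls_scal N a S) (cls_scal N a Y)"
  by (elim cls_hom_cases)
     (auto simp: cls_scal_cls cls_add_cls weyl_cls_eq_iff intro!: weyl_eq.scal_add_right)

lemma cls_scal_of_zero: "cls_scal N a (cls_zero N U V) = cls_zero N U V"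
  using cls_scal_scal[OF cls_zero_in_hom, of N a 0 U V] by (simp add: cls_scal_zero[OF cls_zero_in_hom])

text \<open>
  Finitely supported families of 2-morphisms, indexed by the label of the rightmost region, the
  source and the target. Composition, extended by zero to non-composable pairs, makes them a ring
  (without unit), so that ring normalization applies to all morphisms at once. Between words of
  unequal weight the only entry is the junk class \<open>{}\<close>.
\<close>

typedef mor = "{x :: int \<Rightarrow> word \<Rightarrow> word \<Rightarrow> diag set.
   (\<forall>N U V. x N U V \<in> cls_hom N U V) \<and> finite {(N, U, V). x N U V \<noteq> cls_zero N U V}}"
  morphisms ent Abs_mor
  by (rule exI[of _ cls_zero]) (simp add: case_prod_unfold)

setup_lifting type_definition_mor

definition supp :: "mor \<Rightarrow> (int \<times> word \<times> word) set" where
  "supp x = {(N, U, V). ent x N U V \<noteq> cls_zero N U V}"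

lemma finite_supp: "finite (supp x)"
  using ent[of x] by (simp add: supp_def)

lemma ent_in_hom [simp]: "ent x N U V \<in> cls_hom N U V"
  using ent[of x] by simp

lemma mor_eqI: "(\<And>N U V. ent x N U V = ent y N U V) \<Longrightarrow> x = y"
  by (simp add: ent_inject[symmetric] fun_eq_iff)

lift_definition smul :: "Cq \<Rightarrow> mor \<Rightarrow> mor"  (infixr "*\<^sub>m" 74) is
  "\<lambda>a x N U V. cls_scal N a (x N U V)"
proof safe
  fix a and x :: "int \<Rightarrow> word \<Rightarrow> word \<Rightarrow> diag set" and N U V
  assume *: "\<forall>N U V. x N U V \<in> cls_hom N U V" "finite {(N, U, V). x N U V \<noteq> cls_zero N U V}"
  show "cls_scal N a (x N U V) \<in> cls_hom N U V" using * by (simp add: cls_scal_in_hom)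
  show "finite {(N, U, V). cls_scal N a (x N U V) \<noteq> cls_zero N U V}"
    by (rule finite_subset[OF _ *(2)], clarify) (metis cls_scal_of_zero)
qed

instantiation mor :: ab_group_add
begin

lift_definition zero_mor :: mor is cls_zero
  by (simp add: case_prod_unfold)

lift_definition plus_mor :: "mor \<Rightarrow> mor \<Rightarrow> mor" is
  "\<lambda>x y N U V. cls_add N (x N U V) (y N U V)"
proof safe
  fix x y :: "int \<Rightarrow> word \<Rightarrow> word \<Rightarrow> diag set" and N U V
  assume *: "\<forall>N U V. x N U V \<in> cls_hom N U V" "finite {(N, U, V). x N U V \<noteq> cls_zero N U V}"
    "\<forall>N U V. y N U V \<in> cls_hom N U V" "finite {(N, U, V). y N U V \<noteq> cls_zero N U V}"
  show "cls_add N (x N U V) (y N U V) \<in> cls_hom N U V" using * by (simp add: cls_add_in_hom)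
  show "finite {(N, U, V). cls_add N (x N U V) (y N U V) \<noteq> cls_zero N U V}"
    by (rule finite_subset[OF _ finite_UnI[OF *(2,4)]], clarify) (metis cls_add_zero cls_zero_in_hom)
qed

definition uminus_mor :: "mor \<Rightarrow> mor" where "uminus_mor x = (-1) *\<^sub>m x"

definition minus_mor :: "mor \<Rightarrow> mor \<Rightarrow> mor" where "minus_mor x y = x + (- y)"

instance
proof
  fix x y z :: mor
  show "x + y + z = x + (y + z)"
    by (rule mor_eqI) (simp add: plus_mor.rep_eq cls_add_assoc[OF ent_in_hom ent_in_hom ent_in_hom])
  show "x + y = y + x"
    by (rule mor_eqI) (simp add: plus_mor.rep_eq cls_add_commute[OF ent_in_hom ent_in_hom])
  show "0 + x = x"
    by (rule mor_eqI) (simp add: plus_mor.rep_eq zero_mor.rep_eq cls_add_zero)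
  show "- x + x = 0"
  proof (rule mor_eqI)
    fix N U V
    have "cls_add N (cls_scal N (-1) (ent x N U V)) (cls_scal N 1 (ent x N U V)) = cls_zero N U V"
      using cls_scal_add_left[OF ent_in_hom, of N "-1" 1 x U V]
      by (simp add: cls_scal_zero[OF ent_in_hom])
    then show "ent (- x + x) N U V = ent 0 N U V"
      by (simp add: plus_mor.rep_eq zero_mor.rep_eq uminus_mor_def smul.rep_eq
          cls_scal_one[OF ent_in_hom])
  qed
  show "x - y = x + - y" by (simp add: minus_mor_def)
qed

end

lemma smul_add_right [simp]: "a *\<^sub>m (x + y) = a *\<^sub>m x + a *\<^sub>m y"
  by (rule mor_eqI) (simp add: plus_mor.rep_eq smul.rep_eq cls_scal_add_right[OF ent_in_hom ent_in_hom])

lemma smul_add_left: "(a + b) *\<^sub>m x = a *\<^sub>m x + b *\<^sub>m x"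
  by (rule mor_eqI) (simp add: plus_mor.rep_eq smul.rep_eq cls_scal_add_left[OF ent_in_hom])

lemma smul_smul [simp]: "a *\<^sub>m b *\<^sub>m x = (a * b) *\<^sub>m x"
  by (rule mor_eqI) (simp add: smul.rep_eq cls_scal_scal[OF ent_in_hom])

lemma smul_one [simp]: "1 *\<^sub>m x = x"
  by (rule mor_eqI) (simp add: smul.rep_eq cls_scal_one[OF ent_in_hom])

lemma smul_zero_left [simp]: "0 *\<^sub>m x = 0"
  by (rule mor_eqI) (simp add: smul.rep_eq zero_mor.rep_eq cls_scal_zero[OF ent_in_hom])

lemma smul_zero_right [simp]: "a *\<^sub>m (0 :: mor) = 0"
  by (rule mor_eqI) (simp add: smul.rep_eq zero_mor.rep_eq cls_scal_of_zero)

lemma smul_neg_one: "(-1) *\<^sub>m x = - x"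
  by (simp add: uminus_mor_def)

lemma smul_sum: "a *\<^sub>m sum f A = (\<Sum>i\<in>A. a *\<^sub>m f i)"
  by (induction A rule: infinite_finite_induct) auto

text \<open>Untyped diagrams become 0, which lets rules such as \<open>mk_scal\<close> hold for all
  diagrams.\<close>

lift_definition mk :: "int \<Rightarrow> diag \<Rightarrow> mor" is
  "\<lambda>N f M U V. if M = N \<and> typed f \<and> U = dm f \<and> V = cd f then weyl_cls N f else cls_zero M U V"
proof safe
  fix N M :: int and f U V
  show "(if M = N \<and> typed f \<and> U = dm f \<and> V = cd f then weyl_cls N f else cls_zero M U V)
      \<in> cls_hom M U V"
    by (auto simp: cls_in_hom)
  show "finite {(M, U, V). (if M = N \<and> typed f \<and> U = dm f \<and> V = cd f then weyl_cls N f
      else cls_zero M U V) \<noteq> cls_zero M U V}"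
    by (rule finite_subset[of _ "{(N, dm f, cd f)}"]) auto
qed

lemma mk_untyped: "\<not> typed f \<Longrightarrow> mk N f = 0"
  by (rule mor_eqI) (simp add: mk.rep_eq zero_mor.rep_eq)

lemma mk_cong: "weyl_eq N f g \<Longrightarrow> mk N f = mk N g"
  using weyl_eq_typed[of N f g] by (intro mor_eqI) (auto simp: mk.rep_eq dest: weyl_cls_cong)

lemma mk_eq_iff:
  assumes "typed f" "typed g" "dm f = dm g" "cd f = cd g"
  shows "mk N f = mk N g \<longleftrightarrow> weyl_eq N f g"
proof
  assume "mk N f = mk N g"
  then have "ent (mk N f) N (dm f) (cd f) = ent (mk N g) N (dm f) (cd f)" by simp
  then show "weyl_eq N f g"
    using assms by (simp add: mk.rep_eq weyl_cls_eq_iff)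
qed (rule mk_cong)

lemma mk_zero [simp]: "mk N (Zero U V) = 0"
  by (rule mor_eqI) (auto simp: mk.rep_eq zero_mor.rep_eq cls_zero_def)

lemma mk_add: "typed (f +\<^sub>d g) \<Longrightarrow> mk N (f +\<^sub>d g) = mk N f + mk N g"
  by (rule mor_eqI) (auto simp: mk.rep_eq plus_mor.rep_eq cls_add_cls cls_add_zero)

lemma mk_scal: "mk N (a *\<^sub>d f) = a *\<^sub>m mk N f"
  by (rule mor_eqI) (auto simp: mk.rep_eq smul.rep_eq cls_scal_cls cls_scal_of_zero)

section \<open>Composition as a ring multiplication\<close>

lemma cls_comp_scal_left:
  assumes "S \<in> cls_hom N V W" "T \<in> cls_hom N U V" "wt U = wt V" "wt V = wt W"
  shows "cls_comp N (cls_scal N a S) T = cls_scal N a (cls_comp N S T)"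
proof -
  from assms obtain f g where *: "typed f" "dm f = U" "cd f = V" "T = weyl_cls N f"
    "typed g" "dm g = V" "cd g = W" "S = weyl_cls N g"
    by (elim cls_hom_cases) auto
  then have "weyl_eq N ((a *\<^sub>d g) \<circ>\<^sub>d f) (a *\<^sub>d g \<circ>\<^sub>d f)"
    by (intro weyl_eq.comp_scal_left) auto
  with * show ?thesis by (simp add: cls_comp_cls cls_scal_cls weyl_cls_eq_iff)
qed

lemma cls_comp_scal_right:
  assumes "S \<in> cls_hom N V W" "T \<in> cls_hom N U V" "wt U = wt V" "wt V = wt W"
  shows "cls_comp N S (cls_scal N a T) = cls_scal N a (cls_comp N S T)"
proof -
  from assms obtain f g where *: "typed f" "dm f = U" "cd f = V" "T = weyl_cls N f"
    "typed g" "dm g = V" "cd g = W" "S = weyl_cls N g"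
    by (elim cls_hom_cases) auto
  then have "weyl_eq N (g \<circ>\<^sub>d (a *\<^sub>d f)) (a *\<^sub>d g \<circ>\<^sub>d f)"
    by (intro weyl_eq.comp_scal_right) auto
  with * show ?thesis by (simp add: cls_comp_cls cls_scal_cls weyl_cls_eq_iff)
qed

lemma cls_comp_zero:
  assumes "wt U = wt V" "wt V = wt W"
  shows "T \<in> cls_hom N U V \<Longrightarrow> cls_comp N (cls_zero N V W) T = cls_zero N U W"
    "S \<in> cls_hom N V W \<Longrightarrow> cls_comp N S (cls_zero N U V) = cls_zero N U W"
proof -
  assume T: "T \<in> cls_hom N U V"
  have "cls_comp N (cls_zero N V W) T \<in> cls_hom N U W"
    by (rule cls_comp_in_hom[OF cls_zero_in_hom T assms])
  then show "cls_comp N (cls_zero N V W) T = cls_zero N U W"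
    using cls_comp_scal_left[OF cls_zero_in_hom[of N V W] T assms, of 0]
    by (simp add: cls_scal_of_zero cls_scal_zero)
next
  assume S: "S \<in> cls_hom N V W"
  have "cls_comp N S (cls_zero N U V) \<in> cls_hom N U W"
    by (rule cls_comp_in_hom[OF S cls_zero_in_hom assms])
  then show "cls_comp N S (cls_zero N U V) = cls_zero N U W"
    using cls_comp_scal_right[OF S cls_zero_in_hom[of N U V] assms, of 0]
    by (simp add: cls_scal_of_zero cls_scal_zero)
qed

text \<open>Composites through one fixed middle word V. Fixing V makes composition total and
  bilinear; the product is the sum over all V, of which finitely many contribute.\<close>

lift_definition comp_via :: "word \<Rightarrow> mor \<Rightarrow> mor \<Rightarrow> mor" is
  "\<lambda>V x y N U W. if wt U = wt V \<and> wt V = wt W then cls_comp N (x N V W) (y N U V) else cls_zero N U W"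
proof safe
  fix V W U N and x y :: "int \<Rightarrow> word \<Rightarrow> word \<Rightarrow> diag set"
  assume *: "\<forall>N U V. x N U V \<in> cls_hom N U V" "finite {(N, U, V). x N U V \<noteq> cls_zero N U V}"
    "\<forall>N U V. y N U V \<in> cls_hom N U V" "finite {(N, U, V). y N U V \<noteq> cls_zero N U V}"
  show "(if wt U = wt V \<and> wt V = wt W then cls_comp N (x N V W) (y N U V) else cls_zero N U W)
      \<in> cls_hom N U W"
    using *(1,3) cls_comp_in_hom[of "x N V W" N V W "y N U V" U] by auto
  \<comment> \<open>A nonzero composite has its target among the targets met by x, and its label and
    source among those met by y; both sets are finite.\<close>
  define A where "A = (\<lambda>(N, V, W). W) ` {(N, U, V). x N U V \<noteq> cls_zero N U V}"
  define B where "B = (\<lambda>(N, U, V). (N, U)) ` {(N, U, V). y N U V \<noteq> cls_zero N U V}"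
  have "{(N, U, W). (if wt U = wt V \<and> wt V = wt W then cls_comp N (x N V W) (y N U V)
      else cls_zero N U W) \<noteq> cls_zero N U W} \<subseteq> (\<lambda>((N, U), W). (N, U, W)) ` (B \<times> A)"
  proof clarify
    fix N U W
    assume "(if wt U = wt V \<and> wt V = wt W then cls_comp N (x N V W) (y N U V) else cls_zero N U W)
      \<noteq> cls_zero N U W"
    then have w: "wt U = wt V" "wt V = wt W" "cls_comp N (x N V W) (y N U V) \<noteq> cls_zero N U W"
      by (auto split: if_splits)
    have "x N V W \<noteq> cls_zero N V W" using w cls_comp_zero(1)[of U V W "y N U V" N] *(3) by auto
    then have "W \<in> A" unfolding A_def by (intro image_eqI[of _ _ "(N, V, W)"]) simp_all
    have "y N U V \<noteq> cls_zero N U V" using w cls_comp_zero(2)[of U V W "x N V W" N] *(1) by auto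
    then have "(N, U) \<in> B" unfolding B_def by (intro image_eqI[of _ _ "(N, U, V)"]) simp_all
    show "(N, U, W) \<in> (\<lambda>((N, U), W). (N, U, W)) ` (B \<times> A)"
      using \<open>W \<in> A\<close> \<open>(N, U) \<in> B\<close> by (intro image_eqI[of _ _ "((N, U), W)"]) simp_all
  qed
  moreover have "finite ((\<lambda>((N, U), W). (N, U, W)) ` (B \<times> A))"
    using *(2,4) unfolding A_def B_def by (intro finite_imageI finite_cartesian_product)
  ultimately show "finite {(N, U, W). (if wt U = wt V \<and> wt V = wt W then
      cls_comp N (x N V W) (y N U V) else cls_zero N U W) \<noteq> cls_zero N U W}"
    by (rule finite_subset)
qed

lemma ent_comp_via:
  "ent (comp_via V x y) N U W =
     (if wt U = wt V \<and> wt V = wt W then cls_comp N (ent x N V W) (ent y N U V) else cls_zero N U W)"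
  by (simp add: comp_via.rep_eq)

lemma cls_comp_add_left:
  assumes "S \<in> cls_hom N V W" "S' \<in> cls_hom N V W" "T \<in> cls_hom N U V" "wt U = wt V" "wt V = wt W"
  shows "cls_comp N (cls_add N S S') T = cls_add N (cls_comp N S T) (cls_comp N S' T)"
proof -
  from assms obtain f g g' where *: "typed f" "dm f = U" "cd f = V" "T = weyl_cls N f"
    "typed g" "dm g = V" "cd g = W" "S = weyl_cls N g"
    "typed g'" "dm g' = V" "cd g' = W" "S' = weyl_cls N g'"
    by (elim cls_hom_cases) auto
  then have "weyl_eq N ((g +\<^sub>d g') \<circ>\<^sub>d f) (g \<circ>\<^sub>d f +\<^sub>d g' \<circ>\<^sub>d f)"
    by (intro weyl_eq.comp_add_left) auto
  with * show ?thesis by (simp add: cls_comp_cls cls_add_cls weyl_cls_eq_iff)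
qed

lemma cls_comp_add_right:
  assumes "S \<in> cls_hom N V W" "T \<in> cls_hom N U V" "T' \<in> cls_hom N U V" "wt U = wt V" "wt V = wt W"
  shows "cls_comp N S (cls_add N T T') = cls_add N (cls_comp N S T) (cls_comp N S T')"
proof -
  from assms obtain f f' g where *: "typed f" "dm f = U" "cd f = V" "T = weyl_cls N f"
    "typed f'" "dm f' = U" "cd f' = V" "T' = weyl_cls N f'"
    "typed g" "dm g = V" "cd g = W" "S = weyl_cls N g"
    by (elim cls_hom_cases) auto
  then have "weyl_eq N (g \<circ>\<^sub>d (f +\<^sub>d f')) (g \<circ>\<^sub>d f +\<^sub>d g \<circ>\<^sub>d f')"
    by (intro weyl_eq.comp_add_right) auto
  with * show ?thesis by (simp add: cls_comp_cls cls_add_cls weyl_cls_eq_iff)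
qed

lemma cls_comp_assoc:
  assumes "R \<in> cls_hom N W Z" "S \<in> cls_hom N V W" "T \<in> cls_hom N U V"
    "wt U = wt V" "wt V = wt W" "wt W = wt Z"
  shows "cls_comp N (cls_comp N R S) T = cls_comp N R (cls_comp N S T)"
proof -
  from assms obtain f g h where *: "typed f" "dm f = U" "cd f = V" "T = weyl_cls N f"
    "typed g" "dm g = V" "cd g = W" "S = weyl_cls N g"
    "typed h" "dm h = W" "cd h = Z" "R = weyl_cls N h"
    by (elim cls_hom_cases) auto
  then have "weyl_eq N ((h \<circ>\<^sub>d g) \<circ>\<^sub>d f) (h \<circ>\<^sub>d g \<circ>\<^sub>d f)"
    by (intro weyl_eq.comp_assoc) auto
  with * show ?thesis by (simp add: cls_comp_cls weyl_cls_eq_iff)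
qed

lemma comp_via_add_left: "comp_via V (x + x') y = comp_via V x y + comp_via V x' y"
proof (rule mor_eqI)
  fix N U W
  show "ent (comp_via V (x + x') y) N U W = ent (comp_via V x y + comp_via V x' y) N U W"
    using cls_comp_add_left[of "ent x N V W" N V W "ent x' N V W" "ent y N U V" U]
      cls_add_zero[OF cls_zero_in_hom, of N U W]
    by (simp add: ent_comp_via plus_mor.rep_eq)
qed

lemma comp_via_add_right: "comp_via V x (y + y') = comp_via V x y + comp_via V x y'"
proof (rule mor_eqI)
  fix N U W
  show "ent (comp_via V x (y + y')) N U W = ent (comp_via V x y + comp_via V x y') N U W"
    using cls_comp_add_right[of "ent x N V W" N V W "ent y N U V" U "ent y' N U V"]
      cls_add_zero[OF cls_zero_in_hom, of N U W]
    by (simp add: ent_comp_via plus_mor.rep_eq)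
qed

lemma comp_via_smul_left: "comp_via V (a *\<^sub>m x) y = a *\<^sub>m comp_via V x y"
proof (rule mor_eqI)
  fix N U W
  show "ent (comp_via V (a *\<^sub>m x) y) N U W = ent (a *\<^sub>m comp_via V x y) N U W"
    using cls_comp_scal_left[of "ent x N V W" N V W "ent y N U V" U a]
    by (simp add: ent_comp_via smul.rep_eq cls_scal_of_zero)
qed

lemma comp_via_smul_right: "comp_via V x (a *\<^sub>m y) = a *\<^sub>m comp_via V x y"
proof (rule mor_eqI)
  fix N U W
  show "ent (comp_via V x (a *\<^sub>m y)) N U W = ent (a *\<^sub>m comp_via V x y) N U W"
    using cls_comp_scal_right[of "ent x N V W" N V W "ent y N U V" U a]
    by (simp add: ent_comp_via smul.rep_eq cls_scal_of_zero)
qed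

lemma comp_via_zero [simp]: "comp_via V 0 y = 0" "comp_via V x 0 = 0"
  using comp_via_smul_left[of V 0 x y] comp_via_smul_right[of V x 0 y] by simp_all

lemma ent_comp_via_zero:
  assumes "ent x N V W = cls_zero N V W \<or> ent y N U V = cls_zero N U V"
  shows "ent (comp_via V x y) N U W = cls_zero N U W"
  using assms cls_comp_zero[of U V W, OF _ _ ent_in_hom] by (auto simp: ent_comp_via)

lemma comp_via_assoc: "comp_via W (x) (comp_via V y z) = comp_via V (comp_via W x y) z"
proof (rule mor_eqI)
  fix N U Z
  show "ent (comp_via W x (comp_via V y z)) N U Z = ent (comp_via V (comp_via W x y) z) N U Z"
  proof (cases "wt U = wt V \<and> wt V = wt W \<and> wt W = wt Z")
    case True
    then show ?thesis
      using cls_comp_assoc[of "ent x N W Z" N W Z "ent y N V W" V "ent z N U V" U]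
      by (simp add: ent_comp_via)
  next
    case False
    have "ent (comp_via W x (comp_via V y z)) N U Z = cls_zero N U Z"
    proof (cases "wt U = wt V \<and> wt V = wt W")
      case True
      then show ?thesis using False by (simp add: ent_comp_via)
    next
      case False
      then have "ent (comp_via V y z) N U W = cls_zero N U W" by (auto simp: ent_comp_via)
      then show ?thesis by (rule ent_comp_via_zero[OF disjI2])
    qed
    moreover have "ent (comp_via V (comp_via W x y) z) N U Z = cls_zero N U Z"
    proof (cases "wt V = wt W \<and> wt W = wt Z")
      case True
      then show ?thesis using False by (simp add: ent_comp_via)
    next
      case False
      then have "ent (comp_via W x y) N V Z = cls_zero N V Z" by (auto simp: ent_comp_via)
      then show ?thesis by (rule ent_comp_via_zero[OF disjI1])
    qed
    ultimately show ?thesis by simp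
  qed
qed

lemma finite_comp_via: "finite {V. comp_via V x y \<noteq> 0}"
proof -
  have "{V. comp_via V x y \<noteq> 0} \<subseteq> (\<lambda>(N, U, V). V) ` supp y"
  proof
    fix V assume "V \<in> {V. comp_via V x y \<noteq> 0}"
    then have "comp_via V x y \<noteq> 0" by simp
    then obtain N U W where "ent (comp_via V x y) N U W \<noteq> cls_zero N U W"
      using mor_eqI[of "comp_via V x y" 0] by (auto simp: zero_mor.rep_eq)
    then have "ent y N U V \<noteq> cls_zero N U V"
      using ent_comp_via_zero by blast
    then show "V \<in> (\<lambda>(N, U, V). V) ` supp y"
      by (intro image_eqI[of _ _ "(N, U, V)"]) (auto simp: supp_def)
  qed
  then show ?thesis by (rule finite_subset) (simp add: finite_supp)
qed

lemma Sum_any_comp_via_left: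
  "finite {i. f i \<noteq> 0} \<Longrightarrow> comp_via V (Sum_any f) y = Sum_any (\<lambda>i. comp_via V (f i) y)"
proof -
  assume fin: "finite {i. f i \<noteq> 0}"
  have "comp_via V (sum f A) y = (\<Sum>i\<in>A. comp_via V (f i) y)" for A
    by (induction A rule: infinite_finite_induct) (auto simp: comp_via_add_left)
  moreover have "Sum_any (\<lambda>i. comp_via V (f i) y) = (\<Sum>i\<in>{i. f i \<noteq> 0}. comp_via V (f i) y)"
    by (rule Sum_any.expand_superset[OF fin]) auto
  ultimately show ?thesis by (simp add: Sum_any.expand_set)
qed

lemma Sum_any_comp_via_right:
  "finite {i. f i \<noteq> 0} \<Longrightarrow> comp_via V x (Sum_any f) = Sum_any (\<lambda>i. comp_via V x (f i))"
proof -
  assume fin: "finite {i. f i \<noteq> 0}"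
  have "comp_via V x (sum f A) = (\<Sum>i\<in>A. comp_via V x (f i))" for A
    by (induction A rule: infinite_finite_induct) (auto simp: comp_via_add_right)
  moreover have "Sum_any (\<lambda>i. comp_via V x (f i)) = (\<Sum>i\<in>{i. f i \<noteq> 0}. comp_via V x (f i))"
    by (rule Sum_any.expand_superset[OF fin]) auto
  ultimately show ?thesis by (simp add: Sum_any.expand_set)
qed

instantiation mor :: ring
begin

definition times_mor :: "mor \<Rightarrow> mor \<Rightarrow> mor" where
  "times_mor x y = (\<Sum>V. comp_via V x y)"

instance
proof
  fix x y z :: mor
  show "(x + y) * z = x * z + y * z"
    unfolding times_mor_def comp_via_add_left
    by (rule Sum_any.distrib) (rule finite_comp_via)+
  show "x * (y + z) = x * y + x * z"
    unfolding times_mor_def comp_via_add_right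
    by (rule Sum_any.distrib) (rule finite_comp_via)+
  define A where "A = {V. comp_via V y z \<noteq> 0}"
  define B where "B = {W. comp_via W x y \<noteq> 0}"
  have fin: "finite A" "finite B" unfolding A_def B_def by (rule finite_comp_via)+
  have "(x * y) * z = (\<Sum>V. \<Sum>W. comp_via V (comp_via W x y) z)"
    unfolding times_mor_def by (simp add: Sum_any_comp_via_left finite_comp_via)
  also have "\<dots> = (\<Sum>W. \<Sum>V. comp_via V (comp_via W x y) z)"
  \<comment> \<open>By associativity a nonzero triple composite makes both partial composites
    nonzero, so both middle words range over finite sets and the sums may be exchanged.\<close>
  proof (rule Sum_any.swap[OF finite_cartesian_product[OF fin]])
    have "comp_via W x y \<noteq> 0" if "comp_via V (comp_via W x y) z \<noteq> 0" for V W
      using that by auto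
    moreover have "comp_via V y z \<noteq> 0" if "comp_via V (comp_via W x y) z \<noteq> 0" for V W
      using that comp_via_assoc[of W x V y z] by auto
    ultimately show "{V. \<exists>W. comp_via V (comp_via W x y) z \<noteq> 0} \<times>
        {W. \<exists>V. comp_via V (comp_via W x y) z \<noteq> 0} \<subseteq> A \<times> B"
      unfolding A_def B_def by blast
  qed
  also have "\<dots> = x * (y * z)"
    unfolding times_mor_def by (simp add: Sum_any_comp_via_right finite_comp_via comp_via_assoc)
  finally show "(x * y) * z = x * (y * z)" .
qed

end

lemma smul_mult_left [simp]: "(a *\<^sub>m x) * y = a *\<^sub>m (x * y)"
proof -
  have "a *\<^sub>m (\<Sum>V. comp_via V x y) = (\<Sum>V. a *\<^sub>m comp_via V x y)"
    unfolding Sum_any.expand_set smul_sum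
    by (rule sum.mono_neutral_cong_right) (auto simp: finite_comp_via)
  then show ?thesis by (simp add: times_mor_def comp_via_smul_left)
qed

lemma smul_mult_right [simp]: "x * (a *\<^sub>m y) = a *\<^sub>m (x * y)"
proof -
  have "comp_via V (a *\<^sub>m x) y = comp_via V x (a *\<^sub>m y)" for V
    by (simp add: comp_via_smul_left comp_via_smul_right)
  then have "(a *\<^sub>m x) * y = x * (a *\<^sub>m y)" by (simp add: times_mor_def)
  then show ?thesis by simp
qed

lemma mk_comp: "typed (g \<circ>\<^sub>d f) \<Longrightarrow> mk N (g \<circ>\<^sub>d f) = mk N g * mk N f"
proof -
  assume t: "typed (g \<circ>\<^sub>d f)"
  then have w: "wt (dm f) = wt (cd f)" "wt (cd f) = wt (cd g)"
    using weight_cd[of f] weight_cd[of g] by auto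
  have *: "comp_via V (mk N g) (mk N f) = (if V = cd f then mk N (g \<circ>\<^sub>d f) else 0)" for V
  proof (rule mor_eqI)
    fix K U W
    show "ent (comp_via V (mk N g) (mk N f)) K U W
        = ent (if V = cd f then mk N (g \<circ>\<^sub>d f) else 0) K U W"
    proof (cases "K = N \<and> U = dm f \<and> V = cd f \<and> W = cd g")
      case True
      then show ?thesis using t w by (simp add: ent_comp_via mk.rep_eq cls_comp_cls)
    next
      case False
      then have "ent (mk N g) K V W = cls_zero K V W \<or> ent (mk N f) K U V = cls_zero K U V"
        using t by (auto simp: mk.rep_eq)
      then have "ent (comp_via V (mk N g) (mk N f)) K U W = cls_zero K U W"
        by (rule ent_comp_via_zero)
      moreover have "ent (if V = cd f then mk N (g \<circ>\<^sub>d f) else 0) K U W = cls_zero K U W"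
        using False by (auto simp: mk.rep_eq zero_mor.rep_eq)
      ultimately show ?thesis by simp
    qed
  qed
  show ?thesis
    unfolding times_mor_def * by simp
qed

lemma mk_comp_mismatch: "N \<noteq> M \<or> dm g \<noteq> cd f \<Longrightarrow> mk M g * mk N f = 0"
proof -
  assume t: "N \<noteq> M \<or> dm g \<noteq> cd f"
  have *: "comp_via V (mk M g) (mk N f) = 0" for V
  proof (rule mor_eqI)
    fix K U W
    have "ent (mk M g) K V W = cls_zero K V W \<or> ent (mk N f) K U V = cls_zero K U V"
      using t by (auto simp: mk.rep_eq)
    then show "ent (comp_via V (mk M g) (mk N f)) K U W = ent 0 K U W"
      unfolding zero_mor.rep_eq by (rule ent_comp_via_zero)
  qed
  show ?thesis unfolding times_mor_def * by simp
qed

text \<open>Subtracting the class found at one nonzero entry removes this entry from the finite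
  support. Hence additive identities have to be checked on single diagrams only.\<close>

lemma mor_induct [case_names zero add]:
  assumes "P 0" "\<And>N f x. typed f \<Longrightarrow> P x \<Longrightarrow> P (mk N f + x)"
  shows "P x"
proof (induction "card (supp x)" arbitrary: x rule: less_induct)
  case less
  show ?case
  proof (cases "supp x = {}")
    case True
    then have "x = 0" by (intro mor_eqI) (auto simp: supp_def zero_mor.rep_eq)
    then show ?thesis using assms by simp
  next
    case False
    then obtain N U V where NUV: "ent x N U V \<noteq> cls_zero N U V" by (auto simp: supp_def)
    then have "wt U = wt V"
      using ent_in_hom[of x N U V] by (auto simp: cls_zero_mismatch cls_hom_def split: if_splits)
    then obtain f where f: "typed f" "dm f = U" "cd f = V" "ent x N U V = weyl_cls N f"
      using cls_hom_rep[OF ent_in_hom] by metis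
    have "ent (x - mk N f) K U' V' = (if (K, U', V') = (N, U, V) then cls_zero N U V else ent x K U' V')"
      for K U' V'
    proof (cases "(K, U', V') = (N, U, V)")
      case True
      have "cls_add N (ent x N U V) (cls_scal N (-1) (ent x N U V)) = ent (x + - x) N U V"
        by (simp only: plus_mor.rep_eq uminus_mor_def smul.rep_eq)
      then have "cls_add N (weyl_cls N f) (cls_scal N (-1) (weyl_cls N f)) = cls_zero N U V"
        using f by (simp add: zero_mor.rep_eq)
      then show ?thesis using True f
        by (simp add: minus_mor_def plus_mor.rep_eq uminus_mor_def smul.rep_eq mk.rep_eq zero_mor.rep_eq)
    next
      case False
      then have "ent (mk N f) K U' V' = cls_zero K U' V'" using f by (auto simp: mk.rep_eq)
      then show ?thesis using False cls_add_commute[OF ent_in_hom[of x K U' V'] cls_zero_in_hom]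
        by (auto simp: minus_mor_def plus_mor.rep_eq uminus_mor_def smul.rep_eq cls_scal_of_zero cls_add_zero)
    qed
    then have "supp (x - mk N f) = supp x - {(N, U, V)}"
      by (auto simp: supp_def)
    moreover have "(N, U, V) \<in> supp x" using NUV by (simp add: supp_def)
    ultimately have "card (supp (x - mk N f)) < card (supp x)"
      using finite_supp[of x] by (metis card_Diff1_less)
    then have "P (mk N f + (x - mk N f))" using less f(1) assms(2) by blast
    then show ?thesis by simp
  qed
qed

section \<open>Tensoring a diagram on the left\<close>

lemma cls_whisk_scal:
  assumes "typed f" "S \<in> cls_hom N U V"
  shows "cls_whisk N f (cls_scal N a S) = cls_scal N a (cls_whisk N f S)"
proof (cases "wt U = wt V")
  case True
  obtain g where g: "typed g" "dm g = U" "cd g = V" "S = weyl_cls N g"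
    using assms(2) True by (rule cls_hom_rep)
  have "weyl_eq N (f \<otimes>\<^sub>d (a *\<^sub>d g)) (a *\<^sub>d f \<otimes>\<^sub>d g)"
    using g assms by (intro weyl_eq.tens_scal_right) auto
  with g assms show ?thesis by (simp add: cls_whisk_cls cls_scal_cls weyl_cls_eq_iff)
next
  case False
  then have "S = {}" using assms by (auto simp: cls_hom_def)
  then show ?thesis by simp
qed

lemma cls_whisk_zero:
  assumes "typed f"
  shows "cls_whisk N f (cls_zero N U V) = cls_zero N (dm f @ U) (cd f @ V)"
  using cls_whisk_scal[OF assms cls_zero_in_hom, of N 0 U V]
    cls_scal_zero[OF cls_whisk_in_hom[OF cls_zero_in_hom assms], of N U V]
  by (simp add: cls_scal_of_zero)

text \<open>Tensoring with \<open>f\<close> on the left.\<close>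

lift_definition wh :: "diag \<Rightarrow> mor \<Rightarrow> mor" is
  "\<lambda>f x N U V. if typed f \<and> take (length (dm f)) U = dm f \<and> take (length (cd f)) V = cd f
     then cls_whisk N f (x N (drop (length (dm f)) U) (drop (length (cd f)) V)) else cls_zero N U V"
proof safe
  fix f N U V and x :: "int \<Rightarrow> word \<Rightarrow> word \<Rightarrow> diag set"
  assume *: "\<forall>N U V. x N U V \<in> cls_hom N U V" "finite {(N, U, V). x N U V \<noteq> cls_zero N U V}"
  show "(if typed f \<and> take (length (dm f)) U = dm f \<and> take (length (cd f)) V = cd f
     then cls_whisk N f (x N (drop (length (dm f)) U) (drop (length (cd f)) V)) else cls_zero N U V)
     \<in> cls_hom N U V"
  proof (cases "typed f \<and> take (length (dm f)) U = dm f \<and> take (length (cd f)) V = cd f")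
    case True
    then have UV: "dm f @ drop (length (dm f)) U = U" "cd f @ drop (length (cd f)) V = V"
      using append_take_drop_id by metis+
    have "cls_whisk N f (x N (drop (length (dm f)) U) (drop (length (cd f)) V))
        \<in> cls_hom N (dm f @ drop (length (dm f)) U) (cd f @ drop (length (cd f)) V)"
      using * True by (intro cls_whisk_in_hom) auto
    then show ?thesis using True by (simp only: UV) simp
  next
    case False
    then show ?thesis by (subst if_not_P) (assumption, rule cls_zero_in_hom)
  qed
  have "{(N, U, V). (if typed f \<and> take (length (dm f)) U = dm f \<and> take (length (cd f)) V = cd f
     then cls_whisk N f (x N (drop (length (dm f)) U) (drop (length (cd f)) V)) else cls_zero N U V)
     \<noteq> cls_zero N U V}
    \<subseteq> (\<lambda>(N, U, V). (N, dm f @ U, cd f @ V)) ` {(N, U, V). x N U V \<noteq> cls_zero N U V}"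
  proof clarify
    fix N U V
    assume "(if typed f \<and> take (length (dm f)) U = dm f \<and> take (length (cd f)) V = cd f
     then cls_whisk N f (x N (drop (length (dm f)) U) (drop (length (cd f)) V)) else cls_zero N U V)
     \<noteq> cls_zero N U V"
    then have t: "typed f" "take (length (dm f)) U = dm f" "take (length (cd f)) V = cd f"
      "cls_whisk N f (x N (drop (length (dm f)) U) (drop (length (cd f)) V)) \<noteq> cls_zero N U V"
      by (auto split: if_splits)
    have UV: "dm f @ drop (length (dm f)) U = U" "cd f @ drop (length (cd f)) V = V"
      using t append_take_drop_id by metis+
    then have "x N (drop (length (dm f)) U) (drop (length (cd f)) V)
        \<noteq> cls_zero N (drop (length (dm f)) U) (drop (length (cd f)) V)"
      using t cls_whisk_zero by metis
    then show "(N, U, V) \<in> (\<lambda>(N, U, V). (N, dm f @ U, cd f @ V)) ` {(N, U, V). x N U V \<noteq> cls_zero N U V}"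
      using UV by (intro image_eqI[of _ _ "(N, drop (length (dm f)) U, drop (length (cd f)) V)"]) simp_all
  qed
  then show "finite {(N, U, V). (if typed f \<and> take (length (dm f)) U = dm f \<and> take (length (cd f)) V = cd f
     then cls_whisk N f (x N (drop (length (dm f)) U) (drop (length (cd f)) V)) else cls_zero N U V)
     \<noteq> cls_zero N U V}"
    by (rule finite_subset) (rule finite_imageI[OF *(2)])
qed

lemma ent_wh:
  "typed f \<Longrightarrow> ent (wh f x) N (dm f @ U) (cd f @ V) = cls_whisk N f (ent x N U V)"
  by (simp add: wh.rep_eq)

lemma ent_wh_other:
  assumes "\<not> (\<exists>U V. U' = dm f @ U \<and> V' = cd f @ V \<and> typed f)"
  shows "ent (wh f x) N U' V' = cls_zero N U' V'"
proof -
  have "\<not> (typed f \<and> take (length (dm f)) U' = dm f \<and> take (length (cd f)) V' = cd f)"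
    using assms append_take_drop_id by metis
  then show ?thesis unfolding wh.rep_eq by (rule if_not_P)
qed

lemma wh_eqI:
  assumes "\<And>N U V. typed f \<Longrightarrow> cls_whisk N f (ent x N U V) = ent y N (dm f @ U) (cd f @ V)"
    "\<And>N U' V'. \<not> (\<exists>U V. U' = dm f @ U \<and> V' = cd f @ V \<and> typed f) \<Longrightarrow> ent y N U' V' = cls_zero N U' V'"
  shows "wh f x = y"
proof (rule mor_eqI)
  fix N U' V'
  show "ent (wh f x) N U' V' = ent y N U' V'"
  proof (cases "\<exists>U V. U' = dm f @ U \<and> V' = cd f @ V \<and> typed f")
    case True
    then show ?thesis using assms(1) by (auto simp: ent_wh)
  next
    case False
    then show ?thesis using assms(2) by (simp add: ent_wh_other)
  qed
qed

lemma cls_whisk_add: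
  assumes "typed f" "S \<in> cls_hom N U V" "T \<in> cls_hom N U V"
  shows "cls_whisk N f (cls_add N S T) = cls_add N (cls_whisk N f S) (cls_whisk N f T)"
proof (cases "wt U = wt V")
  case True
  obtain g where g: "typed g" "dm g = U" "cd g = V" "S = weyl_cls N g"
    using assms(2) True by (rule cls_hom_rep)
  obtain h where h: "typed h" "dm h = U" "cd h = V" "T = weyl_cls N h"
    using assms(3) True by (rule cls_hom_rep)
  have "weyl_eq N (f \<otimes>\<^sub>d (g +\<^sub>d h)) (f \<otimes>\<^sub>d g +\<^sub>d f \<otimes>\<^sub>d h)"
    using g h assms by (intro weyl_eq.tens_add_right) auto
  with g h assms show ?thesis by (simp add: cls_whisk_cls cls_add_cls weyl_cls_eq_iff)
next
  case False
  then have "S = {}" "T = {}" using assms by (auto simp: cls_hom_def)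
  then show ?thesis by simp
qed

lemma wh_untyped: "\<not> typed f \<Longrightarrow> wh f x = 0"
  by (rule wh_eqI) (auto simp: zero_mor.rep_eq)

lemma wh_add [simp]: "wh f (x + y) = wh f x + wh f y"
proof (rule wh_eqI)
  fix N U V assume "typed f"
  then show "cls_whisk N f (ent (x + y) N U V) = ent (wh f x + wh f y) N (dm f @ U) (cd f @ V)"
    by (simp add: plus_mor.rep_eq ent_wh cls_whisk_add[OF _ ent_in_hom ent_in_hom])
next
  fix N U' V' assume "\<not> (\<exists>U V. U' = dm f @ U \<and> V' = cd f @ V \<and> typed f)"
  from ent_wh_other[OF this]
  show "ent (wh f x + wh f y) N U' V' = cls_zero N U' V'"
    by (simp add: plus_mor.rep_eq cls_add_zero)
qed

lemma wh_smul [simp]: "wh f (a *\<^sub>m x) = a *\<^sub>m wh f x"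
proof (rule wh_eqI)
  fix N U V assume "typed f"
  then show "cls_whisk N f (ent (a *\<^sub>m x) N U V) = ent (a *\<^sub>m wh f x) N (dm f @ U) (cd f @ V)"
    by (simp add: smul.rep_eq ent_wh cls_whisk_scal[OF _ ent_in_hom])
next
  fix N U' V' assume "\<not> (\<exists>U V. U' = dm f @ U \<and> V' = cd f @ V \<and> typed f)"
  from ent_wh_other[OF this]
  show "ent (a *\<^sub>m wh f x) N U' V' = cls_zero N U' V'"
    by (simp add: smul.rep_eq cls_scal_of_zero)
qed

lemma wh_zero [simp]: "wh f 0 = 0"
  using wh_smul[of f 0 0] by (simp del: wh_smul)

lemma wh_mk: "typed x \<Longrightarrow> wh f (mk N x) = mk N (f \<otimes>\<^sub>d x)"
proof (cases "typed f")
  case True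
  assume x: "typed x"
  show ?thesis
  proof (rule wh_eqI)
    fix M U V
    show "cls_whisk M f (ent (mk N x) M U V) = ent (mk N (f \<otimes>\<^sub>d x)) M (dm f @ U) (cd f @ V)"
      using True x by (simp add: mk.rep_eq cls_whisk_zero cls_whisk_cls)
  qed (use True in \<open>auto simp: mk.rep_eq\<close>)
qed (simp add: wh_untyped mk_untyped)

lemma mor_eq_by_mk:
  assumes "A 0 = B 0"
    "\<And>x y. A (x + y) = A x + A y" "\<And>x y. B (x + y) = B x + B y"
    "\<And>N f. typed f \<Longrightarrow> A (mk N f) = B (mk N f)"
  shows "A x = (B x :: mor)"
  by (induction x rule: mor_induct) (simp_all add: assms)

text \<open>The components of x may have any rightmost label and any source, so f and g are compared
  at every label; \<open>wh_level\<close> treats relations tied to one label.\<close>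

lemma wh_cong: "(\<And>n. weyl_eq n f g) \<Longrightarrow> wh f x = wh g x"
proof (rule mor_eq_by_mk[where A = "wh f" and B = "wh g"])
  fix N x assume "\<And>n. weyl_eq n f g" "typed x"
  then show "wh f (mk N x) = wh g (mk N x)"
    by (auto simp: wh_mk intro!: mk_cong weyl_eq.cong_tens weyl_eq.refl)
qed simp_all

lemma wh_rel: "weyl_rel f g \<Longrightarrow> wh f x = wh g x"
  by (intro wh_cong weyl_eq.relation)

lemma wh_Zero [simp]: "wh (Zero U V) x = 0"
proof (cases "typed (Zero U V)")
  case True
  show ?thesis
  proof (rule mor_eq_by_mk[where A = "wh (Zero U V)" and B = "\<lambda>_. 0"])
    fix N x assume x: "typed x"
    have "weyl_eq N (Zero U V \<otimes>\<^sub>d x) ((0 *\<^sub>d Zero U V) \<otimes>\<^sub>d x)"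
      using x True weyl_eq.scal_zero[of "Zero U V"]
      by (intro weyl_eq.cong_tens weyl_eq.refl) (auto intro: weyl_eq.sym)
    also have "weyl_eq N \<dots> (0 *\<^sub>d (Zero U V \<otimes>\<^sub>d x))"
      using x True by (intro weyl_eq.tens_scal_left) auto
    finally have "mk N (Zero U V \<otimes>\<^sub>d x) = mk N (0 *\<^sub>d (Zero U V \<otimes>\<^sub>d x))"
      by (rule mk_cong)
    then show "wh (Zero U V) (mk N x) = 0"
      using x by (simp add: wh_mk mk_scal)
  qed simp_all
qed (simp add: wh_untyped)

lemma wh_dadd: "typed (f +\<^sub>d g) \<Longrightarrow> wh (f +\<^sub>d g) x = wh f x + wh g x"
proof (rule mor_eq_by_mk[where A = "wh (f +\<^sub>d g)" and B = "\<lambda>x. wh f x + wh g x"])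
  fix N x assume "typed (f +\<^sub>d g)" "typed x"
  then show "wh (f +\<^sub>d g) (mk N x) = wh f (mk N x) + wh g (mk N x)"
    by (simp add: wh_mk flip: mk_add) (auto intro!: mk_cong weyl_eq.tens_add_left)
qed simp_all

lemma wh_dscal: "wh (a *\<^sub>d f) x = a *\<^sub>m wh f x"
proof (cases "typed f")
  case True
  show ?thesis
  proof (rule mor_eq_by_mk[where A = "wh (a *\<^sub>d f)" and B = "\<lambda>x. a *\<^sub>m wh f x"])
    fix N x assume "typed x"
    with True show "wh (a *\<^sub>d f) (mk N x) = a *\<^sub>m wh f (mk N x)"
      by (simp add: wh_mk flip: mk_scal) (auto intro!: mk_cong weyl_eq.tens_scal_left)
  qed simp_all
qed (simp add: wh_untyped)

lemma wh_tens: "wh (g \<otimes>\<^sub>d f) x = wh g (wh f x)"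
proof (cases "typed g \<and> typed f")
  case True
  show ?thesis
  proof (rule mor_eq_by_mk[where A = "wh (g \<otimes>\<^sub>d f)" and B = "\<lambda>x. wh g (wh f x)"])
    fix N x assume "typed x"
    with True show "wh (g \<otimes>\<^sub>d f) (mk N x) = wh g (wh f (mk N x))"
      by (simp add: wh_mk) (auto intro!: mk_cong weyl_eq.tens_assoc)
  qed simp_all
qed (auto simp: wh_untyped)

lemma wh_id0 [simp]: "wh id0 x = x"
  by (rule mor_eq_by_mk[where A = "wh id0" and B = "\<lambda>x. x"])
     (auto simp: wh_mk intro!: mk_cong weyl_eq.tens_unit_left)

lemma wh_ident_append: "wh (Ident (U @ V)) x = wh (Ident U) (wh (Ident V) x)"
  unfolding wh_tens[symmetric] by (rule wh_cong) (auto intro: weyl_eq.sym weyl_eq.tens_id)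

text \<open>The interchange law, carried over from diagrams to sums of diagrams; where components of
  y and x do not match, both sides vanish.\<close>

lemma wh_mult:
  assumes "typed (f \<circ>\<^sub>d g)"
  shows "wh f y * wh g x = wh (f \<circ>\<^sub>d g) (y * x)"
proof (rule mor_eq_by_mk[where A = "\<lambda>y. wh f y * wh g x" and B = "\<lambda>y. wh (f \<circ>\<^sub>d g) (y * x)"])
  fix M y assume y: "typed y"
  show "wh f (mk M y) * wh g x = wh (f \<circ>\<^sub>d g) (mk M y * x)"
  proof (rule mor_eq_by_mk[where A = "\<lambda>x. wh f (mk M y) * wh g x" and B = "\<lambda>x. wh (f \<circ>\<^sub>d g) (mk M y * x)"])
    fix N x assume x: "typed x"
    show "wh f (mk M y) * wh g (mk N x) = wh (f \<circ>\<^sub>d g) (mk M y * mk N x)"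
    proof (cases "M = N \<and> dm y = cd x")
      case True
      have "wh f (mk M y) * wh g (mk N x) = mk N ((f \<otimes>\<^sub>d y) \<circ>\<^sub>d (g \<otimes>\<^sub>d x))"
        using True x y assms by (simp add: wh_mk mk_comp)
      also have "\<dots> = mk N ((f \<circ>\<^sub>d g) \<otimes>\<^sub>d (y \<circ>\<^sub>d x))"
        using True x y assms by (intro mk_cong weyl_eq.interchange) auto
      also have "\<dots> = wh (f \<circ>\<^sub>d g) (mk M y * mk N x)"
        using True x y assms by (simp add: wh_mk flip: mk_comp)
      finally show ?thesis .
    next
      case False
      then show ?thesis using x y assms by (auto simp: wh_mk mk_comp_mismatch)
    qed
  qed (simp_all add: distrib_left)
qed (simp_all add: distrib_right)

text \<open>Scalars such as those of \<open>Bk\<close> depend on the label, so they can be evaluated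
  only on elements concentrated at one label and one pair of words.\<close>

definition homs :: "int \<Rightarrow> word \<Rightarrow> word \<Rightarrow> mor set" where
  "homs N U V = {x. \<forall>M U' V'. (M, U', V') \<noteq> (N, U, V) \<longrightarrow> ent x M U' V' = cls_zero M U' V'}"

lemma homs_rep:
  assumes "x \<in> homs N U V" "wt U = wt V"
  obtains f where "typed f" "dm f = U" "cd f = V" "x = mk N f"
proof -
  obtain f where f: "typed f" "dm f = U" "cd f = V" "ent x N U V = weyl_cls N f"
    using cls_hom_rep[OF ent_in_hom assms(2)] by metis
  have "x = mk N f"
    using assms f by (intro mor_eqI) (auto simp: homs_def mk.rep_eq)
  with f that show ?thesis by blast
qed

lemma homs_mismatch:
  assumes "x \<in> homs N U V" "wt U \<noteq> wt V"
  shows "x = 0"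
proof (rule mor_eqI)
  fix M U' V'
  have "ent x N U V = cls_zero N U V"
    using ent_in_hom[of x N U V] assms by (simp add: cls_hom_def cls_zero_mismatch)
  then show "ent x M U' V' = ent 0 M U' V'"
    using assms(1) by (cases "(M, U', V') = (N, U, V)") (auto simp: homs_def zero_mor.rep_eq)
qed

lemma mk_homs: "dm f = U \<Longrightarrow> cd f = V \<Longrightarrow> mk N f \<in> homs N U V"
  by (auto simp: homs_def mk.rep_eq)

lemma zero_homs [simp]: "0 \<in> homs N U V"
  by (simp add: homs_def zero_mor.rep_eq)

lemma homs_cases:
  assumes "x \<in> homs N U V"
  obtains "x = 0" | f where "typed f" "dm f = U" "cd f = V" "x = mk N f"
  using assms homs_rep homs_mismatch by metis

lemma homs_add: "x \<in> homs N U V \<Longrightarrow> y \<in> homs N U V \<Longrightarrow> x + y \<in> homs N U V"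
  by (simp add: homs_def plus_mor.rep_eq cls_add_zero)

lemma homs_smul: "x \<in> homs N U V \<Longrightarrow> a *\<^sub>m x \<in> homs N U V"
  by (simp add: homs_def smul.rep_eq cls_scal_of_zero)

lemma homs_mult: "x \<in> homs N V W \<Longrightarrow> y \<in> homs N U V \<Longrightarrow> x * y \<in> homs N U W"
  by (elim homs_cases) (auto simp flip: mk_comp intro: mk_homs)

lemma homs_wh: "x \<in> homs N U V \<Longrightarrow> dm f = U' \<Longrightarrow> cd f = V' \<Longrightarrow> wh f x \<in> homs N (U' @ U) (V' @ V)"
  by (erule homs_cases) (auto simp: wh_mk intro: mk_homs)

lemma ident_mult_left: "x \<in> homs N U V \<Longrightarrow> mk N (Ident V) * x = x"
  by (erule homs_cases) (auto simp flip: mk_comp intro!: mk_cong weyl_eq.comp_id_left)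

lemma ident_mult_right: "x \<in> homs N U V \<Longrightarrow> x * mk N (Ident U) = x"
  by (erule homs_cases) (auto simp flip: mk_comp intro!: mk_cong weyl_eq.comp_id_right)

text \<open>On a homogeneous element the region to the right of f has the single label N + wt U, so
  that relations special to this label apply.\<close>

lemma wh_level:
  assumes "x \<in> homs N U V" "weyl_eq (N + wt U) f g"
  shows "wh f x = wh g x"
  using assms(1)
proof (cases rule: homs_cases)
  case (2 h)
  then show ?thesis using assms(2)
    by (auto simp: wh_mk intro!: mk_cong weyl_eq.cong_tens weyl_eq.refl)
qed simp

section \<open>Closed diagrams are combinations of bubbles\<close>

lemma qvar_power: "qvar ^ n = Fract (monom 1 n) 1"
proof (induction n)
  case 0
  then show ?case by (simp add: One_fract_def)
next
  case (Suc n)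
  then show ?case by (simp add: qvar_def monom_Suc)
qed

lemma qvar_power_neq_1: "n > 0 \<Longrightarrow> qvar ^ n \<noteq> 1"
  using degree_monom_eq[of "1 :: complex" n]
  by (auto simp: qvar_power One_fract_def eq_fract)

lemma qvar_nonzero [simp]: "qvar \<noteq> 0"
  by (simp add: qvar_def Zero_fract_def eq_fract)

lemma qvar_diff_nonzero: "n > 0 \<Longrightarrow> qvar powi n - qvar powi (- n) \<noteq> 0"
proof
  assume n: "n > 0" and "qvar powi n - qvar powi (- n) = 0"
  then have "qvar powi n * qvar powi n = 1"
    by (simp add: power_int_minus field_simps)
  then have "qvar powi (n + n) = 1" by (subst power_int_add) simp_all
  then show False using qvar_power_neq_1[of "nat (n + n)"] n by (simp add: power_int_def)
qed

lemma qint_nonzero: "n > 0 \<Longrightarrow> qint n \<noteq> 0"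
  using qvar_diff_nonzero[of n] qvar_diff_nonzero[of 1] by (simp add: qint_def)

lemma qint_0 [simp]: "qint 0 = 0"
  by (simp add: qint_def)

lemma qint_1 [simp]: "qint 1 = 1"
  using qvar_diff_nonzero[of 1] by (simp add: qint_def)

lemma powi_2_diff:
  fixes x :: "'a :: field"
  assumes "x \<noteq> 0" "x - x powi (-1) \<noteq> 0"
  shows "(x powi 2 - x powi (-2)) / (x - x powi (-1)) = x + x powi (-1)"
proof -
  have "x powi 2 - x powi (-2) = (x + x powi (-1)) * (x - x powi (-1))"
    using assms(1) by (simp add: power_int_minus field_simps power2_eq_square)
  with assms(2) show ?thesis by simp
qed

lemma powi_diff_rec:
  fixes x :: "'a :: field"
  assumes "x \<noteq> 0"
  shows "(x powi (n + 1) - x powi (- (n + 1))) / d + (x powi (n - 1) - x powi (- (n - 1))) / d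
    = (x + x powi (-1)) * ((x powi n - x powi (- n)) / d)"
proof -
  have "x powi (n + 1) - x powi (- (n + 1)) + (x powi (n - 1) - x powi (- (n - 1)))
    = (x + x powi (-1)) * (x powi n - x powi (- n))"
    using assms power_int_add[of x n 1] power_int_add[of x n "-1"]
      power_int_add[of x "- n" 1] power_int_add[of x "- n" "-1"]
    by (simp add: algebra_simps)
  then show ?thesis by (simp only: add_divide_distrib[symmetric] times_divide_eq_right)
qed

lemma qint_2: "qint 2 = qvar + qvar powi (-1)"
  unfolding qint_def using qvar_diff_nonzero[of 1] by (intro powi_2_diff) simp_all

lemma qint_rec: "qint (n + 1) + qint (n - 1) = qint 2 * qint n"
  unfolding qint_2 unfolding qint_def by (rule powi_diff_rec) simp

lemma qint_add2: "qint (n + 2) = qint 2 * qint (n + 1) - qint n"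
  using qint_rec[of "n + 1"] by (simp add: eq_diff_eq add.commute)

text \<open>In a region labelled n, with n at least 0, the scalar of \<open>Bk k\<close> depends on
  the sum i = n + k only.\<close>

definition bval :: "int \<Rightarrow> Cq" where
  "bval i = (if 0 \<le> i then qint (i + 1) / qint (i + 2) else 0)"

definition bdval :: "int \<Rightarrow> Cq" where
  "bdval i = qint 2 - bval (i - 1)"

lemma bval_nonzero: "0 \<le> i \<Longrightarrow> bval i \<noteq> 0"
  by (simp add: bval_def qint_nonzero)

text \<open>This is [i + 2] = [2] [i + 1] - [i] divided by [i + 1]; at i = 0 the value 0 of
  \<open>bval\<close> at -1 agrees with [0]/[1].\<close>

lemma bdval_eq: "0 \<le> i \<Longrightarrow> bdval i = qint (i + 2) / qint (i + 1)"
proof -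
  assume i: "0 \<le> i"
  have "qint 2 - qint i / qint (i + 1) = qint (i + 2) / qint (i + 1)"
    unfolding qint_add2 using qint_nonzero[of "i + 1"] i
    by (simp add: diff_divide_distrib)
  moreover have "bval (i - 1) = qint i / qint (i + 1)"
    using i by (auto simp: bval_def add.commute)
  ultimately show ?thesis by (simp add: bdval_def)
qed

lemma bdval_nonzero: "0 \<le> i \<Longrightarrow> bdval i \<noteq> 0"
  by (simp add: bdval_eq qint_nonzero)

lemma bval_bdval: "0 \<le> i \<Longrightarrow> bval i * bdval i = 1"
  by (simp add: bdval_eq bval_def qint_nonzero)

lemma weyl_eq_Bk: "0 \<le> n \<Longrightarrow> weyl_eq n (Bk k) (bval (n + k) *\<^sub>d id0)"
proof (cases "0 \<le> n + k")
  case True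
  assume "0 \<le> n"
  then show ?thesis using True weyl_eq.b_pos[of n k] by (simp add: bval_def)
next
  case False
  assume "0 \<le> n"
  then have "weyl_eq n (Bk k) zero0" using False by (intro weyl_eq.b_neg) auto
  also have "weyl_eq n zero0 (0 *\<^sub>d id0)"
    using weyl_eq.scal_zero[of id0 n] by (auto intro: weyl_eq.sym)
  finally show ?thesis using False by (simp add: bval_def)
qed

lemma weyl_eq_bdag: "0 \<le> n \<Longrightarrow> weyl_eq n (bdag k) (bdval (n + k) *\<^sub>d id0)"
proof -
  assume n: "0 \<le> n"
  have "weyl_eq n (bdag k) (qint 2 *\<^sub>d id0 -\<^sub>d bval (n + (k - 1)) *\<^sub>d id0)"
    unfolding bdag_def using n
    by (intro weyl_eq.cong_add weyl_eq.cong_scal weyl_eq.relation r4a weyl_eq_Bk) simp_all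
  also have "weyl_eq n \<dots> (qint 2 *\<^sub>d id0 +\<^sub>d (-1 * bval (n + (k - 1))) *\<^sub>d id0)"
    by (intro weyl_eq.cong_add weyl_eq.scal_scal weyl_eq.refl) simp_all
  also have "weyl_eq n \<dots> ((qint 2 + -1 * bval (n + (k - 1))) *\<^sub>d id0)"
    by (intro weyl_eq.sym[OF weyl_eq.scal_add_left]) simp
  finally show ?thesis by (simp add: bdval_def add_diff_eq)
qed

lemma smul_minus_left [simp]: "(- a) *\<^sub>m x = - (a *\<^sub>m x)"
  by (metis smul_smul smul_neg_one mult_minus1)

lemma smul_minus_right [simp]: "a *\<^sub>m (- x) = - (a *\<^sub>m x)"
  by (metis smul_smul smul_neg_one mult_minus1_right smul_minus_left)

lemma smul_diff_right: "a *\<^sub>m (x - y) = a *\<^sub>m x - a *\<^sub>m y"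
  using smul_add_right[of a x "- y"] by simp

lemma smul_eq_0_iff [simp]: "a *\<^sub>m x = 0 \<longleftrightarrow> a = 0 \<or> x = 0"
proof
  assume "a *\<^sub>m x = 0"
  then have "(inverse a * a) *\<^sub>m x = 0" by (simp flip: smul_smul)
  then show "a = 0 \<or> x = 0" by (cases "a = 0") simp_all
qed auto

lemma smul_cancel: "a \<noteq> 0 \<Longrightarrow> a *\<^sub>m x = a *\<^sub>m y \<longleftrightarrow> x = y"
  using smul_eq_0_iff[of a "x - y"] by (simp add: smul_diff_right del: smul_eq_0_iff)

lemma wh_minus [simp]: "wh f (- x) = - wh f x"
  using wh_smul[of f "-1" x] by (simp add: smul_neg_one del: wh_smul)

lemma wh_diff: "wh f (x - y) = wh f x - wh f y"
  using wh_add[of f x "- y"] by simp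

notation wh (infixr "\<rhd>" 75)

lemma Bk_wh: "x \<in> homs N U V \<Longrightarrow> 0 \<le> N + wt U \<Longrightarrow> Bk k \<rhd> x = bval (N + wt U + k) *\<^sub>m x"
  using wh_level[OF _ weyl_eq_Bk] by (simp add: wh_dscal)

lemma bdag_wh: "x \<in> homs N U V \<Longrightarrow> 0 \<le> N + wt U \<Longrightarrow> bdag k \<rhd> x = bdval (N + wt U + k) *\<^sub>m x"
  using wh_level[OF _ weyl_eq_bdag] by (simp add: wh_dscal)

section \<open>Sliding morphisms past diagrams; bubbles, cups and caps in the ring\<close>

lemma wh_mult_right: "typed f \<Longrightarrow> f \<rhd> x * Ident (dm f) \<rhd> y = f \<rhd> (x * y)"
  by (subst wh_mult) (auto intro!: wh_cong weyl_eq.comp_id_right)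

lemma wh_mult_left: "typed f \<Longrightarrow> Ident (cd f) \<rhd> x * f \<rhd> y = f \<rhd> (x * y)"
  by (subst wh_mult) (auto intro!: wh_cong weyl_eq.comp_id_left)

lemma wh_ident_mult [simp]: "Ident U \<rhd> x * Ident U \<rhd> y = Ident U \<rhd> (x * y)"
  using wh_mult_right[of "Ident U"] by simp

lemma wh_closed_mult:
  assumes "typed z" "dm z = []" "cd z = []"
  shows "z \<rhd> x * y = z \<rhd> (x * y)" "x * z \<rhd> y = z \<rhd> (x * y)"
  using wh_mult_right[of z x y] wh_mult_left[of z x y] assms by simp_all

lemma cc_mult [simp]: "cc k \<rhd> x * y = cc k \<rhd> (x * y)" "x * cc k \<rhd> y = cc k \<rhd> (x * y)"
  by (rule wh_closed_mult; simp)+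

lemma closed_tens_comp:
  assumes "typed z" "dm z = []" "cd z = []" "typed w" "dm w = []" "cd w = []"
  shows "weyl_eq n (z \<otimes>\<^sub>d w) (z \<circ>\<^sub>d w)"
proof -
  have "weyl_eq n (z \<otimes>\<^sub>d w) ((z \<circ>\<^sub>d id0) \<otimes>\<^sub>d (id0 \<circ>\<^sub>d w))"
    using assms weyl_eq.comp_id_right[of z "n + wt (dm w)"] weyl_eq.comp_id_left[of w n]
    by (intro weyl_eq.sym[OF weyl_eq.cong_tens]) simp_all
  also have "weyl_eq n \<dots> ((z \<otimes>\<^sub>d id0) \<circ>\<^sub>d (id0 \<otimes>\<^sub>d w))"
    using assms by (intro weyl_eq.sym[OF weyl_eq.interchange]) simp_all
  also have "weyl_eq n \<dots> (z \<circ>\<^sub>d w)"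
    using assms by (intro weyl_eq.cong_comp weyl_eq.tens_unit_left weyl_eq.tens_unit_right) simp_all
  finally show ?thesis .
qed

lemma closed_wh_wh:
  assumes "typed z" "dm z = []" "cd z = []" "typed w" "dm w = []" "cd w = []"
  shows "z \<rhd> w \<rhd> x = (z \<circ>\<^sub>d w) \<rhd> x"
  unfolding wh_tens[symmetric] by (rule wh_cong, rule closed_tens_comp) fact+

lemma cc_neg [simp]: "k < 0 \<Longrightarrow> cc k \<rhd> x = 0"
  by (simp add: cc_def)

lemma cc_cc: "cc j \<rhd> cc k \<rhd> x = (if j = k then cc k \<rhd> x else 0)"
proof (cases "0 \<le> j \<and> 0 \<le> k")
  case True
  then show ?thesis using wh_rel[OF r8a[of j k]] by (simp add: closed_wh_wh)
next
  case False
  then show ?thesis by (cases "j < 0") auto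
qed

lemma cc_cc_same [simp]: "cc k \<rhd> cc k \<rhd> x = cc k \<rhd> x"
  by (simp add: cc_cc)

lemma cc_up_right: "0 \<le> k \<Longrightarrow> idP \<rhd> cc k \<rhd> x = cc k \<rhd> idP \<rhd> cc k \<rhd> x + cc (k + 1) \<rhd> idP \<rhd> cc k \<rhd> x"
  using wh_rel[OF r6b[of k], of x] by (simp add: wh_tens wh_dadd)

lemma cc_up_cc: "0 \<le> k \<Longrightarrow> j \<noteq> k \<Longrightarrow> j \<noteq> k + 1 \<Longrightarrow> cc j \<rhd> idP \<rhd> cc k \<rhd> x = 0"
  by (subst cc_up_right) (simp_all add: cc_cc)

lemma Eta_slide [simp]: "Eta \<rhd> x * y = Eta \<rhd> (x * y)" "idM \<rhd> idP \<rhd> y * Eta \<rhd> x = Eta \<rhd> (y * x)"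
  using wh_mult_right[of Eta x y] wh_mult_left[of Eta y x] wh_ident_append[of "[Dn]" "[Up]" y]
  by simp_all

lemma Eps_slide [simp]: "x * Eps \<rhd> y = Eps \<rhd> (x * y)" "Eps \<rhd> x * idM \<rhd> idP \<rhd> y = Eps \<rhd> (x * y)"
  using wh_mult_right[of Eps x y] wh_mult_left[of Eps x y] wh_ident_append[of "[Dn]" "[Up]" y]
  by simp_all

lemma Eta'_slide [simp]: "Eta' \<rhd> x * y = Eta' \<rhd> (x * y)" "idP \<rhd> idM \<rhd> y * Eta' \<rhd> x = Eta' \<rhd> (y * x)"
  using wh_mult_right[of Eta' x y] wh_mult_left[of Eta' y x] wh_ident_append[of "[Up]" "[Dn]" y]
  by simp_all

lemma Eps'_slide [simp]: "x * Eps' \<rhd> y = Eps' \<rhd> (x * y)" "Eps' \<rhd> x * idP \<rhd> idM \<rhd> y = Eps' \<rhd> (x * y)"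
  using wh_mult_right[of Eps' x y] wh_mult_left[of Eps' x y] wh_ident_append[of "[Up]" "[Dn]" y]
  by simp_all

lemma EE_slide [simp]: "EE \<rhd> x * idP \<rhd> idP \<rhd> y = EE \<rhd> (x * y)" "idP \<rhd> idP \<rhd> x * EE \<rhd> y = EE \<rhd> (x * y)"
  using wh_mult_right[of EE x y] wh_mult_left[of EE x y] wh_ident_append[of "[Up]" "[Up]"]
  by simp_all

text \<open>\<open>r4b\<close> read in the ring. Its coefficients \<open>Bk\<close> and
  \<open>bdag\<close> turn into scalars because the label N + wt U of the outer region is known; x,
  y, z are what happens to the right above, at and below the bubble.\<close>

lemma Eps_Eta_bubble:
  assumes "x * y * z \<in> homs N U V" "0 \<le> N + wt U" "0 \<le> k"
  shows "Eps \<rhd> x * (idM \<rhd> cc k \<rhd> idP \<rhd> y * Eta \<rhd> z)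
    = bval (N + wt U - 2 * k + 1) *\<^sub>m cc (k - 1) \<rhd> (x * y * z)
      + bdval (N + wt U - 2 * k) *\<^sub>m cc k \<rhd> (x * y * z)"
proof -
  have *: "cc j \<rhd> (x * y * z) \<in> homs N U V" for j
    using homs_wh[OF assms(1), of "cc j" "[]" "[]"] by simp
  have "Eps \<rhd> x * (idM \<rhd> cc k \<rhd> idP \<rhd> y * Eta \<rhd> z)
      = (Eps \<circ>\<^sub>d (idM \<otimes>\<^sub>d cc k \<otimes>\<^sub>d idP) \<circ>\<^sub>d Eta) \<rhd> (x * y * z)"
    by (simp add: wh_tens[symmetric] wh_mult mult.assoc)
  also have "\<dots> = Bk (- 2 * k + 1) \<rhd> cc (k - 1) \<rhd> (x * y * z) + bdag (- 2 * k) \<rhd> cc k \<rhd> (x * y * z)"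
    using wh_rel[OF r4b[OF assms(3)], of "x * y * z"] by (simp add: wh_dadd closed_wh_wh)
  also have "\<dots> = bval (N + wt U - 2 * k + 1) *\<^sub>m cc (k - 1) \<rhd> (x * y * z)
      + bdval (N + wt U - 2 * k) *\<^sub>m cc k \<rhd> (x * y * z)"
    unfolding Bk_wh[OF * assms(2)] bdag_wh[OF * assms(2)] by (simp add: algebra_simps)
  finally show ?thesis .
qed

lemma Eps'_Eta'_bubble:
  assumes "x * y * z \<in> homs N U V" "0 \<le> N + wt U" "0 \<le> k"
  shows "Eps' \<rhd> x * (idP \<rhd> cc k \<rhd> idM \<rhd> y * Eta' \<rhd> z)
    = bval (N + wt U - 2 * k - 1) *\<^sub>m cc k \<rhd> (x * y * z)
      + bdval (N + wt U - 2 * k - 2) *\<^sub>m cc (k + 1) \<rhd> (x * y * z)"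
proof -
  have *: "cc j \<rhd> (x * y * z) \<in> homs N U V" for j
    using homs_wh[OF assms(1), of "cc j" "[]" "[]"] by simp
  have "Eps' \<rhd> x * (idP \<rhd> cc k \<rhd> idM \<rhd> y * Eta' \<rhd> z)
      = (Eps' \<circ>\<^sub>d (idP \<otimes>\<^sub>d cc k \<otimes>\<^sub>d idM) \<circ>\<^sub>d Eta') \<rhd> (x * y * z)"
    by (simp add: wh_tens[symmetric] wh_mult mult.assoc)
  also have "\<dots> = Bk (- 2 * k - 1) \<rhd> cc k \<rhd> (x * y * z) + bdag (- 2 * k - 2) \<rhd> cc (k + 1) \<rhd> (x * y * z)"
    using wh_rel[OF r5b[OF assms(3)], of "x * y * z"] by (simp add: wh_dadd closed_wh_wh)
  also have "\<dots> = bval (N + wt U - 2 * k - 1) *\<^sub>m cc k \<rhd> (x * y * z)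
      + bdval (N + wt U - 2 * k - 2) *\<^sub>m cc (k + 1) \<rhd> (x * y * z)"
    unfolding Bk_wh[OF * assms(2)] bdag_wh[OF * assms(2)] by (simp add: algebra_simps)
  finally show ?thesis .
qed

text \<open>\<open>r10a\<close> and \<open>r10b\<close> treated together. They concern a downward
  and an upward strand with the bubble K between them and the bubble d on both sides, where K = d or
  K = d + 1: there a cap followed by a cup is, up to a scalar, the identity.\<close>

lemma cup_cap:
  assumes xh: "x \<in> homs N U V" and x: "x * x = x" "cc d \<rhd> x = x"
    and lev: "0 \<le> N + wt U" and d: "0 \<le> d" "K = d \<or> K = d + 1"
  shows "(if K = d then bval (N + wt U - 2 * K) else bdval (N + wt U - 2 * K + 1)) *\<^sub>m
      (idM \<rhd> cc K \<rhd> idP \<rhd> x * (Eta \<circ>\<^sub>d Eps) \<rhd> x * idM \<rhd> cc K \<rhd> idP \<rhd> x)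
    = cc d \<rhd> idM \<rhd> cc K \<rhd> idP \<rhd> x"
proof -
  define A where "A = idM \<rhd> cc K \<rhd> idP \<rhd> x"
  define g where "g = (if K = d then bval (N + wt U - 2 * K) else bdval (N + wt U - 2 * K + 1))"
  have comp: "(f \<circ>\<^sub>d g) \<rhd> x = f \<rhd> x * g \<rhd> x" if "typed (f \<circ>\<^sub>d g)" for f g
    using that by (simp add: wh_mult x)
  have xx: "(Eta \<circ>\<^sub>d Eps) \<rhd> x = Eta \<rhd> x * Eps \<rhd> x"
    by (simp only: comp[of Eta Eps] typed.simps dm.simps cd.simps)
  have bd: "bdag (- 2 * K + 1) \<rhd> x = g *\<^sub>m x" if "K = d + 1"
    using bdag_wh[OF xh lev, of "- 2 * K + 1"] that by (simp add: g_def algebra_simps)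
  have b: "Bk (- 2 * K) \<rhd> x = g *\<^sub>m x" if "K = d"
    using Bk_wh[OF xh lev, of "- 2 * K"] that by (simp add: g_def algebra_simps)
  have step: "A * (Eta \<rhd> x * ((cc d \<rhd> x * (g *\<^sub>m x)) * (Eps \<rhd> x * A)))
      = g *\<^sub>m (A * (Eta \<circ>\<^sub>d Eps) \<rhd> x * A)"
    unfolding x(2) smul_mult_left smul_mult_right x(1) xx mult.assoc
    unfolding mult.assoc[symmetric, of x "Eps \<rhd> x"] Eps_slide(1) x(1) ..
  from d(2) have "cc d \<rhd> A = g *\<^sub>m (A * (Eta \<circ>\<^sub>d Eps) \<rhd> x * A)"
  proof
    assume K: "K = d + 1"
    have "cc d \<rhd> A = A * (Eta \<rhd> x * ((cc d \<rhd> x * bdag (- 2 * K + 1) \<rhd> x) * (Eps \<rhd> x * A)))"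
      using wh_rel[OF r10b[of K], of x] K d(1) x(2)
      by (simp add: wh_tens comp A_def del: cc_mult)
    then show ?thesis unfolding bd[OF K] step .
  next
    assume K: "K = d"
    have "cc d \<rhd> A = A * (Eta \<rhd> x * ((cc d \<rhd> x * Bk (- 2 * K) \<rhd> x) * (Eps \<rhd> x * A)))"
      using wh_rel[OF r10a[of K], of x] K d(1) x(2)
      by (simp add: wh_tens comp A_def del: cc_mult)
    then show ?thesis unfolding b[OF K] step .
  qed
  then show ?thesis by (simp add: A_def g_def)
qed

text \<open>The relations describe bubbles next to upward strands. The downward strand is therefore
  written as a zigzag, \<open>r6a\<close> is applied to the upward part of it, and pulling the
  result through the cap exposes the bubbles at the left of the downward strand.\<close>

lemma cc_down_right:
  assumes "0 \<le> k" "z * z = z" "cc k \<rhd> z = z"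
  shows "idM \<rhd> z = cc k \<rhd> idM \<rhd> z + cc (k - 1) \<rhd> idM \<rhd> z"
proof -
  have up: "cc k \<rhd> idP \<rhd> x = cc k \<rhd> idP \<rhd> (cc k \<rhd> x + cc (k - 1) \<rhd> x)" for x
    using wh_rel[OF r6a[OF assms(1)], of x] by (simp add: wh_tens wh_dadd)
  define w where "w = cc k \<rhd> idM \<rhd> z + cc (k - 1) \<rhd> idM \<rhd> z"
  have zigzag: "Eps \<rhd> idM \<rhd> z * idM \<rhd> Eta' \<rhd> z = idM \<rhd> z"
    using wh_rel[OF zigzag4, of "z * z"] unfolding wh_tens[symmetric]
    by (subst wh_mult) (simp_all add: assms)
  have Ek: "cc k \<rhd> Eta' \<rhd> z = Eta' \<rhd> z"
    using cc_mult(2)[of "Eta' \<rhd> z" k z] by (simp add: assms)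
  have "idM \<rhd> Eta' \<rhd> z = idM \<rhd> (cc k \<rhd> idP \<rhd> idM \<rhd> z * Eta' \<rhd> z)"
    by (simp add: assms Ek)
  also have "\<dots> = idM \<rhd> (cc k \<rhd> idP \<rhd> w * Eta' \<rhd> z)"
    by (subst up) (simp only: w_def)
  also have "\<dots> = idM \<rhd> (idP \<rhd> w * cc k \<rhd> Eta' \<rhd> z)"
    by (simp only: cc_mult)
  also have "\<dots> = idM \<rhd> idP \<rhd> w * idM \<rhd> Eta' \<rhd> z"
    unfolding Ek by (simp only: wh_ident_mult)
  finally have "idM \<rhd> z = Eps \<rhd> idM \<rhd> z * idM \<rhd> idP \<rhd> w * idM \<rhd> Eta' \<rhd> z"
    using zigzag by (metis mult.assoc)
  also have "Eps \<rhd> idM \<rhd> z * idM \<rhd> idP \<rhd> w = w * Eps \<rhd> idM \<rhd> z"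
    unfolding Eps_slide w_def by (simp add: distrib_left distrib_right assms)
  also have "\<dots> * idM \<rhd> Eta' \<rhd> z = w"
    unfolding mult.assoc zigzag by (simp add: w_def distrib_right assms)
  finally show ?thesis unfolding w_def .
qed

text \<open>
  An idempotent \<open>e\<close> at level \<open>n\<close> that lies in the summand of the bubble \<open>k\<close>. By the relations 6
  there are two ways to add a strand on the left, namely to stay at \<open>k\<close> or to move to \<open>k + 1\<close>, and
  \<open>Q k\<close> and \<open>Q (k + 1)\<close> are the two summands of \<open>e\<close> with two strands added. The relations 11 determine
  the diagonal entries of \<open>E\<close> in this decomposition; its off-diagonal part is an isomorphism between
  the summands with left bubble \<open>k + 1\<close> (lemma \<open>QEQEQ\<close>).
\<close>

locale vertex =
  fixes e :: mor and N :: int and W :: word and n k :: int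
  assumes e_homs: "e \<in> homs N W W" and lev: "n = N + wt W" and n0: "0 \<le> n" and k0: "0 \<le> k"
    and e_idem [simp]: "e * e = e" and ck_e [simp]: "cc k \<rhd> e = e"
begin

lemma wh_comp_e: "typed (f \<circ>\<^sub>d g) \<Longrightarrow> (f \<circ>\<^sub>d g) \<rhd> e = f \<rhd> e * g \<rhd> e"
  by (simp add: wh_mult)

lemma cc_e: "j \<noteq> k \<Longrightarrow> cc j \<rhd> e = 0"
  using cc_cc[of j k e] by simp

lemma cc_up_e: "j \<noteq> k \<Longrightarrow> j \<noteq> k + 1 \<Longrightarrow> cc j \<rhd> idP \<rhd> e = 0"
  using cc_up_cc[OF k0, of j e] by simp

lemma up_e: "idP \<rhd> e = cc k \<rhd> idP \<rhd> e + cc (k + 1) \<rhd> idP \<rhd> e"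
  using cc_up_right[OF k0, of e] by simp

definition Q :: "int \<Rightarrow> mor" where "Q a = idP \<rhd> cc a \<rhd> idP \<rhd> e"

definition E :: mor where "E = EE \<rhd> e"

lemma Q_Q: "Q a * Q b = (if a = b then Q a else 0)"
  by (simp add: Q_def cc_cc)

lemma Q_sum: "Q k + Q (k + 1) = idP \<rhd> idP \<rhd> e"
  unfolding Q_def wh_add[symmetric] up_e[symmetric] ..

lemma Q_other: "a \<noteq> k \<Longrightarrow> a \<noteq> k + 1 \<Longrightarrow> Q a = 0"
  by (simp add: Q_def cc_up_e)

lemma E_unit: "E * idP \<rhd> idP \<rhd> e = E" "idP \<rhd> idP \<rhd> e * E = E"
  by (simp_all add: E_def)

text \<open>In \<open>r11\<close> the terms whose rightmost bubble is k - 1 are killed by e, and so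
  is the one with the bubble k - 1 between the strands, because \<open>Q (k - 1)\<close> is
  0.\<close>

lemma E_Q: "qint 2 *\<^sub>m (E * Q k) = qint 2 *\<^sub>m (Q (k + 1) * E)
    + bdval (n - 2 * k) *\<^sub>m cc (k + 1) \<rhd> Q k - bval (n - 2 * k - 1) *\<^sub>m cc (k + 1) \<rhd> Q (k + 1)"
proof -
  have b: "Bk j \<rhd> e = bval (n + j) *\<^sub>m e" "bdag j \<rhd> e = bdval (n + j) *\<^sub>m e" for j
    using Bk_wh[OF e_homs] bdag_wh[OF e_homs] n0 lev by simp_all
  have z: "Q (k - 1) = 0" by (simp add: Q_other)
  show ?thesis
    using wh_rel[OF r11[OF k0], of e]
    by (simp add: wh_tens wh_dadd wh_dscal wh_comp_e b cc_e smul_neg_one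
        flip: E_def Q_def) (simp add: z algebra_simps)
qed

lemma qint_2_nonzero: "qint 2 \<noteq> 0"
  by (simp add: qint_nonzero)

lemma cc_Q_same: "cc k \<rhd> Q (k + 1) = 0"
  using cc_up_cc[of "k + 1" k "idP \<rhd> e"] k0 by (simp add: Q_def)

lemma cc_Q_plus2: "cc (k + 2) \<rhd> Q k = 0"
  using cc_up_cc[of k "k + 2" "idP \<rhd> e"] k0 by (simp add: Q_def)

text \<open>In these names T is a step that stays at k and F a step that raises it. Left bubble k
  admits the steps T, T only, and applying \<open>cc k\<close> to \<open>E_Q\<close> kills its whole
  right-hand side.\<close>

lemma cc_E_TT: "cc k \<rhd> E = 0"
proof -
  have "qint 2 *\<^sub>m cc k \<rhd> (E * Q k) = 0"
    using arg_cong[OF E_Q, of "wh (cc k)"] cc_Q_same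
    by (simp add: wh_diff cc_cc flip: cc_mult(1))
  then have "E * cc k \<rhd> Q k = 0" using qint_2_nonzero by simp
  moreover have "cc k \<rhd> E = E * cc k \<rhd> Q k + E * cc k \<rhd> Q (k + 1)"
    unfolding distrib_left[symmetric] wh_add[symmetric] Q_sum by (simp add: E_unit)
  ultimately show ?thesis by (simp add: cc_Q_same)
qed

lemma cc_E_FF: "cc (k + 2) \<rhd> E = 0"
proof -
  have "qint 2 *\<^sub>m cc (k + 2) \<rhd> (Q (k + 1) * E) = 0"
    using arg_cong[OF E_Q, of "wh (cc (k + 2))"] cc_Q_plus2
    by (simp add: wh_diff cc_cc flip: cc_mult(2))
  then have "cc (k + 2) \<rhd> Q (k + 1) * E = 0" using qint_2_nonzero by simp
  moreover have "cc (k + 2) \<rhd> E = cc (k + 2) \<rhd> Q k * E + cc (k + 2) \<rhd> Q (k + 1) * E"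
    unfolding distrib_right[symmetric] wh_add[symmetric] Q_sum by (simp add: E_unit)
  ultimately show ?thesis by (simp add: cc_Q_plus2)
qed

lemma E_diag_TF: "qint 2 *\<^sub>m (Q k * E * Q k) = bdval (n - 2 * k) *\<^sub>m cc (k + 1) \<rhd> Q k"
  using arg_cong[OF E_Q, of "(*) (Q k)"]
  by (simp add: distrib_left right_diff_distrib Q_Q mult.assoc[symmetric])

lemma E_diag_FT:
  "qint 2 *\<^sub>m (Q (k + 1) * E * Q (k + 1)) = bval (n - 2 * k - 1) *\<^sub>m cc (k + 1) \<rhd> Q (k + 1)"
  using arg_cong[OF E_Q, of "\<lambda>x. x * Q (k + 1)"]
  by (simp add: distrib_right left_diff_distrib Q_Q mult.assoc)

text \<open>The downward strand is closed up by \<open>Eps'\<close> and \<open>Eta'\<close>, which costs only a nonzero scalar.\<close>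

lemma peel_down:
  assumes "y \<in> homs N V V" "wt V = wt W + 2" "cc d \<rhd> idM \<rhd> y = 0" "cc (k + 1) \<rhd> y = y"
    "d = k \<or> d = k + 1 \<and> 2 * k + 1 \<le> n" "2 * k \<le> n"
  shows "y = 0"
proof -
  let ?i = "mk N (Ident V)"
  have i: "?i * y * ?i = y"
    using assms(1) by (simp add: ident_mult_left ident_mult_right)
  have "Eps' \<rhd> ?i * (idP \<rhd> cc d \<rhd> idM \<rhd> y * Eta' \<rhd> ?i) = 0"
    using assms(3) by simp
  also have "Eps' \<rhd> ?i * (idP \<rhd> cc d \<rhd> idM \<rhd> y * Eta' \<rhd> ?i)
    = bval (n + 2 - 2 * d - 1) *\<^sub>m cc d \<rhd> y + bdval (n + 2 - 2 * d - 2) *\<^sub>m cc (d + 1) \<rhd> y"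
  proof -
    have "?i * y * ?i \<in> homs N V V" using assms(1) by (simp add: i)
    moreover have "N + wt V = n + 2" using assms(2) lev by simp
    ultimately show ?thesis
      using Eps'_Eta'_bubble[of ?i y ?i N V V d, unfolded i] assms(1,5) n0 k0 by auto
  qed
  finally have *: "bval (n + 2 - 2 * d - 1) *\<^sub>m cc d \<rhd> y + bdval (n + 2 - 2 * d - 2) *\<^sub>m cc (d + 1) \<rhd> y = 0"
    by simp
  have c: "cc j \<rhd> y = (if j = k + 1 then y else 0)" for j
    using assms(4) cc_cc[of j "k + 1" y] by simp
  \<comment> \<open>Since y belongs to the bubble k + 1, one term of the circle remains: its
    coefficient is \<open>bdval (n - 2 * k)\<close> for d = k and
    \<open>bval (n - 2 * k - 1)\<close> for d = k + 1, nonzero under the stated bounds.\<close>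
  from assms(5) show ?thesis
  proof (elim disjE conjE)
    assume "d = k"
    with * show ?thesis using assms(6) bdval_nonzero[of "n - 2 * k"] unfolding c by simp
  next
    assume "d = k + 1" "2 * k + 1 \<le> n"
    with * show ?thesis using bval_nonzero[of "n - 2 * k - 1"] unfolding c by simp
  qed
qed

text \<open>The scalar of \<open>cup_cap\<close> for the middle bubble k + 1 at label n + 1. By
  \<open>E_diag_TF\<close> and \<open>E_diag_FT\<close> it is at the same time the diagonal entry of
  \<open>qint 2 *\<^sub>m E\<close> at \<open>Q d\<close>, for d = k and d = k + 1.\<close>

definition gam :: "int \<Rightarrow> Cq" where
  "gam d = (if d = k then bdval (n - 2 * k) else bval (n - 2 * k - 1))"

lemma cup_cap_Q:
  assumes "d = k \<or> d = k + 1"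
  shows "gam d *\<^sub>m (idM \<rhd> cc (k + 1) \<rhd> Q d * (Eta \<circ>\<^sub>d Eps) \<rhd> cc d \<rhd> idP \<rhd> e
      * idM \<rhd> cc (k + 1) \<rhd> Q d) = cc d \<rhd> idM \<rhd> cc (k + 1) \<rhd> Q d"
proof -
  have x: "cc d \<rhd> idP \<rhd> e \<in> homs N ([Up] @ W) ([Up] @ W)"
    using homs_wh[OF homs_wh[OF e_homs], of idP "[Up]" "[Up]" "cc d" "[]" "[]"] by simp
  have lev': "N + wt ([Up] @ W) = n + 1" using lev by (simp add: wt_def)
  have g: "gam d = (if k + 1 = d then bval (n + 1 - 2 * (k + 1)) else bdval (n + 1 - 2 * (k + 1) + 1))"
    using assms by (auto simp: gam_def algebra_simps)
  have "0 \<le> N + wt ([Up] @ W)" "0 \<le> d" "k + 1 = d \<or> k + 1 = d + 1"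
    using assms n0 k0 lev' by auto
  from cup_cap[OF x _ _ this] show ?thesis unfolding Q_def g lev' by (simp add: add.commute)
qed

lemma cc_E [simp]: "cc (k + 1) \<rhd> E = E"
proof -
  have Qd: "Q a = cc a \<rhd> Q a + cc (a + 1) \<rhd> Q a" if "0 \<le> a" for a
    using cc_up_right[OF that, of "idP \<rhd> e"] by (simp add: Q_def)
  have "E = Q k * E + Q (k + 1) * E"
    unfolding distrib_right[symmetric] Q_sum by (simp add: E_unit)
  also have "\<dots> = (cc k \<rhd> Q k + cc (k + 1) \<rhd> Q k) * E + (cc (k + 1) \<rhd> Q (k + 1) + cc (k + 1 + 1) \<rhd> Q (k + 1)) * E"
    using Qd[of k] Qd[of "k + 1"] k0 by simp
  also have "\<dots> = Q k * cc k \<rhd> E + cc (k + 1) \<rhd> ((Q k + Q (k + 1)) * E) + Q (k + 1) * cc (k + 2) \<rhd> E"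
    by (simp add: distrib_right add.assoc)
  also have "\<dots> = cc (k + 1) \<rhd> E"
    unfolding cc_E_TT cc_E_FF Q_sum by (simp add: E_unit)
  finally show ?thesis by simp
qed

text \<open>\<open>r2b\<close> puts a cap and a cup between two copies of \<open>E\<close>. There
  the region between the two upward strands is joined to the leftmost one, so that left bubble d
  leaves only \<open>Q d\<close>, and on this summand \<open>cup_cap\<close> replaces cap and cup by
  a scalar.\<close>

lemma E_EQE:
  assumes d: "d = k \<or> d = k + 1"
  shows "cc d \<rhd> idM \<rhd> (gam d *\<^sub>m E) = cc d \<rhd> idM \<rhd> (qint 2 *\<^sub>m (E * Q d * E))"
proof -
  define y where "y = idP \<rhd> e"
  have y: "y * y = y" by (simp add: y_def)
  define H where "H = (Eta \<circ>\<^sub>d Eps) \<rhd> y"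
  \<comment> \<open>Fixes the bubble k + 1 in the region to the right of the downward strand, as
    \<open>cup_cap_Q\<close> requires. Both copies of \<open>E\<close> absorb c by
    \<open>cc_E\<close>, so it can be inserted freely.\<close>
  define c where "c = idM \<rhd> cc (k + 1) \<rhd> idP \<rhd> idP \<rhd> e"
  have cd: "idM \<rhd> idP \<rhd> x * H * idM \<rhd> idP \<rhd> z = (Eta \<circ>\<^sub>d Eps) \<rhd> (x * y * z)" for x z
    using wh_mult_left[of "Eta \<circ>\<^sub>d Eps" x y] wh_mult_right[of "Eta \<circ>\<^sub>d Eps" "x * y" z]
      wh_ident_append[of "[Dn]" "[Up]"]
    by (simp add: H_def)
  have QH: "idM \<rhd> Q a * H * idM \<rhd> Q b = (if a = b then (Eta \<circ>\<^sub>d Eps) \<rhd> cc a \<rhd> y else 0)" for a b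
    using cd[of "cc a \<rhd> y" "cc b \<rhd> y"] by (simp add: Q_def y cc_cc flip: y_def)
  have ME: "idM \<rhd> E * idM \<rhd> (Q k + Q (k + 1)) = idM \<rhd> E" "idM \<rhd> (Q k + Q (k + 1)) * idM \<rhd> E = idM \<rhd> E"
    by (simp_all only: Q_sum wh_ident_mult E_unit)
  have r2: "qint 2 *\<^sub>m (idM \<rhd> E * H * idM \<rhd> E) = idM \<rhd> E"
  proof -
    have "qint 2 ^ 2 *\<^sub>m (idM \<rhd> E * (H * idM \<rhd> E)) = qint 2 *\<^sub>m idM \<rhd> E"
      using wh_rel[OF r2b, of e] by (simp add: wh_tens wh_dscal wh_comp_e H_def E_def y_def)
    then have "qint 2 *\<^sub>m (qint 2 *\<^sub>m (idM \<rhd> E * H * idM \<rhd> E)) = qint 2 *\<^sub>m idM \<rhd> E"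
      by (simp add: power2_eq_square mult.assoc)
    then show ?thesis using smul_cancel[OF qint_2_nonzero] by metis
  qed
  have slide: "(Eta \<circ>\<^sub>d Eps) \<rhd> cc a \<rhd> y = cc a \<rhd> H" for a
  proof -
    have "(Eta \<circ>\<^sub>d Eps) \<rhd> cc a \<rhd> y = Eta \<rhd> y * Eps \<rhd> cc a \<rhd> y"
      by (simp add: wh_mult y del: Eta_slide Eps_slide)
    also have "\<dots> = Eta \<rhd> y * (cc a \<rhd> y * Eps \<rhd> y)"
      by (simp only: Eps_slide(1) cc_mult y)
    also have "\<dots> = cc a \<rhd> (Eta \<rhd> y * Eps \<rhd> y)"
      by (simp only: cc_mult mult.assoc[symmetric] Eta_slide(1) y)
    finally show ?thesis by (simp add: wh_mult y H_def del: Eta_slide Eps_slide)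
  qed
  define G where "G = (Eta \<circ>\<^sub>d Eps) \<rhd> cc d \<rhd> y"
  have "idM \<rhd> E * H * idM \<rhd> E = idM \<rhd> E * (idM \<rhd> (Q k + Q (k + 1)) * H * idM \<rhd> (Q k + Q (k + 1))) * idM \<rhd> E"
    using ME by (metis mult.assoc)
  also have "idM \<rhd> (Q k + Q (k + 1)) * H * idM \<rhd> (Q k + Q (k + 1)) = cc k \<rhd> H + cc (k + 1) \<rhd> H"
    unfolding wh_add distrib_left distrib_right QH slide by simp
  finally have "cc d \<rhd> (idM \<rhd> E * H * idM \<rhd> E) = idM \<rhd> E * (cc d \<rhd> (cc k \<rhd> H + cc (k + 1) \<rhd> H)) * idM \<rhd> E"
    by (simp only: cc_mult)
  also have "cc d \<rhd> (cc k \<rhd> H + cc (k + 1) \<rhd> H) = G"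
    unfolding G_def slide wh_add using d by (auto simp: cc_cc)
  finally have r2G: "cc d \<rhd> idM \<rhd> E = qint 2 *\<^sub>m (idM \<rhd> E * G * idM \<rhd> E)"
    using arg_cong[OF r2, of "wh (cc d)"] by simp
  have G: "idM \<rhd> Q d * G * idM \<rhd> Q d = G"
  proof -
    have "idM \<rhd> Q d * (idM \<rhd> Q d * H * idM \<rhd> Q d) * idM \<rhd> Q d
        = (idM \<rhd> Q d * idM \<rhd> Q d) * H * (idM \<rhd> Q d * idM \<rhd> Q d)"
      by (simp only: mult.assoc)
    then show ?thesis using QH[of d d] by (simp add: G_def Q_Q)
  qed
  have cE: "c * idM \<rhd> E = idM \<rhd> E" "idM \<rhd> E * c = idM \<rhd> E"
    "c * idM \<rhd> Q d = idM \<rhd> cc (k + 1) \<rhd> Q d" "idM \<rhd> Q d * c = idM \<rhd> cc (k + 1) \<rhd> Q d"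
    by (simp_all add: c_def E_unit Q_def)
  have cGc: "gam d *\<^sub>m (c * G * c) = cc d \<rhd> (c * idM \<rhd> Q d)"
  proof -
    have "gam d *\<^sub>m ((c * idM \<rhd> Q d) * G * (idM \<rhd> Q d * c)) = cc d \<rhd> (c * idM \<rhd> Q d)"
      unfolding cE G_def y_def by (rule cup_cap_Q[OF d])
    also have "(c * idM \<rhd> Q d) * G * (idM \<rhd> Q d * c) = c * (idM \<rhd> Q d * G * idM \<rhd> Q d) * c"
      by (simp only: mult.assoc)
    finally show ?thesis unfolding G .
  qed
  have "cc d \<rhd> idM \<rhd> (gam d *\<^sub>m E) = qint 2 *\<^sub>m gam d *\<^sub>m (idM \<rhd> E * G * idM \<rhd> E)"
    using r2G by (simp add: mult.commute)
  also have "idM \<rhd> E * G * idM \<rhd> E = idM \<rhd> E * (c * G * c) * idM \<rhd> E"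
    using cE by (metis mult.assoc)
  also have "gam d *\<^sub>m \<dots> = idM \<rhd> E * (gam d *\<^sub>m (c * G * c)) * idM \<rhd> E"
    by (simp only: smul_mult_left smul_mult_right)
  also have "\<dots> = cc d \<rhd> ((idM \<rhd> E * c) * idM \<rhd> Q d * idM \<rhd> E)"
    unfolding cGc by (simp only: cc_mult mult.assoc)
  also have "\<dots> = cc d \<rhd> idM \<rhd> (E * Q d * E)"
    unfolding cE by simp
  finally show ?thesis by simp
qed

lemma E_homs: "E \<in> homs N ([Up, Up] @ W) ([Up, Up] @ W)"
  unfolding E_def by (rule homs_wh[OF e_homs]) simp_all

lemma Q_homs: "Q a \<in> homs N ([Up, Up] @ W) ([Up, Up] @ W)"
proof -
  have "Q a = (idP \<otimes>\<^sub>d cc a \<otimes>\<^sub>d idP) \<rhd> e" by (simp add: Q_def wh_tens)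
  then show ?thesis using homs_wh[OF e_homs, of "idP \<otimes>\<^sub>d cc a \<otimes>\<^sub>d idP" "[Up, Up]" "[Up, Up]"] by simp
qed

text \<open>With the downward strand of \<open>E_EQE\<close> removed by \<open>peel_down\<close>,
  this says that \<open>qint 2 *\<^sub>m E\<close> has rank one. The bounds on d keep the scalar of
  the closing circle nonzero.\<close>

lemma EQE:
  assumes "d = k \<or> d = k + 1 \<and> 2 * k + 1 \<le> n" "2 * k \<le> n"
  shows "qint 2 *\<^sub>m (E * Q d * E) = gam d *\<^sub>m E"
proof -
  have "gam d *\<^sub>m E - qint 2 *\<^sub>m (E * Q d * E) = 0"
  proof (rule peel_down[of _ "[Up, Up] @ W"])
    have "- (qint 2 *\<^sub>m (E * Q d * E)) = (- qint 2) *\<^sub>m (E * Q d * E)" by simp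
    then have "gam d *\<^sub>m E - qint 2 *\<^sub>m (E * Q d * E) = gam d *\<^sub>m E + (- qint 2) *\<^sub>m (E * Q d * E)"
      by (simp only: diff_conv_add_uminus)
    then show "gam d *\<^sub>m E - qint 2 *\<^sub>m (E * Q d * E) \<in> homs N ([Up, Up] @ W) ([Up, Up] @ W)"
      by (simp only:) (intro homs_add homs_smul homs_mult[of _ _ "[Up, Up] @ W"] E_homs Q_homs)
    show "cc d \<rhd> idM \<rhd> (gam d *\<^sub>m E - qint 2 *\<^sub>m (E * Q d * E)) = 0"
      using E_EQE[of d] assms(1) by (auto simp: wh_diff)
    show "cc (k + 1) \<rhd> (gam d *\<^sub>m E - qint 2 *\<^sub>m (E * Q d * E)) = gam d *\<^sub>m E - qint 2 *\<^sub>m (E * Q d * E)"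
      by (simp add: wh_diff flip: cc_mult(2))
  qed (use assms in \<open>auto simp: wt_def\<close>)
  then show ?thesis by simp
qed

text \<open>In a 2-by-2 matrix of rank one the product of the off-diagonal entries equals that of
  the diagonal ones; this is the latter product for \<open>E\<close>.\<close>

definition kap :: Cq where
  "kap = bval (n - 2 * k - 1) * bdval (n - 2 * k) / (qint 2 * qint 2)"

lemma kap_nonzero: "2 * k + 1 \<le> n \<Longrightarrow> kap \<noteq> 0"
  using bval_nonzero[of "n - 2 * k - 1"] bdval_nonzero[of "n - 2 * k"] qint_2_nonzero
  by (simp add: kap_def)

lemma QEQEQ_aux:
  assumes d: "d = k \<or> d = k + 1 \<and> 2 * k + 1 \<le> n" "2 * k \<le> n"
    and a: "qint 2 *\<^sub>m (Q a * E * Q a) = c *\<^sub>m cc (k + 1) \<rhd> Q a"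
    and c: "gam d * c = bval (n - 2 * k - 1) * bdval (n - 2 * k)"
  shows "Q a * E * Q d * E * Q a = kap *\<^sub>m cc (k + 1) \<rhd> Q a"
proof -
  have q: "qint 2 * qint 2 \<noteq> 0" using qint_2_nonzero by simp
  have "(qint 2 * qint 2) *\<^sub>m (Q a * E * Q d * E * Q a) = qint 2 *\<^sub>m (Q a * (qint 2 *\<^sub>m (E * Q d * E)) * Q a)"
    by (simp add: mult.assoc)
  also have "\<dots> = gam d *\<^sub>m (qint 2 *\<^sub>m (Q a * E * Q a))"
    unfolding EQE[OF d] by (simp add: mult.commute)
  also have "\<dots> = (qint 2 * qint 2) *\<^sub>m kap *\<^sub>m cc (k + 1) \<rhd> Q a"
    unfolding a using q by (simp add: c kap_def)
  finally show ?thesis using smul_cancel[OF q] by metis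
qed

lemma QEQEQ:
  assumes "2 * k + 1 \<le> n"
  shows "Q (k + 1) * E * Q k * E * Q (k + 1) = kap *\<^sub>m cc (k + 1) \<rhd> Q (k + 1)"
    "Q k * E * Q (k + 1) * E * Q k = kap *\<^sub>m cc (k + 1) \<rhd> Q k"
  by (rule QEQEQ_aux[OF _ _ E_diag_FT] QEQEQ_aux[OF _ _ E_diag_TF];
      use assms in \<open>simp add: gam_def\<close>)+

end

section \<open>The idempotents of the vertices and the steps between them\<close>

definition ups :: "nat \<Rightarrow> word" where "ups n = replicate n Up"

lemma wt_ups [simp]: "wt (ups n) = int n"
  by (induction n) (simp_all add: ups_def wt_def)

lemma ups_Suc: "Up # ups n = ups (Suc n)"
  by (simp add: ups_def)

text \<open>
  The idempotent of the path from the vertex \<open>(0, 0)\<close> to \<open>(n, k)\<close> in the Bratteli diagram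
  which first keeps the second index constant and then raises it in each step.
\<close>

fun ev :: "nat \<Rightarrow> nat \<Rightarrow> mor" where
  "ev n 0 = cc 0 \<rhd> mk 0 (Ident (ups n))"
| "ev 0 (Suc k) = 0"
| "ev (Suc n) (Suc k) = cc (int k + 1) \<rhd> idP \<rhd> ev n k"

lemma ev_homs: "ev n k \<in> homs 0 (ups n) (ups n)"
proof (induction n k rule: ev.induct)
  case (1 n)
  then show ?case using homs_wh[OF mk_homs, of "Ident (ups n)" "ups n" "ups n" "cc 0" "[]" "[]" 0] by simp
next
  case (2 k)
  then show ?case by simp
next
  case (3 n k)
  have "(cc (int k + 1) \<otimes>\<^sub>d idP) \<rhd> ev n k \<in> homs 0 ([Up] @ ups n) ([Up] @ ups n)"
    by (rule homs_wh[OF 3]) simp_all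
  then show ?case by (simp add: wh_tens ups_Suc)
qed

lemma ev_idem [simp]: "ev n k * ev n k = ev n k"
proof (induction n k rule: ev.induct)
  case (1 n)
  then show ?case using ident_mult_left[OF mk_homs, of "Ident (ups n)" "ups n" "ups n" 0] by simp
qed simp_all

lemma cc_ev [simp]: "cc (int k) \<rhd> ev n k = ev n k"
  by (cases n; cases k) (simp_all add: add.commute)

lemma wh_bubble_zero:
  assumes "x \<in> homs N U V" "0 \<le> N + wt U" "N + wt U < 2 * k"
  shows "cc k \<rhd> x = 0"
  using wh_level[OF assms(1) weyl_eq.bubble_zero[OF assms(2,3)]] by simp

lemma ev_invalid: "n < 2 * k \<Longrightarrow> ev n k = 0"
  using wh_bubble_zero[OF ev_homs[of n k], of "int k"] by simp

interpretation vx: vertex "ev n k" 0 "ups n" "int n" "int k" for n k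
  by unfold_locales (simp_all add: ev_homs)

abbreviation QQ :: "nat \<Rightarrow> nat \<Rightarrow> int \<Rightarrow> mor" where "QQ n k \<equiv> vertex.Q (ev n k)"
abbreviation EV :: "nat \<Rightarrow> nat \<Rightarrow> mor" where "EV n k \<equiv> vertex.E (ev n k)"
abbreviation kp :: "nat \<Rightarrow> nat \<Rightarrow> Cq" where "kp n k \<equiv> vertex.kap (int n) (int k)"

text \<open>
  Mutually inverse isomorphisms between \<open>ev (n + 1) k\<close> and \<open>cc k \<rhd> idP \<rhd> ev n k\<close>, for the step that
  is not built into \<open>ev\<close>: this step is moved past the steps of the path one at a time by means of \<open>E\<close>.
\<close>

fun tT :: "nat \<Rightarrow> nat \<Rightarrow> mor" where
  "tT n 0 = ev (Suc n) 0"
| "tT 0 (Suc k) = 0"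
| "tT (Suc n) (Suc k) = cc (int k + 1) \<rhd> QQ n k (int k + 1) * EV n k * idP \<rhd> tT n k"

fun sT :: "nat \<Rightarrow> nat \<Rightarrow> mor" where
  "sT n 0 = ev (Suc n) 0"
| "sT 0 (Suc k) = 0"
| "sT (Suc n) (Suc k) =
     inverse (kp n k) *\<^sub>m (idP \<rhd> sT n k * EV n k * cc (int k + 1) \<rhd> QQ n k (int k + 1))"

lemma ups_mk: "idP \<rhd> mk N (Ident (ups n)) = mk N (Ident (ups (Suc n)))"
  using mk_cong[OF weyl_eq.tens_id[of N "[Up]" "ups n"]] by (simp add: wh_mk ups_Suc)

text \<open>The bubble 0 can be reached from the bubble 0 only. Hence cutting the identity of
  \<open>ups n\<close> by a bubble 0 at the far left cuts it in every region, and
  \<open>ev n 0\<close> too is built up strand by strand.\<close>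

lemma cc0_up: "cc 0 \<rhd> idP \<rhd> cc 0 \<rhd> x = cc 0 \<rhd> idP \<rhd> x"
  using wh_rel[OF r6a[of 0], of x] by (simp add: wh_tens wh_dadd)

lemma ev_Suc_0: "ev (Suc n) 0 = cc 0 \<rhd> idP \<rhd> ev n 0"
  by (simp add: cc0_up ups_mk)

lemma Q_eq_up_ev: "QQ n k (int k + 1) = idP \<rhd> ev (Suc n) (Suc k)"
  by (simp add: vx.Q_def)

text \<open>The path of \<open>ev\<close> to (n + 1, k + 1) ends with a raising step from (n, k),
  the one to (n + 2, k + 1) with a raising step from (n + 1, k). \<open>E\<close> exchanges the
  orders raise-stay and stay-raise, the induction hypothesis treats the staying step at (n, k), and
  \<open>QEQEQ\<close> inverts the exchange up to the factor \<open>kp n k\<close>.\<close>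

lemma T_edge:
  "2 * k \<le> n \<Longrightarrow> sT n k * tT n k = ev (Suc n) k \<and> tT n k * sT n k = cc (int k) \<rhd> idP \<rhd> ev n k
     \<and> cc (int k) \<rhd> idP \<rhd> ev n k * tT n k = tT n k \<and> sT n k * cc (int k) \<rhd> idP \<rhd> ev n k = sT n k"
proof (induction n k rule: ev.induct)
  case (1 n)
  have e: "ev (Suc n) 0 * ev (Suc n) 0 = ev (Suc n) 0" by (rule ev_idem)
  have "cc (int 0) \<rhd> idP \<rhd> ev n 0 = ev (Suc n) 0" by (simp only: ev_Suc_0 of_nat_0)
  then show ?case by (simp only: tT.simps sT.simps e simp_thms)
next
  case (3 n k)
  define A B E c where "A = QQ n k (int k + 1)" and "B = QQ n k (int k)" and "E = EV n k"
    and "c = cc (int k + 1)"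
  have kap: "kp n k \<noteq> 0" using 3(2) by (intro vx.kap_nonzero) simp
  have IH: "sT n k * tT n k = ev (Suc n) k" "tT n k * sT n k = cc (int k) \<rhd> idP \<rhd> ev n k"
    "cc (int k) \<rhd> idP \<rhd> ev n k * tT n k = tT n k" "sT n k * cc (int k) \<rhd> idP \<rhd> ev n k = sT n k"
    using 3 by auto
  have B: "idP \<rhd> tT n k * idP \<rhd> sT n k = B" "B * idP \<rhd> tT n k = idP \<rhd> tT n k"
    "idP \<rhd> sT n k * B = idP \<rhd> sT n k" "idP \<rhd> sT n k * idP \<rhd> tT n k = idP \<rhd> ev (Suc n) k"
    by (simp_all only: B_def vx.Q_def wh_ident_mult IH)
  have AA: "A * A = A" by (simp add: A_def vx.Q_Q)
  have cm: "c \<rhd> x * y = c \<rhd> (x * y)" "x * c \<rhd> y = c \<rhd> (x * y)" "c \<rhd> c \<rhd> x = c \<rhd> x" for x y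
    by (simp_all add: c_def)
  have q: "A * E * B * E * A = kp n k *\<^sub>m c \<rhd> A" "B * E * A * E * B = kp n k *\<^sub>m c \<rhd> B"
    using vx.QEQEQ[where n = n and k = k] 3(2) by (simp_all add: A_def B_def E_def c_def)
  have t: "tT (Suc n) (Suc k) = c \<rhd> A * E * idP \<rhd> tT n k"
    and s: "sT (Suc n) (Suc k) = inverse (kp n k) *\<^sub>m (idP \<rhd> sT n k * E * c \<rhd> A)"
    by (simp_all add: A_def E_def c_def)
  have p: "cc (int (Suc k)) \<rhd> idP \<rhd> ev (Suc n) (Suc k) = c \<rhd> A"
    unfolding A_def c_def Q_eq_up_ev of_nat_Suc by (simp only: add.commute)
  have "sT (Suc n) (Suc k) * tT (Suc n) (Suc k)
      = inverse (kp n k) *\<^sub>m c \<rhd> (idP \<rhd> sT n k * (E * (A * A) * E) * idP \<rhd> tT n k)"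
    unfolding s t by (simp only: smul_mult_left cm mult.assoc wh_smul)
  also have "\<dots> = inverse (kp n k) *\<^sub>m c \<rhd> ((idP \<rhd> sT n k * B) * (E * A * E) * (B * idP \<rhd> tT n k))"
    by (simp only: B AA)
  also have "\<dots> = inverse (kp n k) *\<^sub>m c \<rhd> (idP \<rhd> sT n k * (B * E * A * E * B) * idP \<rhd> tT n k)"
    by (simp only: mult.assoc)
  also have "\<dots> = (inverse (kp n k) * kp n k) *\<^sub>m c \<rhd> (idP \<rhd> sT n k * B * idP \<rhd> tT n k)"
    unfolding q by (simp only: smul_mult_left smul_mult_right wh_smul smul_smul cm)
  also have "\<dots> = ev (Suc (Suc n)) (Suc k)"
    unfolding B by (simp add: kap c_def)
  finally have 1: "sT (Suc n) (Suc k) * tT (Suc n) (Suc k) = ev (Suc (Suc n)) (Suc k)" .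
  have "tT (Suc n) (Suc k) * sT (Suc n) (Suc k)
      = inverse (kp n k) *\<^sub>m c \<rhd> (A * E * (idP \<rhd> tT n k * idP \<rhd> sT n k) * E * A)"
    unfolding s t by (simp only: smul_mult_left smul_mult_right cm mult.assoc wh_smul)
  also have "\<dots> = c \<rhd> A"
    unfolding B q by (simp add: kap cm)
  finally have 2: "tT (Suc n) (Suc k) * sT (Suc n) (Suc k) = c \<rhd> A" .
  have 3: "c \<rhd> A * tT (Suc n) (Suc k) = tT (Suc n) (Suc k)"
    unfolding t by (simp only: cm mult.assoc[symmetric] AA)
  have 4: "sT (Suc n) (Suc k) * c \<rhd> A = sT (Suc n) (Suc k)"
    unfolding s by (simp only: cm smul_mult_left mult.assoc AA wh_smul)
  show ?case using 1 2 3 4 unfolding p by simp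
qed simp

text \<open>The value in the summand (n, j) of a circle around the bubble k, read off from
  \<open>Eps_Eta_bubble\<close>; it normalizes the projections along downward edges.\<close>

definition mu :: "nat \<Rightarrow> nat \<Rightarrow> nat \<Rightarrow> Cq" where
  "mu n j k = (if j = k then bdval (int n - 2 * int k) else bval (int n - 2 * int k + 1))"

text \<open>
  \<open>edge sg n k m j t s\<close>: a strand \<open>sg\<close> added on the left of the vertex \<open>(n, k)\<close> leads to \<open>(m, j)\<close>,
  with inclusion \<open>t\<close> and projection \<open>s\<close> of the summand \<open>ev m j\<close> of \<open>Ident [sg] \<rhd> ev n k\<close>. Those for
  downward strands are the mates of those for upward strands.
\<close>

inductive edge :: "sign \<Rightarrow> nat \<Rightarrow> nat \<Rightarrow> nat \<Rightarrow> nat \<Rightarrow> mor \<Rightarrow> mor \<Rightarrow> bool" where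
  T: "2 * k \<le> n \<Longrightarrow> edge Up n k (Suc n) k (tT n k) (sT n k)"
| F: "2 * k + 1 \<le> n \<Longrightarrow> edge Up n k (Suc n) (Suc k) (ev (Suc n) (Suc k)) (ev (Suc n) (Suc k))"
| D: "edge Up n j (Suc n) k t s \<Longrightarrow>
    edge Dn (Suc n) k n j (idM \<rhd> s * Eta \<rhd> ev n j) (inverse (mu n j k) *\<^sub>m (Eps \<rhd> ev n j * idM \<rhd> t))"

lemma edge_UpE:
  assumes "edge Up n k m j t s"
  obtains "m = Suc n" "j = k" "2 * k \<le> n" "t = tT n k" "s = sT n k"
  | "m = Suc n" "j = Suc k" "2 * k + 1 \<le> n" "t = ev (Suc n) (Suc k)" "s = ev (Suc n) (Suc k)"
  using assms by (cases rule: edge.cases) auto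

lemma edge_DnE:
  assumes "edge Dn n k m j t s"
  obtains t' s' where "n = Suc m" "edge Up m j n k t' s'"
    "t = idM \<rhd> s' * Eta \<rhd> ev m j" "s = inverse (mu m j k) *\<^sub>m (Eps \<rhd> ev m j * idM \<rhd> t')"
  using assms by (cases rule: edge.cases) auto

lemma edge_Up:
  assumes "edge Up n k m j t s"
  shows "m = Suc n \<and> 2 * k \<le> n \<and> 2 * j \<le> m \<and> (j = k \<or> j = Suc k) \<and> s * t = ev m j
    \<and> t * s = cc (int j) \<rhd> idP \<rhd> ev n k \<and> cc (int j) \<rhd> idP \<rhd> ev n k * t = t
    \<and> s * cc (int j) \<rhd> idP \<rhd> ev n k = s"
  using assms
proof (cases rule: edge_UpE)
  case 1
  then show ?thesis using T_edge[of k n] by auto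
next
  case 2
  then show ?thesis using ev_idem[of "Suc n" "Suc k"] by (simp add: add.commute)
qed

lemma mu_nonzero:
  assumes "edge Up n j (Suc n) k t s"
  shows "mu n j k \<noteq> 0"
  using edge_Up[OF assms] bdval_nonzero[of "int n - 2 * int k"] bval_nonzero[of "int n - 2 * int k + 1"]
  by (auto simp: mu_def)

text \<open>The product \<open>s * t\<close> contains a circle around the bubble k, worth
  \<open>mu m j k\<close>. The product \<open>t * s\<close> contains a cap followed by a cup between
  two strands, which \<open>cup_cap\<close> evaluates by the inverse scalar.\<close>

lemma edge_Dn:
  assumes "edge Dn n k m j t s"
  shows "n = Suc m \<and> 2 * k \<le> n \<and> 2 * j \<le> m \<and> s * t = ev m j
    \<and> t * s = cc (int j) \<rhd> idM \<rhd> ev n k"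
  using assms
proof (cases rule: edge_DnE)
  case D: (1 t' s')
  note up = edge_Up[OF D(2)] and mu = mu_nonzero[OF D(2)[unfolded D(1)]]
  have jk: "2 * j \<le> m" "k = j \<or> k = Suc j" "2 * k \<le> Suc m" using up D(1) by simp_all
  define e where "e = ev m j"
  have e: "e * e = e" "cc (int j) \<rhd> e = e" by (simp_all add: e_def)
  have ce: "cc i \<rhd> e = (if i = int j then e else 0)" for i
    using cc_cc[of i "int j" e] by (simp add: e)
  define A where "A = idM \<rhd> cc (int k) \<rhd> idP \<rhd> e"
  have A: "idM \<rhd> s' * A = idM \<rhd> s'" "A * idM \<rhd> t' = idM \<rhd> t'" "A * A = A"
    using up by (simp_all add: A_def e_def e[unfolded e_def])
  have "Eps \<rhd> e * (idM \<rhd> cc (int k) \<rhd> idP \<rhd> e * Eta \<rhd> e) = mu m j k *\<^sub>m e"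
  proof -
    have "e * e * e \<in> homs 0 (ups m) (ups m)" unfolding e unfolding e_def by (rule ev_homs)
    from Eps_Eta_bubble[OF this, of "int k"] show ?thesis
      using jk(2) unfolding e ce mu_def by auto
  qed
  moreover have "s * t = inverse (mu m j k) *\<^sub>m (Eps \<rhd> e * (idM \<rhd> (t' * s') * Eta \<rhd> e))"
    by (simp only: D smul_mult_left mult.assoc wh_ident_mult[symmetric] e_def)
  moreover have "t' * s' = cc (int k) \<rhd> idP \<rhd> e" using up by (simp add: e_def)
  ultimately have st: "s * t = ev m j" using mu by (simp only: smul_smul) (simp add: e_def)
  have inv: "inverse (mu m j k) *\<^sub>m (A * (Eta \<circ>\<^sub>d Eps) \<rhd> e * A) = cc (int j) \<rhd> A"
  proof -
    \<comment> \<open>As \<open>bval i\<close> and \<open>bdval i\<close> are inverse to each other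
      for i at least 0, dividing by the value of the circle produces exactly the scalar of
      \<open>cup_cap\<close>.\<close>
    have g: "inverse (mu m j k) = (if int k = int j then bval (int m - 2 * int k) else bdval (int m - 2 * int k + 1))"
    proof (cases "j = k")
      case True
      then show ?thesis
        using jk inverse_unique[of "bdval (int m - 2 * int k)"] bval_bdval[of "int m - 2 * int k"]
        by (simp add: mu_def mult.commute)
    next
      case False
      then show ?thesis
        using jk inverse_unique[OF bval_bdval[of "int m - 2 * int k + 1"]] by (simp add: mu_def)
    qed
    show ?thesis
      unfolding g A_def using cup_cap[OF ev_homs ev_idem cc_ev, of m j "int k"] jk by (auto simp: e_def)
  qed
  have "t * s = idM \<rhd> s' * (inverse (mu m j k) *\<^sub>m (A * (Eta \<circ>\<^sub>d Eps) \<rhd> e * A)) * idM \<rhd> t'"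
  proof -
    have ee: "(Eta \<circ>\<^sub>d Eps) \<rhd> e = Eta \<rhd> e * Eps \<rhd> e"
      by (simp add: wh_mult e del: Eta_slide Eps_slide)
    have "idM \<rhd> s' * (A * (Eta \<rhd> e * Eps \<rhd> e) * A) * idM \<rhd> t'
        = (idM \<rhd> s' * A) * Eta \<rhd> e * (Eps \<rhd> e * (A * idM \<rhd> t'))"
      by (simp only: mult.assoc)
    then show ?thesis unfolding D(3,4) ee smul_mult_left smul_mult_right A by (simp only: e_def)
  qed
  also have "\<dots> = cc (int j) \<rhd> ((idM \<rhd> s' * A) * idM \<rhd> t')"
    unfolding inv by (simp only: cc_mult)
  also have "\<dots> = cc (int j) \<rhd> idM \<rhd> ev n k"
    unfolding A using up D(1) by simp
  finally show ?thesis using st up D(1) by simp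
qed

lemma edge_props:
  assumes "edge sg n k m j t s"
  shows "int m = int n + wt [sg]" "2 * k \<le> n" "2 * j \<le> m" "s * t = ev m j"
    "t * s = cc (int j) \<rhd> Ident [sg] \<rhd> ev n k"
proof -
  have "int m = int n + wt [sg] \<and> 2 * k \<le> n \<and> 2 * j \<le> m \<and> s * t = ev m j
    \<and> t * s = cc (int j) \<rhd> Ident [sg] \<rhd> ev n k"
  proof (cases sg)
    case Up
    show ?thesis using edge_Up[OF assms[unfolded Up]] by (simp add: Up wt_def)
  next
    case Dn
    show ?thesis using edge_Dn[OF assms[unfolded Dn]] by (simp add: Dn wt_def)
  qed
  then show "int m = int n + wt [sg]" "2 * k \<le> n" "2 * j \<le> m" "s * t = ev m j"
    "t * s = cc (int j) \<rhd> Ident [sg] \<rhd> ev n k" by blast+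
qed

lemma edge_absorb:
  assumes "edge sg n k m j t s"
  shows "t * ev m j = t" "ev m j * s = s"
    "cc (int j) \<rhd> Ident [sg] \<rhd> ev n k * t = t" "s * cc (int j) \<rhd> Ident [sg] \<rhd> ev n k = s"
proof -
  have Up: "t * ev m j = t \<and> ev m j * s = s" if e: "edge Up n k m j t s" for n k m j t s
  proof -
    note up = edge_Up[OF e]
    have "t * s * t = t" "s * t * s = s"
      using up by (metis mult.assoc)+
    then show ?thesis using up by (metis mult.assoc)
  qed
  have "t * ev m j = t \<and> ev m j * s = s"
  proof (cases sg)
    case sg: Up
    show ?thesis using Up assms sg by blast
  next
    case Dn
    from assms[unfolded this] show ?thesis
    proof (cases rule: edge_DnE)
      case (1 t' s')
      then show ?thesis by (simp add: mult.assoc) (simp flip: mult.assoc)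
    qed
  qed
  then show te: "t * ev m j = t" and es: "ev m j * s = s" by blast+
  show "cc (int j) \<rhd> Ident [sg] \<rhd> ev n k * t = t"
    using te by (simp only: edge_props(5)[OF assms, symmetric] mult.assoc edge_props(4)[OF assms])
  show "s * cc (int j) \<rhd> Ident [sg] \<rhd> ev n k = s"
    using es by (simp only: edge_props(5)[OF assms, symmetric] mult.assoc[symmetric] edge_props(4)[OF assms])
qed

lemma edge_unique:
  assumes "edge sg n k m j t s" "edge sg n k m' j' t' s'"
  shows "m = m' \<and> (j = j' \<longrightarrow> t = t' \<and> s = s')"
proof -
  have up: "m = m' \<and> (j = j' \<longrightarrow> t = t' \<and> s = s')"
    if "edge Up n k m j t s" "edge Up n k m' j' t' s'" for n k m j t s m' j' t' s'
    using that by (auto elim!: edge_UpE)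
  have up': "t = t' \<and> s = s'"
    if "edge Up n k m j t s" "edge Up n k m j t' s'" for n k m j t s t' s'
    using up[OF that] by simp
  show ?thesis
  proof (cases sg)
    case Up
    then show ?thesis using assms up by blast
  next
    case Dn
    then show ?thesis using assms up' by (blast elim!: edge_DnE)
  qed
qed

lemma edge_orth:
  assumes "edge sg n k m j t s" "edge sg n k m' j' t' s'" "j \<noteq> j'"
  shows "s * t' = 0"
proof -
  have "s * t' = s * cc (int j) \<rhd> Ident [sg] \<rhd> ev n k * (cc (int j') \<rhd> Ident [sg] \<rhd> ev n k * t')"
    by (simp only: edge_absorb[OF assms(1)] edge_absorb[OF assms(2)])
  also have "\<dots> = s * (cc (int j) \<rhd> cc (int j') \<rhd> Ident [sg] \<rhd> ev n k * t')"
    by (simp add: mult.assoc cc_cc assms(3) assms(3)[symmetric])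
  finally show ?thesis using assms(3) by (simp add: cc_cc)
qed

section \<open>Spans of products along edges and paths\<close>

inductive_set mspan :: "mor set \<Rightarrow> mor set" for A where
  base: "x \<in> A \<Longrightarrow> x \<in> mspan A"
| zero: "0 \<in> mspan A"
| add: "x \<in> mspan A \<Longrightarrow> y \<in> mspan A \<Longrightarrow> x + y \<in> mspan A"
| smul: "x \<in> mspan A \<Longrightarrow> a *\<^sub>m x \<in> mspan A"

lemma span_map:
  assumes "x \<in> mspan A" "\<And>a. a \<in> A \<Longrightarrow> L a \<in> mspan B"
    "\<And>x y. L (x + y) = L x + L y" "\<And>a x. L (a *\<^sub>m x) = a *\<^sub>m L x"
  shows "L x \<in> mspan B"
  using assms(1)
proof induction
  case zero
  then show ?case using assms(4)[of 0 0] by (simp add: mspan.zero)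
qed (auto simp: assms intro: mspan.intros)

lemma edge_in_span:
  "edge sg n k m j t s \<Longrightarrow> t * s \<in> mspan {t * s | m j t s. edge sg n k m j t s}"
  by (rule mspan.base) blast

text \<open>The bubbles split the identity into two candidates, and a candidate without an edge
  vanishes: a raising step out of range by \<open>ev_invalid\<close>, a downward step that keeps too
  large a k by \<open>wh_bubble_zero\<close>, a lowering below k = 0 since \<open>cc\<close> is 0
  there. At n = 0 a downward strand opens a region labelled -1.\<close>

lemma Ident_edge_span:
  assumes "2 * k \<le> n"
  shows "Ident [sg] \<rhd> ev n k \<in> mspan {t * s | m j t s. edge sg n k m j t s}"
proof (cases sg)
  case Up
  have "cc (int k) \<rhd> idP \<rhd> ev n k \<in> mspan {t * s | m j t s. edge sg n k m j t s}"
    using edge_in_span[OF edge.T[OF assms]] edge_props(5)[OF edge.T[OF assms]] Up by simp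
  moreover have "cc (int k + 1) \<rhd> idP \<rhd> ev n k \<in> mspan {t * s | m j t s. edge sg n k m j t s}"
  proof (cases "2 * k + 1 \<le> n")
    case True
    have "cc (int k + 1) \<rhd> idP \<rhd> ev n k = ev (Suc n) (Suc k) * ev (Suc n) (Suc k)"
      using ev_idem[of "Suc n" "Suc k"] by simp
    then show ?thesis using edge_in_span[OF edge.F[OF True]] Up by simp
  next
    case False
    then show ?thesis using ev_invalid[of "Suc n" "Suc k"] by (simp add: mspan.zero)
  qed
  ultimately show ?thesis unfolding Up by (subst vx.up_e) (simp add: mspan.add)
next
  case Dn
  show ?thesis
  proof (cases n)
    case 0
    have h: "idM \<rhd> ev 0 0 \<in> homs 0 [Dn] [Dn]"
      using homs_wh[OF ev_homs[of 0 0], of idM "[Dn]" "[Dn]"] by (simp add: ups_def)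
    have "id0 \<rhd> idM \<rhd> ev 0 0 = zero0 \<rhd> idM \<rhd> ev 0 0"
      by (rule wh_level[OF h weyl_eq.negative]) (simp add: wt_def)
    then show ?thesis using 0 assms Dn by (simp add: mspan.zero)
  next
    case (Suc m)
    have "cc (int k) \<rhd> idM \<rhd> ev n k \<in> mspan {t * s | m j t s. edge sg n k m j t s}"
    proof (cases "2 * k \<le> m")
      case True
      have "edge Dn n k m k (idM \<rhd> sT m k * Eta \<rhd> ev m k) (inverse (mu m k k) *\<^sub>m (Eps \<rhd> ev m k * idM \<rhd> tT m k))"
        unfolding Suc by (intro edge.D edge.T True)
      note e = this
      from edge_in_span[OF e] show ?thesis unfolding edge_props(5)[OF e] Dn .
    next
      case False
      have "idM \<rhd> ev n k \<in> homs 0 (Dn # ups n) (Dn # ups n)"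
        using homs_wh[OF ev_homs[of n k], of idM "[Dn]" "[Dn]"] by simp
      moreover have "wt (Dn # ups n) = int m" using wt_ups[of n] Suc by (simp add: wt_def)
      ultimately have "cc (int k) \<rhd> idM \<rhd> ev n k = 0"
        using wh_bubble_zero[of "idM \<rhd> ev n k" 0 "Dn # ups n" "Dn # ups n" "int k"] False by simp
      then show ?thesis by (simp add: mspan.zero)
    qed
    moreover have "cc (int k - 1) \<rhd> idM \<rhd> ev n k \<in> mspan {t * s | m j t s. edge sg n k m j t s}"
    proof (cases k)
      case 0
      then show ?thesis by (simp add: mspan.zero)
    next
      case k: (Suc i)
      have "edge Dn n k m i (idM \<rhd> ev n k * Eta \<rhd> ev m i) (inverse (mu m i k) *\<^sub>m (Eps \<rhd> ev m i * idM \<rhd> ev n k))"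
        unfolding Suc k by (intro edge.D edge.F) (use assms Suc k in simp)
      note e = this
      from edge_in_span[OF e] show ?thesis unfolding edge_props(5)[OF e] Dn by (simp add: k)
    qed
    ultimately show ?thesis
      unfolding Dn by (subst cc_down_right[of "int k"]) (simp_all add: mspan.add)
  qed
qed

inductive path :: "word \<Rightarrow> nat \<Rightarrow> nat \<Rightarrow> nat \<Rightarrow> nat \<Rightarrow> mor \<Rightarrow> mor \<Rightarrow> bool" where
  Nil: "2 * k \<le> n \<Longrightarrow> path [] n k n k (ev n k) (ev n k)"
| Cons: "path U n k m j t s \<Longrightarrow> edge sg m j m' j' t' s' \<Longrightarrow>
    path (sg # U) n k m' j' (Ident [sg] \<rhd> t * t') (s' * Ident [sg] \<rhd> s)"

lemma path_NilE:
  assumes "path [] n k m j t s"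
  obtains "m = n" "j = k" "t = ev n k" "s = ev n k" "2 * k \<le> n"
  using assms by (cases rule: path.cases) auto

lemma path_ConsE:
  assumes "path (sg # U) n k m' j' t s"
  obtains m j t1 s1 t2 s2 where "path U n k m j t1 s1" "edge sg m j m' j' t2 s2"
    "t = Ident [sg] \<rhd> t1 * t2" "s = s2 * Ident [sg] \<rhd> s1"
  using assms by (cases rule: path.cases) auto

lemma path_props:
  assumes "path U n k m j t s"
  shows "int m = int n + wt U \<and> 2 * j \<le> m \<and> s * t = ev m j \<and> t * ev m j = t \<and> ev m j * s = s"
  using assms
proof induction
  case (Cons U n k m j t s sg m' j' t' s')
  note e = edge_props[OF Cons(2)] edge_absorb[OF Cons(2)]
  have "s' * Ident [sg] \<rhd> s * (Ident [sg] \<rhd> t * t') = s' * Ident [sg] \<rhd> (s * t) * t'"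
    by (simp only: mult.assoc wh_ident_mult[symmetric])
  also have "\<dots> = (s' * cc (int j') \<rhd> Ident [sg] \<rhd> ev m j) * Ident [sg] \<rhd> ev m j * t'"
    using Cons e by simp
  also have "\<dots> = s' * cc (int j') \<rhd> Ident [sg] \<rhd> ev m j * t'"
    by (simp only: mult.assoc) (simp add: mult.assoc[symmetric])
  also have "\<dots> = ev m' j'" by (simp only: e)
  finally show ?case using Cons e by (simp add: wt_def mult.assoc) (simp add: mult.assoc[symmetric])
qed (simp add: wt_def)

text \<open>Paths are compared from their common start: the inner product is by induction 0 or the
  idempotent of a common vertex, and then \<open>edge_unique\<close> and \<open>edge_orth\<close>
  decide about the last two edges.\<close>

lemma path_orth:
  assumes "path U n k m j t s" "path U n k m' j' t' s'"
  shows "s * t' = 0 \<or> m = m' \<and> j = j' \<and> t = t' \<and> s = s' \<and> s * t' = ev m j"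
  using assms
proof (induction arbitrary: m' j' t' s')
  case (Nil k n)
  then show ?case by (auto elim: path_NilE)
next
  case (Cons U n k m j t s sg m1 j1 t1 s1)
  from Cons.prems obtain m2 j2 t2 s2 t3 s3 where p: "path U n k m2 j2 t2 s2" "edge sg m2 j2 m' j' t3 s3"
    "t' = Ident [sg] \<rhd> t2 * t3" "s' = s3 * Ident [sg] \<rhd> s2"
    by (rule path_ConsE)
  have st: "s1 * Ident [sg] \<rhd> s * t' = s1 * Ident [sg] \<rhd> (s * t2) * t3"
    by (simp only: p mult.assoc wh_ident_mult[symmetric])
  from Cons.IH[OF p(1)] show ?case
  proof
    assume "s * t2 = 0"
    then show ?thesis using st by simp
  next
    assume *: "m = m2 \<and> j = j2 \<and> t = t2 \<and> s = s2 \<and> s * t2 = ev m j"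
    then have e3: "edge sg m j m' j' t3 s3" using p by simp
    have "s1 * Ident [sg] \<rhd> ev m j = s1 * cc (int j1) \<rhd> Ident [sg] \<rhd> ev m j * Ident [sg] \<rhd> ev m j"
      by (simp only: edge_absorb(4)[OF Cons(2)])
    also have "\<dots> = s1 * (cc (int j1) \<rhd> Ident [sg] \<rhd> ev m j * Ident [sg] \<rhd> ev m j)"
      by (rule mult.assoc)
    also have "cc (int j1) \<rhd> Ident [sg] \<rhd> ev m j * Ident [sg] \<rhd> ev m j = cc (int j1) \<rhd> Ident [sg] \<rhd> ev m j"
      by (simp only: cc_mult(1) wh_ident_mult ev_idem)
    also have "s1 * \<dots> = s1" by (rule edge_absorb(4)[OF Cons(2)])
    finally have s1e: "s1 * Ident [sg] \<rhd> ev m j = s1" .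
    then have st': "s1 * Ident [sg] \<rhd> s * t' = s1 * t3"
    proof -
      have "s * t2 = ev m j" using * by blast
      then show ?thesis unfolding st by (simp only: s1e)
    qed
    show ?thesis
    proof (cases "j1 = j'")
      case True
      then show ?thesis using edge_unique[OF Cons(2) e3] edge_props(4)[OF Cons(2)] st' * p by auto
    next
      case False
      then show ?thesis using edge_orth[OF Cons(2) e3] st' by simp
    qed
  qed
qed

text \<open>The matrix units of pairs of paths from \<open>(n, k)\<close> with a common end point.\<close>

definition Sp :: "word \<Rightarrow> word \<Rightarrow> nat \<Rightarrow> nat \<Rightarrow> mor set" where
  "Sp U V n k = mspan {t' * s | m j t s t' s'. path U n k m j t s \<and> path V n k m j t' s'}"

lemma Ident_path_span:
  "2 * k \<le> n \<Longrightarrow> Ident U \<rhd> ev n k \<in> mspan {t * s | m j t s. path U n k m j t s}"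
proof (induction U)
  case Nil
  have "ev n k = ev n k * ev n k" by simp
  with path.Nil[OF Nil] show ?case unfolding wh_id0 by (intro mspan.base) blast
next
  case (Cons sg U)
  have "Ident (sg # U) \<rhd> ev n k = Ident [sg] \<rhd> Ident U \<rhd> ev n k"
    using wh_ident_append[of "[sg]" U] by simp
  also have "\<dots> \<in> mspan {t * s | m j t s. path (sg # U) n k m j t s}"
  proof (rule span_map[where L = "wh (Ident [sg])", OF Cons.IH[OF Cons.prems]])
    fix a assume "a \<in> {t * s | m j t s. path U n k m j t s}"
    then obtain m j t s where p: "path U n k m j t s" "a = t * s" by blast
    note pp = path_props[OF p(1)]
    have "t * ev m j * s = t * s" using pp by simp
    then have "Ident [sg] \<rhd> a = Ident [sg] \<rhd> t * Ident [sg] \<rhd> ev m j * Ident [sg] \<rhd> s"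
      by (simp add: p)
    also have "\<dots> \<in> mspan {t * s | m j t s. path (sg # U) n k m j t s}"
    proof (rule span_map[where L = "\<lambda>x. Ident [sg] \<rhd> t * x * Ident [sg] \<rhd> s", OF Ident_edge_span])
      show "2 * j \<le> m" using pp by simp
    next
      fix b assume "b \<in> {t * s | m' j' t s. edge sg m j m' j' t s}"
      then obtain m' j' t' s' where e: "edge sg m j m' j' t' s'" "b = t' * s'" by blast
      have "Ident [sg] \<rhd> t * b * Ident [sg] \<rhd> s = (Ident [sg] \<rhd> t * t') * (s' * Ident [sg] \<rhd> s)"
        by (simp only: e mult.assoc)
      with path.Cons[OF p(1) e(1)]
      show "Ident [sg] \<rhd> t * b * Ident [sg] \<rhd> s \<in> mspan {t * s | m j t s. path (sg # U) n k m j t s}"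
        by (intro mspan.base) blast
    qed (simp_all add: distrib_left distrib_right)
    finally show "Ident [sg] \<rhd> a \<in> mspan {t * s | m j t s. path (sg # U) n k m j t s}" .
  qed simp_all
  finally show ?case .
qed

lemma path_append:
  assumes "path V m j m' j' t' s'" "path U n k m j t s"
  shows "path (V @ U) n k m' j' (Ident V \<rhd> t * t') (s' * Ident V \<rhd> s)"
  using assms
proof induction
  case (Nil k' n')
  then show ?case using path_props[OF Nil(2)] by simp
next
  case (Cons V m j m1 j1 t1 s1 sg m2 j2 t2 s2)
  have "path (sg # (V @ U)) n k m2 j2 (Ident [sg] \<rhd> (Ident V \<rhd> t * t1) * t2) (s2 * Ident [sg] \<rhd> (s1 * Ident V \<rhd> s))"
    by (rule path.Cons[OF Cons.IH[OF Cons.prems] Cons.hyps(2)])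
  moreover have "Ident (sg # V) \<rhd> x = Ident [sg] \<rhd> Ident V \<rhd> x" for x
    using wh_ident_append[of "[sg]" V x] by simp
  ultimately show ?case
    by (simp only: wh_ident_mult[symmetric] mult.assoc append_Cons)
qed

lemma Sp_base:
  "path U n k m j t s \<Longrightarrow> path V n k m j t' s' \<Longrightarrow> t' * s \<in> Sp U V n k"
  unfolding Sp_def by (rule mspan.base) blast

lemma Sp_induct:
  assumes "x \<in> Sp U V n k"
    "\<And>m j t s t' s'. path U n k m j t s \<Longrightarrow> path V n k m j t' s' \<Longrightarrow> L (t' * s) \<in> Sp U' V' n' k'"
    "\<And>x y. L (x + y) = L x + L y" "\<And>a x. L (a *\<^sub>m x) = a *\<^sub>m L x"
  shows "L x \<in> Sp U' V' n' k'"
  unfolding Sp_def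
proof (rule span_map[where L = L, OF assms(1)[unfolded Sp_def]])
  fix a assume "a \<in> {t' * s | m j t s t' s'. path U n k m j t s \<and> path V n k m j t' s'}"
  then show "L a \<in> mspan {t' * s | m j t s t' s'. path U' n' k' m j t s \<and> path V' n' k' m j t' s'}"
    using assms(2) unfolding Sp_def by blast
qed (rule assms)+

text \<open>The diagram is placed between two decompositions of identities into paths. Paths ending
  at different bubbles contribute 0, since a bubble at the far left slides through the diagram; for
  the others it suffices that the matrix coefficient is a scalar.\<close>

lemma wh_in_Sp_coeffs:
  assumes f: "typed f" and nk: "2 * k \<le> n"
    and c: "\<And>m j t s t' s'. path (dm f) n k m j t s \<Longrightarrow> path (cd f) n k m j t' s'
      \<Longrightarrow> \<exists>a. s' * f \<rhd> ev n k * t = a *\<^sub>m ev m j"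
  shows "f \<rhd> ev n k \<in> Sp (dm f) (cd f) n k"
proof -
  have "f \<rhd> ev n k = Ident (cd f) \<rhd> ev n k * f \<rhd> ev n k * Ident (dm f) \<rhd> ev n k"
    by (simp add: f wh_mult_left wh_mult_right)
  also have "\<dots> \<in> Sp (dm f) (cd f) n k"
    unfolding Sp_def
  proof (rule span_map[where L = "\<lambda>x. x * f \<rhd> ev n k * Ident (dm f) \<rhd> ev n k", OF Ident_path_span[OF nk]])
    fix a assume "a \<in> {t * s | m j t s. path (cd f) n k m j t s}"
    then obtain m' j' t' s' where p': "path (cd f) n k m' j' t' s'" "a = t' * s'" by blast
    show "a * f \<rhd> ev n k * Ident (dm f) \<rhd> ev n k
        \<in> mspan {t' * s | m j t s t' s'. path (dm f) n k m j t s \<and> path (cd f) n k m j t' s'}"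
    proof (rule span_map[where L = "\<lambda>x. a * f \<rhd> ev n k * x", OF Ident_path_span[OF nk]])
      fix b assume "b \<in> {t * s | m j t s. path (dm f) n k m j t s}"
      then obtain m j t s where p: "path (dm f) n k m j t s" "b = t * s" by blast
      note pp = path_props[OF p(1)] path_props[OF p'(1)]
      have m: "m = m'" using pp weight_cd[OF f] by auto
      have eq: "a * f \<rhd> ev n k * b = t' * (s' * f \<rhd> ev n k * t) * s"
        by (simp only: p p' mult.assoc)
      show "a * f \<rhd> ev n k * b
          \<in> mspan {t' * s | m j t s t' s'. path (dm f) n k m j t s \<and> path (cd f) n k m j t' s'}"
      proof (cases "j = j'")
        case True
        then obtain c where "s' * f \<rhd> ev n k * t = c *\<^sub>m ev m j" using c p p' m by blast
        then have "a * f \<rhd> ev n k * b = c *\<^sub>m (t' * s)"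
          unfolding eq using pp m True by simp
        moreover have "t' * s \<in> mspan {t' * s | m j t s t' s'. path (dm f) n k m j t s \<and> path (cd f) n k m j t' s'}"
          using Sp_base[OF p(1)] p'(1) m True unfolding Sp_def by blast
        ultimately show ?thesis by (simp add: mspan.smul)
      next
        case False
        have "s' * f \<rhd> ev n k * t = (ev m j' * s') * f \<rhd> ev n k * (t * ev m j)"
          using pp m by simp
        also have "\<dots> = cc (int j') \<rhd> ev m j' * (s' * f \<rhd> ev n k * t) * cc (int j) \<rhd> ev m j"
          by (simp only: mult.assoc cc_ev)
        also have "\<dots> = 0"
          using False by (simp only: cc_mult) (simp add: cc_cc)
        finally show ?thesis unfolding eq by (simp add: mspan.zero)
      qed
    qed (simp_all add: distrib_left)
  qed (simp_all add: distrib_right)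
  finally show ?thesis .
qed

section \<open>Matrix coefficients of the generators with respect to paths\<close>

lemma path2E:
  assumes "path [sg', sg] n k m j t s"
  obtains m1 j1 t1 s1 t2 s2 where "edge sg n k m1 j1 t1 s1" "edge sg' m1 j1 m j t2 s2"
    "t = Ident [sg'] \<rhd> (Ident [sg] \<rhd> ev n k * t1) * t2" "s = s2 * Ident [sg'] \<rhd> (s1 * Ident [sg] \<rhd> ev n k)"
  using assms by (auto elim!: path_ConsE path_NilE)

text \<open>Downward edges are mates of upward ones: \<open>Eta\<close> is built into their
  inclusion, which gives the coefficient 1, and \<open>Eps\<close> into their projection, which
  gives the factor \<open>mu\<close> in \<open>Eps_coeff\<close>.\<close>

lemma Eta_coeff:
  assumes "path [Dn, Up] n k n k t s"
  shows "s * Eta \<rhd> ev n k = ev n k"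
  using assms
proof (cases rule: path2E)
  case (1 m1 j1 t1 s1 t2 s2)
  from 1(2) obtain t0 s0 where d: "m1 = Suc n" "edge Up n k m1 j1 t0 s0"
    "t2 = idM \<rhd> s0 * Eta \<rhd> ev n k" "s2 = inverse (mu n k j1) *\<^sub>m (Eps \<rhd> ev n k * idM \<rhd> t0)"
    by (rule edge_DnE)
  have "s0 = s1" using edge_unique[OF d(2) 1(1)] by simp
  have "s * Eta \<rhd> ev n k = s2 * (idM \<rhd> s1 * (idM \<rhd> idP \<rhd> ev n k * Eta \<rhd> ev n k))"
    by (simp only: 1 wh_ident_mult[symmetric] mult.assoc)
  also have "\<dots> = s2 * t2"
    unfolding d(3) \<open>s0 = s1\<close> by (simp only: Eta_slide ev_idem)
  finally show ?thesis using edge_props(4)[OF 1(2)] by simp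
qed

lemma Eps_coeff:
  assumes "path [Dn, Up] n k n k t s"
  shows "\<exists>a. Eps \<rhd> ev n k * t = a *\<^sub>m ev n k"
  using assms
proof (cases rule: path2E)
  case (1 m1 j1 t1 s1 t2 s2)
  from 1(2) obtain t0 s0 where d: "m1 = Suc n" "edge Up n k m1 j1 t0 s0"
    "t2 = idM \<rhd> s0 * Eta \<rhd> ev n k" "s2 = inverse (mu n k j1) *\<^sub>m (Eps \<rhd> ev n k * idM \<rhd> t0)"
    by (rule edge_DnE)
  have "t0 = t1" using edge_unique[OF d(2) 1(1)] by simp
  have mu: "mu n k j1 \<noteq> 0" using mu_nonzero d by simp
  have "Eps \<rhd> ev n k * t = Eps \<rhd> ev n k * idM \<rhd> idP \<rhd> ev n k * idM \<rhd> t1 * t2"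
    by (simp only: 1 wh_ident_mult[symmetric] mult.assoc)
  also have "\<dots> = mu n k j1 *\<^sub>m (s2 * t2)"
    unfolding d(4) \<open>t0 = t1\<close> Eps_slide(2) ev_idem using mu by simp
  finally show ?thesis using edge_props(4)[OF 1(2)] by auto
qed

lemma zigzag1_wh: "Eps' \<rhd> idP \<rhd> x * idP \<rhd> Eta \<rhd> y = idP \<rhd> (x * y)"
proof -
  have "Eps' \<rhd> idP \<rhd> x * idP \<rhd> Eta \<rhd> y = ((Eps' \<otimes>\<^sub>d idP) \<circ>\<^sub>d (idP \<otimes>\<^sub>d Eta)) \<rhd> (x * y)"
    unfolding wh_tens[symmetric] by (rule wh_mult) simp
  then show ?thesis using wh_rel[OF weyl_rel.zigzag1] by simp
qed

lemma zigzag2_wh: "idP \<rhd> Eps \<rhd> x * Eta' \<rhd> idP \<rhd> y = idP \<rhd> (x * y)"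
proof -
  have "idP \<rhd> Eps \<rhd> x * Eta' \<rhd> idP \<rhd> y = ((idP \<otimes>\<^sub>d Eps) \<circ>\<^sub>d (Eta' \<otimes>\<^sub>d idP)) \<rhd> (x * y)"
    unfolding wh_tens[symmetric] by (rule wh_mult) simp
  then show ?thesis using wh_rel[OF weyl_rel.zigzag2] by simp
qed

lemma edge_Up_unit:
  assumes "edge Up n k m j t s"
  shows "idP \<rhd> ev n k * t = t" "s * idP \<rhd> ev n k = s"
proof -
  have *: "idP \<rhd> ev n k * cc (int j) \<rhd> idP \<rhd> ev n k = cc (int j) \<rhd> idP \<rhd> ev n k"
    "cc (int j) \<rhd> idP \<rhd> ev n k * idP \<rhd> ev n k = cc (int j) \<rhd> idP \<rhd> ev n k"
    by simp_all
  note ab = edge_absorb(3,4)[OF assms]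
  show "idP \<rhd> ev n k * t = t" using *(1) ab(1) by (metis mult.assoc)
  show "s * idP \<rhd> ev n k = s" using *(2) ab(2) by (metis mult.assoc)
qed

text \<open>A zigzag straightens the downward edge into the upward edge between the same vertices,
  where projection and inclusion cancel. What remains is the normalization
  \<open>inverse (mu m1 j1 k)\<close>; for \<open>Eps'\<close> nothing remains.\<close>

lemma Eta'_coeff:
  assumes "path [Up, Dn] n k n k t s"
  shows "\<exists>a. s * Eta' \<rhd> ev n k = a *\<^sub>m ev n k"
  using assms
proof (cases rule: path2E)
  case (1 m1 j1 t1 s1 t2 s2)
  from 1(1) obtain t0 s0 where d: "n = Suc m1" "edge Up m1 j1 n k t0 s0"
    "t1 = idM \<rhd> s0 * Eta \<rhd> ev m1 j1" "s1 = inverse (mu m1 j1 k) *\<^sub>m (Eps \<rhd> ev m1 j1 * idM \<rhd> t0)"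
    by (rule edge_DnE)
  have "t0 = t2" "s0 = s2" using edge_unique[OF d(2) 1(2)] by simp_all
  have "s * Eta' \<rhd> ev n k = s2 * (idP \<rhd> s1 * (idP \<rhd> idM \<rhd> ev n k * Eta' \<rhd> ev n k))"
    by (simp only: 1 wh_ident_mult[symmetric] mult.assoc)
  also have "\<dots> = inverse (mu m1 j1 k) *\<^sub>m (s2 * (idP \<rhd> Eps \<rhd> ev m1 j1 * (idP \<rhd> idM \<rhd> t2 * Eta' \<rhd> ev n k)))"
    unfolding d(4) \<open>t0 = t2\<close> Eta'_slide ev_idem
    by (simp only: wh_smul smul_mult_left smul_mult_right wh_ident_mult[symmetric] mult.assoc Eta'_slide)
  also have "idP \<rhd> idM \<rhd> t2 * Eta' \<rhd> ev n k = Eta' \<rhd> idP \<rhd> ev m1 j1 * t2"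
    by (simp only: Eta'_slide edge_absorb(1)[OF 1(2)] edge_Up_unit(1)[OF 1(2)])
  also have "idP \<rhd> Eps \<rhd> ev m1 j1 * (Eta' \<rhd> idP \<rhd> ev m1 j1 * t2) = t2"
    unfolding mult.assoc[symmetric] zigzag2_wh by (simp add: edge_Up_unit(1)[OF 1(2)])
  also have "s2 * t2 = ev n k" by (rule edge_props(4)[OF 1(2)])
  finally show ?thesis by blast
qed

lemma Eps'_coeff:
  assumes "path [Up, Dn] n k n k t s"
  shows "Eps' \<rhd> ev n k * t = ev n k"
  using assms
proof (cases rule: path2E)
  case (1 m1 j1 t1 s1 t2 s2)
  from 1(1) obtain t0 s0 where d: "n = Suc m1" "edge Up m1 j1 n k t0 s0"
    "t1 = idM \<rhd> s0 * Eta \<rhd> ev m1 j1" "s1 = inverse (mu m1 j1 k) *\<^sub>m (Eps \<rhd> ev m1 j1 * idM \<rhd> t0)"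
    by (rule edge_DnE)
  have "s0 = s2" using edge_unique[OF d(2) 1(2)] by simp_all
  have "Eps' \<rhd> ev n k * t = Eps' \<rhd> ev n k * idP \<rhd> idM \<rhd> ev n k * idP \<rhd> idM \<rhd> s2 * idP \<rhd> Eta \<rhd> ev m1 j1 * t2"
    unfolding 1 d(3) \<open>s0 = s2\<close> by (simp only: wh_ident_mult[symmetric] mult.assoc)
  also have "Eps' \<rhd> ev n k * idP \<rhd> idM \<rhd> ev n k * idP \<rhd> idM \<rhd> s2 = s2 * Eps' \<rhd> idP \<rhd> ev m1 j1"
    by (simp only: Eps'_slide ev_idem edge_absorb(2)[OF 1(2)] edge_Up_unit(2)[OF 1(2)])
  also have "\<dots> * idP \<rhd> Eta \<rhd> ev m1 j1 * t2 = s2 * t2"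
    unfolding mult.assoc zigzag1_wh
    by (simp add: edge_Up_unit(1)[OF 1(2)])
  finally show ?thesis using edge_props(4)[OF 1(2)] by simp
qed

text \<open>If both paths have the same middle vertex, a diagonal entry of \<open>E\<close> is met.
  Otherwise the off-diagonal part of \<open>E\<close> is built into \<open>tT\<close> and
  \<open>sT\<close>, which leaves \<open>kp n k\<close> or 1. All this happens at left bubble k + 1;
  at the other left bubbles \<open>E\<close> vanishes.\<close>

lemma EE_coeff:
  assumes "path [Up, Up] n k m j t s" "path [Up, Up] n k m j t' s'"
  shows "\<exists>a. s' * EE \<rhd> ev n k * t = a *\<^sub>m ev m j"
proof -
  define E where "E = EV n k"
  have E: "EE \<rhd> ev n k = E" by (simp add: E_def vx.E_def)
  from assms(1) obtain m1 j1 t1 s1 t2 s2 where p: "edge Up n k m1 j1 t1 s1" "edge Up m1 j1 m j t2 s2"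
    "t = idP \<rhd> (idP \<rhd> ev n k * t1) * t2" "s = s2 * idP \<rhd> (s1 * idP \<rhd> ev n k)"
    by (rule path2E)
  from assms(2) obtain m1' j1' t1' s1' t2' s2' where p': "edge Up n k m1' j1' t1' s1'" "edge Up m1' j1' m j t2' s2'"
    "t' = idP \<rhd> (idP \<rhd> ev n k * t1') * t2'" "s' = s2' * idP \<rhd> (s1' * idP \<rhd> ev n k)"
    by (rule path2E)
  note u = edge_Up_unit[OF p(1)] edge_Up_unit[OF p'(1)]
  have t: "t = idP \<rhd> t1 * t2" and s: "s = s2 * idP \<rhd> s1" and s': "s' = s2' * idP \<rhd> s1'"
    unfolding p p' u by simp_all
  have m1: "m1 = Suc n" "m1' = Suc n" "m = Suc (Suc n)" using edge_Up[OF p(1)] edge_Up[OF p'(1)] edge_Up[OF p(2)] by simp_all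
  have Qt: "QQ n k (int j1) * idP \<rhd> t1 = idP \<rhd> t1" "idP \<rhd> s1 * QQ n k (int j1) = idP \<rhd> s1"
    using edge_Up[OF p(1)] by (simp_all add: vx.Q_def)
  have st: "s * t = ev m j" using path_props[OF assms(1)] by simp
  have js: "j = j1 \<or> j = Suc j1" "j1 = k \<or> j1 = Suc k" "j = j1' \<or> j = Suc j1'" "j1' = k \<or> j1' = Suc k"
    using edge_Up[OF p(1)] edge_Up[OF p(2)] edge_Up[OF p'(1)] edge_Up[OF p'(2)] by simp_all
  have left: "s' = cc (int j) \<rhd> s'"
  proof -
    have "s' = ev m j * s'" using path_props[OF assms(2)] by simp
    also have "\<dots> = cc (int j) \<rhd> ev m j * s'" by simp
    also have "\<dots> = cc (int j) \<rhd> s'" using path_props[OF assms(2)] by (simp only: cc_mult)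
    finally show ?thesis .
  qed
  have zero: "s' * E * t = 0" if "cc (int j) \<rhd> E = 0"
  proof -
    have "s' * E * t = cc (int j) \<rhd> s' * E * t" by (simp only: left[symmetric])
    also have "\<dots> = s' * cc (int j) \<rhd> E * t" by (simp only: cc_mult)
    finally show ?thesis using that by simp
  qed
  consider "j1 = j1'" | "j1 = Suc k" "j1' = k" | "j1 = k" "j1' = Suc k" using js by auto
  then have "\<exists>a. s' * E * t = a *\<^sub>m ev m j"
  proof cases
    case 1
    have "s1 = s1'" using edge_unique[OF p(1) p'(1)] 1 by simp
    moreover have "s2 = s2'" using edge_unique[OF p(2), of m j t2' s2'] p'(2) 1 m1 by simp
    ultimately have "s' = s" unfolding s s' by simp
    have diag: "\<exists>a. qint 2 *\<^sub>m (QQ n k (int j1) * E * QQ n k (int j1)) = a *\<^sub>m cc (int k + 1) \<rhd> QQ n k (int j1)"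
      using js(2)
    proof
      assume "j1 = k"
      then show ?thesis unfolding E_def using vx.E_diag_TF[of n k] by blast
    next
      assume "j1 = Suc k"
      then have "int j1 = int k + 1" by simp
      then show ?thesis unfolding E_def using vx.E_diag_FT[of n k] by metis
    qed
    then obtain a where a: "qint 2 *\<^sub>m (QQ n k (int j1) * E * QQ n k (int j1)) = a *\<^sub>m cc (int k + 1) \<rhd> QQ n k (int j1)"
      by blast
    have "qint 2 *\<^sub>m (s * E * t) = s2 * idP \<rhd> s1 * (qint 2 *\<^sub>m (QQ n k (int j1) * E * QQ n k (int j1))) * idP \<rhd> t1 * t2"
    proof -
      have "s * E * t = s2 * (idP \<rhd> s1 * QQ n k (int j1)) * E * (QQ n k (int j1) * idP \<rhd> t1) * t2"
        unfolding Qt s t by (simp only: mult.assoc)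
      then show ?thesis by (simp only: mult.assoc smul_mult_left smul_mult_right)
    qed
    also have "\<dots> = a *\<^sub>m cc (int k + 1) \<rhd> (s2 * (idP \<rhd> s1 * QQ n k (int j1)) * idP \<rhd> t1 * t2)"
      unfolding a by (simp only: mult.assoc smul_mult_left smul_mult_right cc_mult)
    also have "\<dots> = a *\<^sub>m cc (int k + 1) \<rhd> (s * t)"
      unfolding Qt s t by (simp only: mult.assoc)
    also have "\<dots> = (if int j = int k + 1 then a else 0) *\<^sub>m ev m j"
    proof -
      have "cc (int k + 1) \<rhd> ev m j = cc (int k + 1) \<rhd> cc (int j) \<rhd> ev m j" by (simp only: cc_ev)
      also have "\<dots> = (if int j = int k + 1 then ev m j else 0)" by (subst cc_cc) (simp only: cc_ev eq_commute[of "int k + 1"])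
      finally show ?thesis unfolding st by (simp only: smul_zero_left smul_zero_right split: if_split) simp
    qed
    finally have eq: "qint 2 *\<^sub>m (s * E * t) = (if int j = int k + 1 then a else 0) *\<^sub>m ev m j" .
    have "inverse (qint 2) *\<^sub>m qint 2 *\<^sub>m (s * E * t)
        = inverse (qint 2) *\<^sub>m (if int j = int k + 1 then a else 0) *\<^sub>m ev m j"
      unfolding eq ..
    then have "s' * E * t = (inverse (qint 2) * (if int j = int k + 1 then a else 0)) *\<^sub>m ev m j"
      using vx.qint_2_nonzero unfolding \<open>s' = s\<close> smul_smul by simp
    then show ?thesis by blast
  next
    case 2
    show ?thesis
    proof (cases "j = Suc k")
      case False
      then have "j = Suc (Suc k)" "j = k \<or> j = Suc k" using 2 js by auto
      then show ?thesis using False by simp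
    next
      case True
      have e1: "2 * k + 1 \<le> n" "t1 = ev (Suc n) (Suc k)" using p(1) 2 by (auto elim!: edge_UpE)
      have e2: "t2 = tT (Suc n) (Suc k)" using p(2) 2 True m1 by (auto elim!: edge_UpE)
      have e1': "s1' = sT n k" using p'(1) 2 by (auto elim!: edge_UpE)
      have e2': "s2' = ev m j" using p'(2) 2 True m1 by (auto elim!: edge_UpE)
      have tt: "idP \<rhd> ev (Suc n) (Suc k) * t2 = t2"
        using edge_Up_unit(1)[OF p(2)] unfolding m1 2 by simp
      have kap: "kp n k \<noteq> 0" using e1 by (intro vx.kap_nonzero) simp
      have c: "cc (int k + 1) \<rhd> QQ n k (int k + 1) * t2 = t2"
        using edge_Up[OF p(2)] unfolding m1 2 True Q_eq_up_ev by (simp add: add.commute)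
      have "s' * E * t = ev m j * (idP \<rhd> sT n k * E * t2)"
        unfolding s' t e1' e2' e1(2) tt by (simp only: mult.assoc)
      also have "idP \<rhd> sT n k * E * t2 = kp n k *\<^sub>m (sT (Suc n) (Suc k) * t2)"
        using kap c by (simp add: E_def mult.assoc del: tT.simps cc_mult)
      also have "sT (Suc n) (Suc k) * t2 = ev m j"
        unfolding e2 True m1(3) using T_edge[of "Suc k" "Suc n"] e1(1) by simp
      finally show ?thesis by auto
    qed
  next
    case 3
    show ?thesis
    proof (cases "j = Suc k")
      case False
      then have "j = Suc (Suc k)" "j = k \<or> j = Suc k" using 3 js by auto
      then show ?thesis using False by simp
    next
      case True
      have e1: "2 * k + 1 \<le> n" "s1' = ev (Suc n) (Suc k)" using p'(1) 3 by (auto elim!: edge_UpE)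
      have e2: "s2' = sT (Suc n) (Suc k)" using p'(2) 3 True m1 by (auto elim!: edge_UpE)
      have e1': "t1 = tT n k" using p(1) 3 by (auto elim!: edge_UpE)
      have e2': "t2 = ev m j" using p(2) 3 True m1 by (auto elim!: edge_UpE)
      have ss: "s2' * idP \<rhd> ev (Suc n) (Suc k) = s2'"
        using edge_Up_unit(2)[OF p'(2)] unfolding m1 3 by simp
      have c: "s2' * cc (int k + 1) \<rhd> QQ n k (int k + 1) = s2'"
        using edge_Up[OF p'(2)] unfolding m1 3 True Q_eq_up_ev by (simp add: add.commute)
      have "s' * E * t = s2' * (E * idP \<rhd> tT n k) * ev m j"
        unfolding s' t e1' e2' e1(2) ss by (simp only: mult.assoc)
      also have "s2' * (E * idP \<rhd> tT n k) = (s2' * cc (int k + 1) \<rhd> QQ n k (int k + 1)) * (E * idP \<rhd> tT n k)"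
        unfolding c ..
      also have "\<dots> = s2' * tT (Suc n) (Suc k)"
        by (simp only: tT.simps E_def mult.assoc)
      also have "\<dots> = ev m j"
        unfolding e2 True m1(3) using T_edge[of "Suc k" "Suc n"] e1(1) by simp
      finally have "s' * E * t = 1 *\<^sub>m ev m j" by simp
      then show ?thesis by blast
    qed
  qed
  then show ?thesis unfolding E .
qed

text \<open>Composites multiply matrix units, which \<open>path_orth\<close> handles. In a tensor
  product g meets a matrix unit \<open>t1' * s1\<close> of f at the end vertex (m, j) of the paths,
  where the induction hypothesis for g applies, and the paths are concatenated.\<close>

theorem wh_in_Sp:
  assumes "typed f" "2 * k \<le> n"
  shows "f \<rhd> ev n k \<in> Sp (dm f) (cd f) n k"
  using assms
proof (induction f arbitrary: n k)
  case (Ident w)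
  have "Ident w \<rhd> ev n k \<in> mspan {t' * s | m j t s t' s'. path w n k m j t s \<and> path w n k m j t' s'}"
  proof (rule span_map[where L = "\<lambda>x. x", OF Ident_path_span[OF Ident(2)]])
    fix a assume "a \<in> {t * s | m j t s. path w n k m j t s}"
    then show "a \<in> mspan {t' * s | m j t s t' s'. path w n k m j t s \<and> path w n k m j t' s'}"
      by (intro mspan.base) blast
  qed simp_all
  then show ?case by (simp add: Sp_def)
next
  case Eta
  show ?case
  proof (rule wh_in_Sp_coeffs[OF Eta])
    fix m j t s t' s' assume "path (dm Eta) n k m j t s" and p: "path (cd Eta) n k m j t' s'"
    then have "m = n" "j = k" "t = ev n k" by (auto elim!: path_NilE)
    moreover from this p have "s' * Eta \<rhd> ev n k = ev n k" by (intro Eta_coeff) simp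
    ultimately have "s' * Eta \<rhd> ev n k * t = 1 *\<^sub>m ev m j" by simp
    then show "\<exists>a. s' * Eta \<rhd> ev n k * t = a *\<^sub>m ev m j" by blast
  qed
next
  case Eps
  show ?case
  proof (rule wh_in_Sp_coeffs[OF Eps])
    fix m j t s t' s' assume p: "path (dm Eps) n k m j t s" and "path (cd Eps) n k m j t' s'"
    then have *: "m = n" "j = k" "s' = ev n k" by (auto elim!: path_NilE)
    with p obtain a where "Eps \<rhd> ev n k * t = a *\<^sub>m ev n k" using Eps_coeff[of n k t s] by auto
    then have "s' * Eps \<rhd> ev n k * t = a *\<^sub>m ev m j" using * by simp
    then show "\<exists>a. s' * Eps \<rhd> ev n k * t = a *\<^sub>m ev m j" by blast
  qed
next
  case Eta'
  show ?case
  proof (rule wh_in_Sp_coeffs[OF Eta'])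
    fix m j t s t' s' assume "path (dm Eta') n k m j t s" and p: "path (cd Eta') n k m j t' s'"
    then have *: "m = n" "j = k" "t = ev n k" by (auto elim!: path_NilE)
    with p obtain a where "s' * Eta' \<rhd> ev n k = a *\<^sub>m ev n k" using Eta'_coeff[of n k t' s'] by auto
    then have "s' * Eta' \<rhd> ev n k * t = a *\<^sub>m ev m j" using * by simp
    then show "\<exists>a. s' * Eta' \<rhd> ev n k * t = a *\<^sub>m ev m j" by blast
  qed
next
  case Eps'
  show ?case
  proof (rule wh_in_Sp_coeffs[OF Eps'])
    fix m j t s t' s' assume p: "path (dm Eps') n k m j t s" and "path (cd Eps') n k m j t' s'"
    then have *: "m = n" "j = k" "s' = ev n k" by (auto elim!: path_NilE)
    with p have "Eps' \<rhd> ev n k * t = ev n k" using Eps'_coeff[of n k t s] by auto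
    then have "s' * Eps' \<rhd> ev n k * t = 1 *\<^sub>m ev m j" using * by simp
    then show "\<exists>a. s' * Eps' \<rhd> ev n k * t = a *\<^sub>m ev m j" by blast
  qed
next
  case EE
  show ?case
    by (rule wh_in_Sp_coeffs[OF EE]) (simp add: EE_coeff)
next
  case (Bk i)
  have "Bk i \<rhd> ev n k = bval (int n + i) *\<^sub>m (ev n k * ev n k)"
    using Bk_wh[OF ev_homs[of n k]] by simp
  also have "\<dots> \<in> Sp [] [] n k"
    using Sp_base[OF path.Nil path.Nil, OF Bk(2) Bk(2)] unfolding Sp_def by (rule mspan.smul)
  finally show ?case by simp
next
  case (Comp g f)
  then have t: "typed g" "typed f" "dm g = cd f" by auto
  have "(g \<circ>\<^sub>d f) \<rhd> ev n k = g \<rhd> ev n k * f \<rhd> ev n k"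
    using Comp by (simp add: wh_mult)
  also have "\<dots> \<in> Sp (dm f) (cd g) n k"
  proof (rule Sp_induct[where L = "\<lambda>x. x * f \<rhd> ev n k", OF Comp.IH(1)[OF t(1) Comp.prems(2)]])
    fix m j t1 s1 t1' s1' assume p1: "path (dm g) n k m j t1 s1" "path (cd g) n k m j t1' s1'"
    show "t1' * s1 * f \<rhd> ev n k \<in> Sp (dm f) (cd g) n k"
    proof (rule Sp_induct[where L = "\<lambda>x. t1' * s1 * x", OF Comp.IH(2)[OF t(2) Comp.prems(2)]])
      fix m2 j2 t2 s2 t2' s2' assume p2: "path (dm f) n k m2 j2 t2 s2" "path (cd f) n k m2 j2 t2' s2'"
      have eq: "t1' * s1 * (t2' * s2) = t1' * (s1 * t2') * s2" by (simp only: mult.assoc)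
      from path_orth[OF p1(1)] p2(2) t(3)
      consider "s1 * t2' = 0" | "m = m2" "j = j2" "s1 * t2' = ev m j" by auto
      then show "t1' * s1 * (t2' * s2) \<in> Sp (dm f) (cd g) n k"
      proof cases
        case 1
        then show ?thesis unfolding eq by (simp add: Sp_def mspan.zero)
      next
        case 2
        then have "t1' * s1 * (t2' * s2) = t1' * s2"
          unfolding eq using path_props[OF p1(2)] by simp
        then show ?thesis using Sp_base[of "dm f" n k m j t2 s2 "cd g" t1' s1'] p1 p2 2 by simp
      qed
    qed (simp_all add: distrib_left)
  qed (simp_all add: distrib_right)
  finally show ?case by simp
next
  case (Tens g f)
  then have t: "typed g" "typed f" by auto
  have "g \<rhd> f \<rhd> ev n k \<in> Sp (dm g @ dm f) (cd g @ cd f) n k"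
  proof (rule Sp_induct[where L = "wh g", OF Tens.IH(2)[OF t(2) Tens.prems(2)]])
    fix m j t1 s1 t1' s1' assume p1: "path (dm f) n k m j t1 s1" "path (cd f) n k m j t1' s1'"
    note pp = path_props[OF p1(1)] path_props[OF p1(2)]
    have "t1' * s1 = t1' * ev m j * s1" using pp by simp
    then have "g \<rhd> (t1' * s1) = Ident (cd g) \<rhd> t1' * g \<rhd> ev m j * Ident (dm g) \<rhd> s1"
      by (simp only: wh_mult_left[OF t(1)] wh_mult_right[OF t(1)])
    also have "\<dots> \<in> Sp (dm g @ dm f) (cd g @ cd f) n k"
    proof (rule Sp_induct[where L = "\<lambda>x. Ident (cd g) \<rhd> t1' * x * Ident (dm g) \<rhd> s1", OF Tens.IH(1)[OF t(1)]])
      show "2 * j \<le> m" using pp by simp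
    next
      fix m2 j2 t2 s2 t2' s2' assume p2: "path (dm g) m j m2 j2 t2 s2" "path (cd g) m j m2 j2 t2' s2'"
      have "Ident (cd g) \<rhd> t1' * (t2' * s2) * Ident (dm g) \<rhd> s1
          = (Ident (cd g) \<rhd> t1' * t2') * (s2 * Ident (dm g) \<rhd> s1)"
        by (simp only: mult.assoc)
      also have "\<dots> \<in> Sp (dm g @ dm f) (cd g @ cd f) n k"
        by (rule Sp_base[OF path_append[OF p2(1) p1(1)] path_append[OF p2(2) p1(2)]])
      finally show "Ident (cd g) \<rhd> t1' * (t2' * s2) * Ident (dm g) \<rhd> s1 \<in> Sp (dm g @ dm f) (cd g @ cd f) n k" .
    qed (simp_all add: distrib_left distrib_right)
    finally show "g \<rhd> (t1' * s1) \<in> Sp (dm g @ dm f) (cd g @ cd f) n k" .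
  qed simp_all
  then show ?case by (simp add: wh_tens)
next
  case (Zero U V)
  then show ?case by (simp add: Sp_def mspan.zero)
next
  case (Add f g)
  then show ?case by (simp add: wh_dadd Sp_def mspan.add)
next
  case (Scal a f)
  then show ?case by (simp add: wh_dscal Sp_def mspan.smul)
qed

section \<open>From the idempotents back to the bubbles\<close>

lemma closed_scalar:
  assumes "typed f" "dm f = []" "cd f = []" "2 * k \<le> n"
  shows "\<exists>a. f \<rhd> ev n k = a *\<^sub>m ev n k"
proof -
  \<comment> \<open>The empty word has a single path from (n, k), so this span consists of the
    multiples of \<open>ev n k\<close>.\<close>
  have "f \<rhd> ev n k \<in> Sp [] [] n k" using wh_in_Sp[of f k n] assms by simp
  then show ?thesis unfolding Sp_def
  proof induction
    case (base x)
    then have "x = 1 *\<^sub>m ev n k" by (auto elim!: path_NilE)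
    then show ?case by blast
  next
    case zero
    then show ?case by (metis smul_zero_left)
  next
    case (add x y)
    then show ?case by (metis smul_add_left)
  next
    case (smul x a)
    then show ?case by (metis smul_smul)
  qed
qed

text \<open>The strand is closed to a circle around the bubble k inside a region labelled n + 1. Its
  value has one term for the bubble k and one for k + 1, and multiplication by \<open>cc a\<close>
  keeps exactly one of them, with nonzero coefficient.\<close>

lemma close_right:
  assumes "typed g" and i: "0 \<le> k" "a = k \<or> a = k + 1" "0 \<le> int n - 2 * k" "a = k + 1 \<Longrightarrow> 0 \<le> int n - 2 * k - 1"
    and z: "mk (int n) (g \<otimes>\<^sub>d cc a \<otimes>\<^sub>d idP \<otimes>\<^sub>d cc k) = 0"
  shows "mk (int (Suc n)) (g \<otimes>\<^sub>d cc a) = 0"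
proof -
  let ?i = "mk (int (Suc n)) id0"
  let ?Y = "g \<otimes>\<^sub>d cc a"
  define V where "V = ?Y \<otimes>\<^sub>d idP \<otimes>\<^sub>d cc k"
  have ii: "?i \<in> homs (int (Suc n)) [] []" by (rule mk_homs) simp_all
  have i1: "?i * ?i = ?i" using ident_mult_left[OF ii] by simp
  have w: "wt (dm V) = wt (cd V)" using assms(1) weight_cd[of V] by (simp add: V_def)
  have "mk (int n) V = mk (int n) (g \<otimes>\<^sub>d cc a \<otimes>\<^sub>d idP \<otimes>\<^sub>d cc k)"
    unfolding V_def using assms(1) by (intro mk_cong weyl_eq.tens_assoc) simp
  also have "\<dots> = mk (int n) (Zero (dm V) (cd V))" using z by simp
  finally have "weyl_eq (int n) V (Zero (dm V) (cd V))"
    using mk_eq_iff[of V "Zero (dm V) (cd V)" "int n"] w assms(1) by (simp add: V_def)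
  \<comment> \<open>A downward strand at the right lowers the label n + 1 to n, the label at which V
    is known to vanish.\<close>
  moreover have "idM \<rhd> ?i \<in> homs (int (Suc n)) [Dn] [Dn]"
    using homs_wh[OF ii, of idM "[Dn]" "[Dn]"] by simp
  ultimately have "V \<rhd> idM \<rhd> ?i = 0"
    using wh_level[of "idM \<rhd> ?i" "int (Suc n)" "[Dn]" "[Dn]" V "Zero (dm V) (cd V)"] by (simp add: wt_def)
  then have "?Y \<rhd> idP \<rhd> cc k \<rhd> idM \<rhd> ?i = 0" by (simp add: V_def wh_tens)
  then have "0 = Ident (cd g) \<rhd> Eps' \<rhd> ?i * ?Y \<rhd> idP \<rhd> cc k \<rhd> idM \<rhd> ?i * Ident (dm g) \<rhd> Eta' \<rhd> ?i"
    by simp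
  also have "\<dots> = ?Y \<rhd> (Eps' \<rhd> ?i * (idP \<rhd> cc k \<rhd> idM \<rhd> ?i * Eta' \<rhd> ?i))"
    using wh_mult_left[of ?Y "Eps' \<rhd> ?i" "idP \<rhd> cc k \<rhd> idM \<rhd> ?i"]
      wh_mult_right[of ?Y "Eps' \<rhd> ?i * idP \<rhd> cc k \<rhd> idM \<rhd> ?i" "Eta' \<rhd> ?i"] assms(1)
    by (simp add: mult.assoc)
  also have "Eps' \<rhd> ?i * (idP \<rhd> cc k \<rhd> idM \<rhd> ?i * Eta' \<rhd> ?i)
      = bval (int (Suc n) - 2 * k - 1) *\<^sub>m cc k \<rhd> ?i + bdval (int (Suc n) - 2 * k - 2) *\<^sub>m cc (k + 1) \<rhd> ?i"
    using Eps'_Eta'_bubble[of ?i ?i ?i "int (Suc n)" "[]" "[]" k] ii i(1) unfolding i1 by (simp add: wt_def)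
  also have "?Y \<rhd> \<dots> = bval (int n - 2 * k) *\<^sub>m g \<rhd> cc a \<rhd> cc k \<rhd> ?i + bdval (int n - 2 * k - 1) *\<^sub>m g \<rhd> cc a \<rhd> cc (k + 1) \<rhd> ?i"
    by (simp add: wh_tens)
  finally have 0: "bval (int n - 2 * k) *\<^sub>m g \<rhd> cc a \<rhd> cc k \<rhd> ?i + bdval (int n - 2 * k - 1) *\<^sub>m g \<rhd> cc a \<rhd> cc (k + 1) \<rhd> ?i = 0"
    by simp
  have "g \<rhd> cc a \<rhd> ?i = 0"
    using i(2)
  proof
    assume "a = k"
    then show ?thesis using 0 bval_nonzero[OF i(3)] by (simp add: cc_cc)
  next
    assume "a = k + 1"
    then show ?thesis using 0 bdval_nonzero[OF i(4)] by (simp add: cc_cc)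
  qed
  then have "?Y \<rhd> ?i = 0" by (simp add: wh_tens)
  then have "mk (int (Suc n)) (?Y \<otimes>\<^sub>d id0) = 0" by (simp add: wh_mk)
  then show ?thesis
    using mk_cong[OF weyl_eq.tens_unit_right[of ?Y "int (Suc n)"]] assms(1) by simp
qed

text \<open>Closing the strands of \<open>ev n k\<close> on the right, one at a time, yields a nonzero multiple of the bubble.\<close>

lemma strip:
  "2 * k \<le> n \<Longrightarrow> typed g \<Longrightarrow> g \<rhd> ev n k = 0 \<Longrightarrow> mk (int n) (g \<otimes>\<^sub>d cc (int k)) = 0"
proof (induction n k arbitrary: g rule: ev.induct)
  case (1 n)
  show ?case using 1(2,3)
  proof (induction n arbitrary: g)
    case 0
    have "wh (g \<otimes>\<^sub>d cc 0) (mk 0 id0) = 0" using 0 by (simp add: ups_def wh_tens)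
    then show ?case
      using 0 mk_cong[OF weyl_eq.tens_unit_right[of "g \<otimes>\<^sub>d cc 0" 0]] by (simp add: wh_mk)
  next
    case (Suc n)
    \<comment> \<open>The leftmost bubble and strand of \<open>ev\<close> move into g; after the
      induction hypothesis \<open>close_right\<close> removes this strand and raises the label by
      one.\<close>
    have "(g \<otimes>\<^sub>d cc 0 \<otimes>\<^sub>d idP) \<rhd> ev n 0 = 0"
      using Suc.prems(2) by (simp only: ev_Suc_0 wh_tens)
    then have "mk (int n) ((g \<otimes>\<^sub>d cc 0 \<otimes>\<^sub>d idP) \<otimes>\<^sub>d cc (int 0)) = 0"
      using Suc.prems(1) by (intro Suc.IH) simp_all
    also have "mk (int n) ((g \<otimes>\<^sub>d cc 0 \<otimes>\<^sub>d idP) \<otimes>\<^sub>d cc (int 0)) = mk (int n) (g \<otimes>\<^sub>d cc 0 \<otimes>\<^sub>d idP \<otimes>\<^sub>d cc 0)"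
    proof -
      have "weyl_eq (int n) ((g \<otimes>\<^sub>d cc 0 \<otimes>\<^sub>d idP) \<otimes>\<^sub>d cc 0) (g \<otimes>\<^sub>d (cc 0 \<otimes>\<^sub>d idP) \<otimes>\<^sub>d cc 0)"
        using Suc.prems(1) by (intro weyl_eq.tens_assoc) simp
      also have "weyl_eq (int n) \<dots> (g \<otimes>\<^sub>d cc 0 \<otimes>\<^sub>d idP \<otimes>\<^sub>d cc 0)"
        using Suc.prems(1) by (intro weyl_eq.cong_tens weyl_eq.tens_assoc weyl_eq.refl) simp_all
      finally show ?thesis by (intro mk_cong) simp
    qed
    finally show ?case using close_right[of g 0 0 n] Suc.prems(1) by simp
  qed
next
  case (3 n k)
  have "(g \<otimes>\<^sub>d cc (int k + 1) \<otimes>\<^sub>d idP) \<rhd> ev n k = 0"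
    using 3(4) by (simp add: wh_tens)
  then have "mk (int n) ((g \<otimes>\<^sub>d cc (int k + 1) \<otimes>\<^sub>d idP) \<otimes>\<^sub>d cc (int k)) = 0"
    using 3(2,3) by (intro 3(1)) simp_all
  also have "mk (int n) ((g \<otimes>\<^sub>d cc (int k + 1) \<otimes>\<^sub>d idP) \<otimes>\<^sub>d cc (int k))
      = mk (int n) (g \<otimes>\<^sub>d cc (int k + 1) \<otimes>\<^sub>d idP \<otimes>\<^sub>d cc (int k))"
  proof -
    have "weyl_eq (int n) ((g \<otimes>\<^sub>d cc (int k + 1) \<otimes>\<^sub>d idP) \<otimes>\<^sub>d cc (int k))
        (g \<otimes>\<^sub>d (cc (int k + 1) \<otimes>\<^sub>d idP) \<otimes>\<^sub>d cc (int k))"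
      using 3(3) by (intro weyl_eq.tens_assoc) simp
    also have "weyl_eq (int n) \<dots> (g \<otimes>\<^sub>d cc (int k + 1) \<otimes>\<^sub>d idP \<otimes>\<^sub>d cc (int k))"
      using 3(3) by (intro weyl_eq.cong_tens weyl_eq.tens_assoc weyl_eq.refl) simp_all
    finally show ?thesis by (intro mk_cong) simp
  qed
  finally show ?case using close_right[of g "int k" "int k + 1" n] 3(2,3) by (simp add: add.commute)
qed simp

lemma closed_mult_bubble:
  assumes "typed f" "dm f = []" "cd f = []" "2 * k \<le> n"
  shows "\<exists>a. mk (int n) f * mk (int n) (cc (int k)) = a *\<^sub>m mk (int n) (cc (int k))"
proof -
  obtain a where a: "f \<rhd> ev n k = a *\<^sub>m ev n k" using closed_scalar[OF assms] by blast
  let ?g = "f +\<^sub>d (- a) *\<^sub>d id0"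
  have "?g \<rhd> ev n k = 0" using a assms by (simp add: wh_dadd wh_dscal)
  then have "mk (int n) (?g \<otimes>\<^sub>d cc (int k)) = 0" using assms by (intro strip) simp_all
  then have "mk (int n) (?g \<circ>\<^sub>d cc (int k)) = 0"
    using mk_cong[OF closed_tens_comp[of ?g "cc (int k)" "int n"]] assms by simp
  then have "(mk (int n) f + (- a) *\<^sub>m mk (int n) id0) * mk (int n) (cc (int k)) = 0"
    using assms by (simp add: mk_comp mk_add mk_scal)
  moreover have "mk (int n) id0 * mk (int n) (cc (int k)) = mk (int n) (cc (int k))"
    by (rule ident_mult_left[of _ _ "[]"]) (simp add: mk_homs)
  ultimately have "mk (int n) f * mk (int n) (cc (int k)) = a *\<^sub>m mk (int n) (cc (int k))"
    by (simp add: left_diff_distrib)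
  then show ?thesis by blast
qed

lemma bubble_sum_mk: "(\<Sum>k\<le>n div 2. mk (int n) (cc (int k))) = mk (int n) id0"
proof -
  have "mk N (foldr Add (map cc ks) zero0) = (\<Sum>k\<leftarrow>ks. mk N (cc k))" for N ks
    by (induction ks) (simp_all add: mk_add)
  from this[of "int n" "[0..int n div 2]"]
  have "mk (int n) id0 = (\<Sum>k\<leftarrow>[0..int n div 2]. mk (int n) (cc k))"
    using mk_cong[OF weyl_eq.bubble_sum[of "int n"]] by simp
  also have "\<dots> = (\<Sum>k\<in>{0..int n div 2}. mk (int n) (cc k))"
    by (simp add: sum_list_distinct_conv_sum_set)
  also have "{0..int n div 2} = int ` {..n div 2}"
    by (simp add: image_int_atLeastAtMost atMost_atLeast0 zdiv_int)
  also have "(\<Sum>k\<in>int ` {..n div 2}. mk (int n) (cc k)) = (\<Sum>k\<le>n div 2. mk (int n) (cc (int k)))"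
    by (simp add: sum.reindex)
  finally show ?thesis by simp
qed

theorem closed_span:
  assumes "typed f" "dm f = []" "cd f = []"
  shows "\<exists>a. mk (int n) f = (\<Sum>k\<le>n div 2. a k *\<^sub>m mk (int n) (cc (int k)))"
proof -
  have "\<forall>k. \<exists>a. k \<le> n div 2 \<longrightarrow> mk (int n) f * mk (int n) (cc (int k)) = a *\<^sub>m mk (int n) (cc (int k))"
  proof (intro allI)
    fix k
    have "2 * k \<le> n" if "k \<le> n div 2" using that by simp
    then show "\<exists>a. k \<le> n div 2 \<longrightarrow> mk (int n) f * mk (int n) (cc (int k)) = a *\<^sub>m mk (int n) (cc (int k))"
      using closed_mult_bubble[OF assms] by blast
  qed
  then obtain a where a: "k \<le> n div 2 \<Longrightarrow> mk (int n) f * mk (int n) (cc (int k)) = a k *\<^sub>m mk (int n) (cc (int k))" for k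
    by metis
  have "mk (int n) f = mk (int n) f * mk (int n) id0"
    using ident_mult_right[OF mk_homs, of f "[]" "[]" "int n"] assms by simp
  also have "\<dots> = (\<Sum>k\<le>n div 2. mk (int n) f * mk (int n) (cc (int k)))"
    by (simp add: sum_distrib_left flip: bubble_sum_mk)
  also have "\<dots> = (\<Sum>k\<le>n div 2. a k *\<^sub>m mk (int n) (cc (int k)))"
    by (rule sum.cong) (simp_all add: a)
  finally show ?thesis by blast
qed

section \<open>The representation on paths\<close>

text \<open>
  The vertices of the Bratteli diagram at level \<open>n\<close>; \<open>qd n k\<close> is the quantum dimension of the
  representation attached to \<open>(n, k)\<close>.
\<close>

definition vert :: "int \<Rightarrow> int \<Rightarrow> bool" where
  "vert n k \<longleftrightarrow> 0 \<le> k \<and> 2 * k \<le> n"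

definition qd :: "int \<Rightarrow> int \<Rightarrow> Cq" where
  "qd n k = qint (n - 2 * k + 1)"

primrec adj :: "sign \<Rightarrow> int \<Rightarrow> int \<Rightarrow> bool" where
  "adj Up j k \<longleftrightarrow> j = k \<or> j = k + 1"
| "adj Dn j k \<longleftrightarrow> j = k \<or> j = k - 1"

primrec valid :: "int \<Rightarrow> word \<Rightarrow> int list \<Rightarrow> bool" where
  "valid n [] L \<longleftrightarrow> (case L of [] \<Rightarrow> False | k # R \<Rightarrow> vert n k)"
| "valid n (s # w) L \<longleftrightarrow>
     (case L of [] \<Rightarrow> False | k # R \<Rightarrow> valid n w R \<and> adj s k (hd R) \<and> vert (n + wt (s # w)) k)"

text \<open>
  A path for the word \<open>w\<close> lists its vertices from left to right, so that its last relevant entry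
  belongs to the rightmost region; further entries are ignored. A diagram sends functions on the
  paths for its source to functions on the paths for its target.
\<close>

primrec sem :: "diag \<Rightarrow> int \<Rightarrow> (int list \<Rightarrow> Cq) \<Rightarrow> int list \<Rightarrow> Cq" where
  "sem (Ident w) n \<phi> L = \<phi> L"
| "sem Eta n \<phi> L = (case L of k2 # k1 # k0 # R \<Rightarrow> if k2 = k0 then \<phi> (k0 # R) else 0 | _ \<Rightarrow> 0)"
| "sem Eps n \<phi> L = (case L of k0 # R \<Rightarrow>
     (if vert (n + 1) k0 then qd (n + 1) k0 / qd n k0 * \<phi> (k0 # k0 # k0 # R) else 0)
     + (if vert (n + 1) (k0 + 1) then qd (n + 1) (k0 + 1) / qd n k0 * \<phi> (k0 # (k0 + 1) # k0 # R) else 0)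
   | _ \<Rightarrow> 0)"
| "sem Eta' n \<phi> L = (case L of k2 # k1 # k0 # R \<Rightarrow>
     if k2 = k0 then qd (n - 1) k1 / qd n k0 * \<phi> (k0 # R) else 0 | _ \<Rightarrow> 0)"
| "sem Eps' n \<phi> L = (case L of k0 # R \<Rightarrow>
     (if vert (n - 1) k0 then \<phi> (k0 # k0 # k0 # R) else 0)
     + (if vert (n - 1) (k0 - 1) then \<phi> (k0 # (k0 - 1) # k0 # R) else 0)
   | _ \<Rightarrow> 0)"
| "sem EE n \<phi> L = (case L of k2 # k1 # k0 # R \<Rightarrow>
     if k2 = k0 + 1 then qd (n + 1) k1 / (qint 2 * qd n k0) *
       ((if vert (n + 1) k0 then \<phi> (k2 # k0 # k0 # R) else 0)
        + (if vert (n + 1) (k0 + 1) then \<phi> (k2 # (k0 + 1) # k0 # R) else 0)) else 0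
   | _ \<Rightarrow> 0)"
| "sem (Bk i) n \<phi> L = bval (n + i) * \<phi> L"
| "sem (g \<circ>\<^sub>d f) n \<phi> L = sem g n (sem f n \<phi>) L"
| "sem (g \<otimes>\<^sub>d f) n \<phi> L = sem g (n + wt (dm f))
     (\<lambda>M. sem f n (\<lambda>M'. \<phi> (take (length (dm g)) M @ M')) (drop (length (dm g)) M)) L"
| "sem (Zero U V) n \<phi> L = 0"
| "sem (f +\<^sub>d g) n \<phi> L = sem f n \<phi> L + sem g n \<phi> L"
| "sem (a *\<^sub>d f) n \<phi> L = a * sem f n \<phi> L"

section \<open>Paths and their concatenation\<close>

lemma wt_simps [simp]: "wt [] = 0" "wt (s # w) = sgn_val s + wt w" "wt (v @ w) = wt v + wt w"
  by (simp_all add: wt_def)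

lemma valid_Nil_iff: "valid n [] L \<longleftrightarrow> (\<exists>k R. L = k # R \<and> vert n k)"
  by (cases L) auto

lemma valid_Cons_iff:
  "valid n (s # w) L \<longleftrightarrow> (\<exists>k R. L = k # R \<and> valid n w R \<and> adj s k (hd R) \<and> vert (n + (sgn_val s + wt w)) k)"
  by (cases L) auto

lemma valid_tail: "length p = length w \<Longrightarrow> valid n w (p @ k # R) = valid n w (p @ [k])"
proof (induction p w rule: list_induct2)
  case (Cons x xs y ys)
  then show ?case by (cases xs) auto
qed simp

lemma valid_append:
  "length p = length U \<Longrightarrow> length r = length V \<Longrightarrow>
   valid n (U @ V) (p @ r @ [k]) \<longleftrightarrow> valid n V (r @ [k]) \<and> valid (n + wt V) U (p @ [hd (r @ [k])])"
proof (induction p U rule: list_induct2)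
  case Nil
  have "valid n V (r @ [k]) \<Longrightarrow> vert (n + wt V) (hd (r @ [k]))"
    using Nil by (cases r; cases V) auto
  then show ?case by auto
next
  case (Cons x xs y ys)
  have "hd (xs @ r @ [k]) = hd (xs @ [hd (r @ [k])])" by (cases xs) auto
  with Cons show ?case by (auto simp: add.assoc add.left_commute add.commute)
qed

lemma valid_split:
  assumes "valid n w L"
  obtains p k R where "L = p @ k # R" "length p = length w" "valid n w (p @ [k])"
proof -
  have "\<exists>p k R. L = p @ k # R \<and> length p = length w"
    using assms
  proof (induction w arbitrary: L)
    case Nil
    then show ?case by (cases L) auto
  next
    case (Cons s w)
    then obtain x L' where L: "L = x # L'" "valid n w L'" by (cases L) auto
    with Cons.IH obtain p k R where "L' = p @ k # R" "length p = length w" by blast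
    with L have "L = (x # p) @ k # R" "length (x # p) = length (s # w)" by auto
    then show ?case by blast
  qed
  then show ?thesis using assms that valid_tail by metis
qed

text \<open>A row of a finite matrix: coefficients together with paths lacking their last vertex.
  The tail T, which the row does not depend on, supplies that vertex and the ignored
  entries.\<close>

definition lin :: "(Cq \<times> int list) list \<Rightarrow> (int list \<Rightarrow> Cq) \<Rightarrow> int list \<Rightarrow> Cq" where
  "lin ts \<phi> T = (\<Sum>x\<leftarrow>ts. fst x * \<phi> (snd x @ T))"

lemma lin_simps [simp]: "lin [] \<phi> T = 0" "lin (x # ts) \<phi> T = fst x * \<phi> (snd x @ T) + lin ts \<phi> T"
  "lin (ts @ us) \<phi> T = lin ts \<phi> T + lin us \<phi> T"
  by (simp_all add: lin_def)

lemma lin_scale: "lin (map (\<lambda>x. (a * fst x, snd x)) ts) \<phi> T = a * lin ts \<phi> T"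
  by (induction ts) (simp_all add: distrib_left mult.assoc)

lemma lin_prefix: "lin (map (\<lambda>x. (a * fst x, r @ snd x)) ts) \<phi> T = a * lin ts (\<lambda>L. \<phi> (r @ L)) T"
  by (induction ts) (simp_all add: distrib_left mult.assoc)

lemma lin_add: "lin ts (\<lambda>L. \<phi> L + \<psi> L) T = lin ts \<phi> T + lin ts \<psi> T"
  by (induction ts) (simp_all add: distrib_left add_ac)

lemma lin_mult: "lin ts (\<lambda>L. a * \<phi> L) T = a * lin ts \<phi> T"
  by (induction ts) (simp_all add: distrib_left mult.left_commute)

lemma lin_cong:
  "(\<And>x. x \<in> set ts \<Longrightarrow> \<phi> (snd x @ T) = \<psi> (snd x @ T')) \<Longrightarrow> lin ts \<phi> T = lin ts \<psi> T'"
  by (induction ts) simp_all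

text \<open>
  Every diagram acts by a finite matrix preserving both end vertices of a path: \<open>ts\<close> lists the row
  of \<open>p\<close>, where \<open>p\<close> omits the last vertex \<open>k\<close>.
\<close>

definition mat :: "int \<Rightarrow> word \<Rightarrow> int list \<Rightarrow> int \<Rightarrow> (Cq \<times> int list) list \<Rightarrow> bool" where
  "mat n U p k ts \<longleftrightarrow>
     (\<forall>x\<in>set ts. length (snd x) = length U \<and> valid n U (snd x @ [k]) \<and> hd (snd x @ [k]) = hd (p @ [k]))"

lemma mat_Nil [simp]: "mat n U p k []"
  by (simp add: mat_def)

lemma mat_append [simp]: "mat n U p k (ts @ us) \<longleftrightarrow> mat n U p k ts \<and> mat n U p k us"
  by (auto simp: mat_def)

lemma mat_Cons [simp]: "mat n U p k (x # ts) \<longleftrightarrow> (length (snd x) = length U \<and> valid n U (snd x @ [k])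
    \<and> hd (snd x @ [k]) = hd (p @ [k])) \<and> mat n U p k ts"
  by (auto simp: mat_def)

lemma mat_scale: "mat n U p k ts \<Longrightarrow> mat n U p k (map (\<lambda>x. (a * fst x, snd x)) ts)"
  by (auto simp: mat_def)

lemma length_2_cases: "length p = Suc (Suc 0) \<Longrightarrow> \<exists>a b. p = [a, b]"
  by (auto simp: length_Suc_conv)

text \<open>\<open>sem\<close> is defined on arbitrary functions, so its linearity and locality are
  not visible from its type. A finite row, independent of the function and of the ignored entries,
  yields \<open>sem_cong\<close>, \<open>sem_linear\<close> and \<open>sem_commute\<close>.\<close>

lemma sem_mat:
  "typed f \<Longrightarrow> length p = length (cd f) \<Longrightarrow> valid n (cd f) (p @ [k]) \<Longrightarrow>
     \<exists>ts. mat n (dm f) p k ts \<and> (\<forall>\<phi> R. sem f n \<phi> (p @ k # R) = lin ts \<phi> (k # R))"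
proof (induction f arbitrary: n p k)
  case (Ident w)
  then show ?case by (intro exI[of _ "[(1, p)]"]) simp
next
  case Eta
  from \<open>length p = _\<close> have "length p = Suc (Suc 0)" by simp
  then obtain a b where p: "p = [a, b]" using length_2_cases by blast
  show ?case using Eta p
    by (intro exI[of _ "if a = k then [(1, [])] else []"]) (auto simp: vert_def)
next
  case Eps
  define ts where "ts = (if vert (n + 1) k then [(qd (n + 1) k / qd n k, [k, k])] else []) @
    (if vert (n + 1) (k + 1) then [(qd (n + 1) (k + 1) / qd n k, [k, k + 1])] else [])"
  have "mat n (dm Eps) p k ts" using Eps by (auto simp: ts_def)
  moreover have "\<forall>\<phi> R. sem Eps n \<phi> (p @ k # R) = lin ts \<phi> (k # R)" using Eps by (auto simp: ts_def)
  ultimately show ?case by blast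
next
  case Eta'
  from \<open>length p = _\<close> have "length p = Suc (Suc 0)" by simp
  then obtain a b where p: "p = [a, b]" using length_2_cases by blast
  show ?case using Eta' p
    by (intro exI[of _ "if a = k then [(qd (n - 1) b / qd n k, [])] else []"]) (auto simp: vert_def)
next
  case Eps'
  define ts where "ts = (if vert (n - 1) k then [(1 :: Cq, [k, k])] else []) @
    (if vert (n - 1) (k - 1) then [(1, [k, k - 1])] else [])"
  have "mat n (dm Eps') p k ts" using Eps' by (auto simp: ts_def)
  moreover have "\<forall>\<phi> R. sem Eps' n \<phi> (p @ k # R) = lin ts \<phi> (k # R)" using Eps' by (auto simp: ts_def)
  ultimately show ?case by blast
next
  case EE
  from \<open>length p = _\<close> have "length p = Suc (Suc 0)" by simp
  then obtain a b where p: "p = [a, b]" using length_2_cases by blast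
  define c where "c = qd (n + 1) b / (qint 2 * qd n k)"
  define ts where "ts = (if a = k + 1 then (if vert (n + 1) k then [(c, [a, k])] else []) @
    (if vert (n + 1) (k + 1) then [(c, [a, k + 1])] else []) else [])"
  have "mat n (dm EE) p k ts" using EE p by (auto simp: ts_def)
  moreover have "\<forall>\<phi> R. sem EE n \<phi> (p @ k # R) = lin ts \<phi> (k # R)"
    using EE p by (auto simp: ts_def c_def distrib_left)
  ultimately show ?case by blast
next
  case (Bk i)
  then show ?case by (intro exI[of _ "[(bval (n + i), [])]"]) simp
next
  case (Comp g f)
  then obtain ts where ts: "mat n (dm g) p k ts" "\<And>\<phi> R. sem g n \<phi> (p @ k # R) = lin ts \<phi> (k # R)"
    by (metis typed.simps(8) cd.simps(8))
  have "\<exists>us. mat n (dm f) p k us \<and> (\<forall>\<phi> R. lin ts (sem f n \<phi>) (k # R) = lin us \<phi> (k # R))"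
    using ts(1)
  proof (induction ts)
    case Nil
    show ?case by (intro exI[of _ "[]"]) simp
  next
    case (Cons x ts)
    then obtain us where us: "mat n (dm f) p k us" "\<And>\<phi> R. lin ts (sem f n \<phi>) (k # R) = lin us \<phi> (k # R)"
      by auto
    obtain vs where vs: "mat n (dm f) (snd x) k vs"
      "\<And>\<phi> R. sem f n \<phi> (snd x @ k # R) = lin vs \<phi> (k # R)"
      using Comp.IH(2)[of "snd x" n k] Comp.prems Cons.prems by auto
    have "mat n (dm f) p k (map (\<lambda>y. (fst x * fst y, snd y)) vs @ us)"
      using us(1) vs(1) Cons.prems by (auto simp: mat_def)
    moreover have "\<forall>\<phi> R. lin (x # ts) (sem f n \<phi>) (k # R)
        = lin (map (\<lambda>y. (fst x * fst y, snd y)) vs @ us) \<phi> (k # R)"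
      by (simp add: us(2) vs(2) lin_scale)
    ultimately show ?case by blast
  qed
  then show ?case using ts(2) by simp
next
  case (Tens g f)
  define pg pf where "pg = take (length (cd g)) p" and "pf = drop (length (cd g)) p"
  have p: "p = pg @ pf" "length pg = length (cd g)" "length pf = length (cd f)"
    using Tens.prems by (simp_all add: pg_def pf_def)
  define h where "h = hd (pf @ [k])"
  have t: "typed g" "typed f" using Tens.prems by auto
  have w: "wt (cd f) = wt (dm f)" using weight_cd[OF t(2)] .
  have v: "valid n (cd f) (pf @ [k])" "valid (n + wt (dm f)) (cd g) (pg @ [h])"
    using Tens.prems valid_append[OF p(2,3), of n k] by (simp_all add: p(1) h_def w)
  obtain ts where ts: "mat (n + wt (dm f)) (dm g) pg h ts"
    "\<And>\<phi> R. sem g (n + wt (dm f)) \<phi> (pg @ h # R) = lin ts \<phi> (h # R)"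
    using Tens.IH(1)[OF t(1) p(2) v(2)] by auto
  obtain us where us: "mat n (dm f) pf k us" "\<And>\<phi> R. sem f n \<phi> (pf @ k # R) = lin us \<phi> (k # R)"
    using Tens.IH(2)[OF t(2) p(3) v(1)] by auto
  \<comment> \<open>The first vertex of the path for f is the last vertex of the path for g, so the
    row of g is taken with h in place of k.\<close>
  have hT: "pf @ k # R = h # tl (pf @ k # R)" for R by (cases pf) (auto simp: h_def)
  have "\<exists>vs. mat n (dm g @ dm f) p k vs \<and> (\<forall>\<phi> R. lin ts
     (\<lambda>M. sem f n (\<lambda>M'. \<phi> (take (length (dm g)) M @ M')) (drop (length (dm g)) M)) (pf @ k # R)
     = lin vs \<phi> (k # R))"
    using ts(1)
  proof (induction ts)
    case Nil
    show ?case by (intro exI[of _ "[]"]) simp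
  next
    case (Cons x ts)
    then obtain vs where vs: "mat n (dm g @ dm f) p k vs" "\<And>\<phi> R. lin ts
       (\<lambda>M. sem f n (\<lambda>M'. \<phi> (take (length (dm g)) M @ M')) (drop (length (dm g)) M)) (pf @ k # R)
       = lin vs \<phi> (k # R)" by auto
    have x: "length (snd x) = length (dm g)" "valid (n + wt (dm f)) (dm g) (snd x @ [h])" "hd (snd x @ [h]) = hd (pg @ [h])"
      using Cons.prems by auto
    have "mat n (dm g @ dm f) p k (map (\<lambda>y. (fst x * fst y, snd x @ snd y)) us)"
      unfolding mat_def
    proof (rule ballI)
      fix y assume "y \<in> set (map (\<lambda>y. (fst x * fst y, snd x @ snd y)) us)"
      then obtain a b where "(a, b) \<in> set us" and y: "y = (fst x * a, snd x @ b)" by auto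
      then have b: "length b = length (dm f)" "valid n (dm f) (b @ [k])" "hd (b @ [k]) = h"
        using us(1) by (auto simp: mat_def h_def)
      have "hd (snd x @ b @ [k]) = hd (snd x @ [h])" using b(3) by (cases "snd x"; cases b) auto
      moreover have "hd (p @ [k]) = hd (pg @ [h])" unfolding p(1) h_def by (cases pg; cases pf) auto
      ultimately show "length (snd y) = length (dm g @ dm f)
          \<and> valid n (dm g @ dm f) (snd y @ [k]) \<and> hd (snd y @ [k]) = hd (p @ [k])"
        unfolding y using b x valid_append[OF x(1) b(1), of n k] by simp
    qed
    then have "mat n (dm g @ dm f) p k (map (\<lambda>y. (fst x * fst y, snd x @ snd y)) us @ vs)"
      using vs(1) by simp
    moreover have "\<forall>\<phi> R. lin (x # ts)
       (\<lambda>M. sem f n (\<lambda>M'. \<phi> (take (length (dm g)) M @ M')) (drop (length (dm g)) M)) (pf @ k # R)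
       = lin (map (\<lambda>y. (fst x * fst y, snd x @ snd y)) us @ vs) \<phi> (k # R)"
      by (simp add: vs(2) us(2) lin_prefix x(1))
    ultimately show ?case by blast
  qed
  then obtain vs where vs: "mat n (dm g @ dm f) p k vs" "\<And>\<phi> R. lin ts
     (\<lambda>M. sem f n (\<lambda>M'. \<phi> (take (length (dm g)) M @ M')) (drop (length (dm g)) M)) (pf @ k # R)
     = lin vs \<phi> (k # R)" by blast
  have "sem (g \<otimes>\<^sub>d f) n \<phi> (p @ k # R) = lin vs \<phi> (k # R)" for \<phi> R
    using ts(2)[of _ "tl (pf @ k # R)"] vs(2)[of \<phi> R] by (simp add: p(1) flip: hT)
  with vs(1) show ?case by auto
next
  case (Zero U V)
  show ?case by (intro exI[of _ "[]"]) simp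
next
  case (Add f g)
  obtain ts where ts: "mat n (dm f) p k ts" "\<And>\<phi> R. sem f n \<phi> (p @ k # R) = lin ts \<phi> (k # R)"
    using Add.IH(1)[of p n k] Add.prems by auto
  obtain us where us: "mat n (dm f) p k us" "\<And>\<phi> R. sem g n \<phi> (p @ k # R) = lin us \<phi> (k # R)"
    using Add.IH(2)[of p n k] Add.prems by auto
  show ?case using ts us by (intro exI[of _ "ts @ us"]) simp
next
  case (Scal a f)
  obtain ts where ts: "mat n (dm f) p k ts" "\<And>\<phi> R. sem f n \<phi> (p @ k # R) = lin ts \<phi> (k # R)"
    using Scal.IH[of p n k] Scal.prems by auto
  show ?case using ts by (intro exI[of _ "map (\<lambda>x. (a * fst x, snd x)) ts"]) (simp add: mat_scale lin_scale)
qed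

lemma sem_cong_tail:
  assumes "typed f" "length p = length (cd f)" "valid n (cd f) (p @ [k])"
    "\<And>r. length r = length (dm f) \<Longrightarrow> valid n (dm f) (r @ [k]) \<Longrightarrow> \<phi> (r @ k # R) = \<psi> (r @ k # R)"
  shows "sem f n \<phi> (p @ k # R) = sem f n \<psi> (p @ k # R)"
proof -
  obtain ts where ts: "mat n (dm f) p k ts" "\<And>\<phi> R. sem f n \<phi> (p @ k # R) = lin ts \<phi> (k # R)"
    using sem_mat[OF assms(1-3)] by blast
  have "lin ts \<phi> (k # R) = lin ts \<psi> (k # R)"
    using ts(1) assms(4) by (intro lin_cong) (auto simp: mat_def)
  then show ?thesis by (simp add: ts(2))
qed

lemma sem_cong:
  assumes "typed f" "valid n (cd f) L" "\<And>M. valid n (dm f) M \<Longrightarrow> \<phi> M = \<psi> M"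
  shows "sem f n \<phi> L = sem f n \<psi> L"
  using assms(2)
proof (rule valid_split)
  fix p k R assume *: "L = p @ k # R" "length p = length (cd f)" "valid n (cd f) (p @ [k])"
  show ?thesis unfolding *(1)
  proof (rule sem_cong_tail[OF assms(1) *(2,3)])
    fix r assume "length r = length (dm f)" "valid n (dm f) (r @ [k])"
    then show "\<phi> (r @ k # R) = \<psi> (r @ k # R)" using assms(3)[of "r @ k # R"] valid_tail[of r "dm f" n k R] by simp
  qed
qed

lemma sem_linear:
  assumes "typed f" "valid n (cd f) L"
  shows "sem f n (\<lambda>M. \<phi> M + \<psi> M) L = sem f n \<phi> L + sem f n \<psi> L"
    "sem f n (\<lambda>M. a * \<phi> M) L = a * sem f n \<phi> L"
proof -
  obtain p k R where *: "L = p @ k # R" "length p = length (cd f)" "valid n (cd f) (p @ [k])"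
    using assms(2) by (rule valid_split)
  obtain ts where ts: "\<And>\<phi> R. sem f n \<phi> (p @ k # R) = lin ts \<phi> (k # R)"
    using sem_mat[OF assms(1) *(2,3)] by blast
  show "sem f n (\<lambda>M. \<phi> M + \<psi> M) L = sem f n \<phi> L + sem f n \<psi> L"
    "sem f n (\<lambda>M. a * \<phi> M) L = a * sem f n \<phi> L"
    by (simp_all add: *(1) ts lin_add lin_mult)
qed

text \<open>The rows of f preserve the vertex h shared by the two stretches of the path. Thus g
  meets the same last vertex before and after f, and two finite sums are exchanged.\<close>

lemma sem_commute:
  assumes "typed g" "typed f" "valid n (cd g @ cd f) (pg @ pf @ [k])"
    "length pg = length (cd g)" "length pf = length (cd f)" "N = n + wt (dm f)"
  shows "sem f n (\<lambda>M'. sem g N \<chi> (pg @ M')) (pf @ k # R)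
    = sem g N (\<lambda>M. sem f n (\<lambda>M'. \<chi> (take (length (dm g)) M @ M')) (drop (length (dm g)) M)) (pg @ pf @ k # R)"
proof -
  define h where "h = hd (pf @ [k])"
  have w: "wt (cd f) = wt (dm f)" using weight_cd[OF assms(2)] .
  have v: "valid n (cd f) (pf @ [k])" "valid N (cd g) (pg @ [h])"
    using assms(3) valid_append[OF assms(4,5), of n k] by (simp_all add: h_def w assms(6))
  obtain us where us: "mat N (dm g) pg h us" "\<And>\<phi> R. sem g N \<phi> (pg @ h # R) = lin us \<phi> (h # R)"
    using sem_mat[OF assms(1,4) v(2)] by blast
  obtain ts where ts: "mat n (dm f) pf k ts" "\<And>\<phi> R. sem f n \<phi> (pf @ k # R) = lin ts \<phi> (k # R)"
    using sem_mat[OF assms(2,5) v(1)] by blast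
  have len: "length (snd x) = length (dm g)" if "x \<in> set us" for x
    using us(1) that by (auto simp: mat_def)
  have hT: "T @ k # R = h # tl (T @ k # R)" if "hd (T @ [k]) = h" for T
    using that by (cases T) auto
  have "lin ts (\<lambda>M'. sem g N \<chi> (pg @ M')) (k # R) = lin us (\<lambda>M. lin ts (\<lambda>M'. \<chi> (take (length (dm g)) M @ M')) (k # R)) (pf @ k # R)"
    using ts(1)
  proof (induction ts)
    case Nil
    have "lin us (\<lambda>M. 0) T = 0" for T by (induction us) simp_all
    then show ?case by simp
  next
    case (Cons x ts)
    then have x: "hd (snd x @ [k]) = h" by (simp add: h_def)
    have "sem g N \<chi> (pg @ snd x @ k # R) = lin us \<chi> (snd x @ k # R)"
      using us(2)[of \<chi> "tl (snd x @ k # R)"] hT[OF x] by metis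
    also have "\<dots> = lin us (\<lambda>M. \<chi> (take (length (dm g)) M @ snd x @ k # R)) (pf @ k # R)"
      by (rule lin_cong) (simp add: len)
    finally show ?case using Cons by (simp add: lin_add lin_mult)
  qed
  also have "\<dots> = lin us (\<lambda>M. sem f n (\<lambda>M'. \<chi> (take (length (dm g)) M @ M')) (drop (length (dm g)) M)) (pf @ k # R)"
    by (rule lin_cong) (simp add: len ts(2))
  also have "\<dots> = sem g N (\<lambda>M. sem f n (\<lambda>M'. \<chi> (take (length (dm g)) M @ M')) (drop (length (dm g)) M)) (pg @ pf @ k # R)"
  proof -
    have "hd (pf @ [k]) = h" by (simp add: h_def)
    from hT[OF this] obtain T where T: "pf @ k # R = h # T" by blast
    show ?thesis unfolding T by (rule us(2)[symmetric])
  qed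
  finally show ?thesis by (simp add: ts(2))
qed

section \<open>Soundness of the structural rules\<close>

definition sound :: "int \<Rightarrow> diag \<Rightarrow> diag \<Rightarrow> bool" where
  "sound n f g \<longleftrightarrow> (\<forall>\<phi> L. valid n (cd f) L \<longrightarrow> sem f n \<phi> L = sem g n \<phi> L)"

lemma soundI: "(\<And>\<phi> L. valid n (cd f) L \<Longrightarrow> sem f n \<phi> L = sem g n \<phi> L) \<Longrightarrow> sound n f g"
  by (simp add: sound_def)

lemma sound_tens:
  assumes "weyl_eq (n + wt (dm f)) g g'" "weyl_eq n f f'" "sound (n + wt (dm f)) g g'" "sound n f f'"
  shows "sound n (g \<otimes>\<^sub>d f) (g' \<otimes>\<^sub>d f')"
proof (rule soundI)
  fix \<phi> L assume "valid n (cd (g \<otimes>\<^sub>d f)) L"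
  then obtain p k R where *: "L = p @ k # R" "length p = length (cd (g \<otimes>\<^sub>d f))" "valid n (cd (g \<otimes>\<^sub>d f)) (p @ [k])"
    by (rule valid_split)
  note t = weyl_eq_typed[OF assms(1)] weyl_eq_typed[OF assms(2)]
  define pg pf where "pg = take (length (cd g)) p" and "pf = drop (length (cd g)) p"
  have p: "p = pg @ pf" "length pg = length (cd g)" "length pf = length (cd f)"
    using * by (simp_all add: pg_def pf_def)
  define h T where "h = hd (pf @ [k])" and "T = tl (pf @ k # R)"
  have hT: "pf @ k # R = h # T" by (cases pf) (auto simp: h_def T_def)
  have w: "wt (cd f) = wt (dm f)" using weight_cd t by blast
  have v: "valid n (cd f) (pf @ [k])" "valid (n + wt (dm f)) (cd g) (pg @ [h])"
    using * valid_append[OF p(2,3), of n k] by (simp_all add: p(1) h_def w)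
  have "sem (g \<otimes>\<^sub>d f) n \<phi> L = sem g (n + wt (dm f))
     (\<lambda>M. sem f n (\<lambda>M'. \<phi> (take (length (dm g)) M @ M')) (drop (length (dm g)) M)) (pg @ h # T)"
    by (simp add: *(1) p(1) hT)
  also have "\<dots> = sem g' (n + wt (dm f))
     (\<lambda>M. sem f n (\<lambda>M'. \<phi> (take (length (dm g)) M @ M')) (drop (length (dm g)) M)) (pg @ h # T)"
    using assms(3) v(2) valid_tail[OF p(2), of _ h T] unfolding sound_def by blast
  also have "\<dots> = sem g' (n + wt (dm f))
     (\<lambda>M. sem f' n (\<lambda>M'. \<phi> (take (length (dm g)) M @ M')) (drop (length (dm g)) M)) (pg @ h # T)"
  proof (rule sem_cong_tail)
    fix r :: "int list" assume "length r = length (dm g')"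
    then have "length r = length (dm g)" using t by simp
    then show "sem f n (\<lambda>M'. \<phi> (take (length (dm g)) (r @ h # T) @ M')) (drop (length (dm g)) (r @ h # T))
      = sem f' n (\<lambda>M'. \<phi> (take (length (dm g)) (r @ h # T) @ M')) (drop (length (dm g)) (r @ h # T))"
      using assms(4) v(1) valid_tail[OF p(3), of n k R] unfolding sound_def hT by simp
  qed (use t v p in auto)
  finally show "sem (g \<otimes>\<^sub>d f) n \<phi> L = sem (g' \<otimes>\<^sub>d f') n \<phi> L"
    using t by (simp add: *(1) p(1) hT)
qed

lemma sound_tens_assoc:
  assumes "typed (h \<otimes>\<^sub>d g \<otimes>\<^sub>d f)"
  shows "sound n ((h \<otimes>\<^sub>d g) \<otimes>\<^sub>d f) (h \<otimes>\<^sub>d g \<otimes>\<^sub>d f)"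
proof (rule soundI)
  fix \<phi> L assume "valid n (cd ((h \<otimes>\<^sub>d g) \<otimes>\<^sub>d f)) L"
  then have "valid n (cd h @ (cd g @ cd f)) L" by simp
  then obtain p k R where *: "L = p @ k # R" "length p = length (cd h @ (cd g @ cd f))" "valid n (cd h @ (cd g @ cd f)) (p @ [k])"
    by (rule valid_split)
  define ph pf where "ph = take (length (cd h)) p" and "pf = drop (length (cd h)) p"
  have p: "p = ph @ pf" "length ph = length (cd h)" "length pf = length (cd g @ cd f)"
    using * by (simp_all add: ph_def pf_def)
  define e T where "e = hd (pf @ [k])" and "T = tl (pf @ k # R)"
  have hT: "pf @ k # R = e # T" by (cases pf) (auto simp: e_def T_def)
  have w: "wt (cd f) = wt (dm f)" "wt (cd g) = wt (dm g)" using weight_cd assms by auto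
  have v: "valid (n + wt (dm f) + wt (dm g)) (cd h) (ph @ [e])"
    using * valid_append[OF p(2,3), of n k] by (simp add: p(1) e_def w add_ac)
  show "sem ((h \<otimes>\<^sub>d g) \<otimes>\<^sub>d f) n \<phi> L = sem (h \<otimes>\<^sub>d g \<otimes>\<^sub>d f) n \<phi> L"
    unfolding *(1) p(1) append_assoc hT sem.simps dm.simps wt_simps add.assoc[symmetric]
      add.commute[of "wt (dm g)" "wt (dm f)"]
    by (rule sem_cong_tail[OF _ p(2) v]) (use assms in \<open>simp_all add: add.commute\<close>)
qed

lemma sound_interchange:
  assumes "typed (g' \<circ>\<^sub>d g)" "typed (f' \<circ>\<^sub>d f)"
  shows "sound n ((g' \<otimes>\<^sub>d f') \<circ>\<^sub>d (g \<otimes>\<^sub>d f)) ((g' \<circ>\<^sub>d g) \<otimes>\<^sub>d (f' \<circ>\<^sub>d f))"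
proof (rule soundI)
  fix \<phi> L assume "valid n (cd ((g' \<otimes>\<^sub>d f') \<circ>\<^sub>d (g \<otimes>\<^sub>d f))) L"
  then have "valid n (cd g' @ cd f') L" by simp
  then obtain p k R where *: "L = p @ k # R" "length p = length (cd g' @ cd f')" "valid n (cd g' @ cd f') (p @ [k])"
    by (rule valid_split)
  define pg pf where "pg = take (length (cd g')) p" and "pf = drop (length (cd g')) p"
  have p: "p = pg @ pf" "length pg = length (cd g')" "length pf = length (cd f')"
    using * by (simp_all add: pg_def pf_def)
  define h T where "h = hd (pf @ [k])" and "T = tl (pf @ k # R)"
  have hT: "pf @ k # R = h # T" by (cases pf) (auto simp: h_def T_def)
  have w: "wt (cd f') = wt (dm f)" "wt (dm f') = wt (dm f)" using weight_cd[of f] weight_cd[of f'] assms by auto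
  define N where "N = n + wt (dm f)"
  have v: "valid n (cd f') (pf @ [k])" "valid N (cd g') (pg @ [h])"
    using * valid_append[OF p(2,3), of n k] by (simp_all add: p(1) h_def w N_def)
  let ?psi = "\<lambda>M. sem f n (\<lambda>M'. \<phi> (take (length (dm g)) M @ M')) (drop (length (dm g)) M)"
  have t: "typed g'" "typed g" "typed f'" "typed f" "dm g' = cd g" "dm f' = cd f" using assms by auto
  have "sem ((g' \<otimes>\<^sub>d f') \<circ>\<^sub>d (g \<otimes>\<^sub>d f)) n \<phi> L = sem g' N
     (\<lambda>M. sem f' n (\<lambda>M'. sem g N ?psi (take (length (dm g')) M @ M')) (drop (length (dm g')) M)) (pg @ h # T)"
    by (simp add: *(1) p(1) hT w N_def)
  \<comment> \<open>The diagrams f' on the right and g on the left act on stretches of the path that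
    share one vertex only; \<open>sem_commute\<close> swaps them.\<close>
  also have "\<dots> = sem g' N (\<lambda>M. sem g N (\<lambda>M1. sem f' n (\<lambda>M'. ?psi (take (length (dm g)) M1 @ M')) (drop (length (dm g)) M1)) M) (pg @ h # T)"
  proof (rule sem_cong_tail[OF t(1) p(2) v(2)])
    fix r assume r: "length r = length (dm g')" "valid N (dm g') (r @ [h])"
    have "valid n (cd g @ cd f') (r @ pf @ [k])"
      using valid_append[of r "cd g" pf "cd f'" n k] r v p t by (simp add: h_def[symmetric] w N_def)
    moreover have tk: "take (length (dm g')) (r @ h # T) = r" "drop (length (dm g')) (r @ h # T) = h # T"
      using r by simp_all
    ultimately show "sem f' n (\<lambda>M'. sem g N ?psi (take (length (dm g')) (r @ h # T) @ M')) (drop (length (dm g')) (r @ h # T))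
      = sem g N (\<lambda>M1. sem f' n (\<lambda>M'. ?psi (take (length (dm g)) M1 @ M')) (drop (length (dm g)) M1)) (r @ h # T)"
      unfolding tk hT[symmetric] using sem_commute[OF t(2,3) _ _ p(3), of n r k N ?psi R] r(1) t(5) w N_def by simp
  qed
  also have "\<dots> = sem g' N (sem g N (\<lambda>M1. sem f' n (\<lambda>M'. sem f n (\<lambda>M''. \<phi> (take (length (dm g)) M1 @ M'')) M') (drop (length (dm g)) M1))) (pg @ h # T)"
  proof (rule sem_cong_tail[OF t(1) p(2) v(2)])
    fix r assume r: "length r = length (dm g')" "valid N (dm g') (r @ [h])"
    show "sem g N (\<lambda>M1. sem f' n (\<lambda>M'. ?psi (take (length (dm g)) M1 @ M')) (drop (length (dm g)) M1)) (r @ h # T)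
      = sem g N (\<lambda>M1. sem f' n (\<lambda>M'. sem f n (\<lambda>M''. \<phi> (take (length (dm g)) M1 @ M'')) M') (drop (length (dm g)) M1)) (r @ h # T)"
      by (rule sem_cong_tail[OF t(2)]) (use r t in simp_all)
  qed
  finally show "sem ((g' \<otimes>\<^sub>d f') \<circ>\<^sub>d (g \<otimes>\<^sub>d f)) n \<phi> L = sem ((g' \<circ>\<^sub>d g) \<otimes>\<^sub>d (f' \<circ>\<^sub>d f)) n \<phi> L"
    by (simp add: *(1) p(1) hT N_def)
qed

section \<open>The defining relations on paths\<close>

lemma qd_nonzero: "vert n k \<Longrightarrow> qd n k \<noteq> 0"
  by (simp add: vert_def qd_def qint_nonzero)

lemma sem_comp: "sem (g \<circ>\<^sub>d f) n \<phi> = sem g n (sem f n \<phi>)" by (rule ext) simp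

lemma sem_Ident_ext: "sem (Ident w) n \<phi> = \<phi>" by (rule ext) simp

lemma sem_add_ext: "sem (f +\<^sub>d g) n \<phi> = (\<lambda>L. sem f n \<phi> L + sem g n \<phi> L)" by (rule ext) simp

lemma sem_scal_ext: "sem (a *\<^sub>d f) n \<phi> = (\<lambda>L. a * sem f n \<phi> L)" by (rule ext) simp

lemma sem_whisk_left: "sem (Ident [s] \<otimes>\<^sub>d f) n \<phi> (a # L) = sem f n (\<lambda>M. \<phi> (a # M)) L"
  by simp

lemma sem_whisk_right:
  "sem (g \<otimes>\<^sub>d Ident V) n \<phi> L = sem g (n + wt V) \<phi> L"
  "sem (g \<otimes>\<^sub>d Ident V \<otimes>\<^sub>d Ident W) n \<phi> L = sem g (n + (wt V + wt W)) \<phi> L"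
  "sem (g \<otimes>\<^sub>d Ident V \<otimes>\<^sub>d Ident W \<otimes>\<^sub>d Ident Z) n \<phi> L = sem g (n + (wt V + (wt W + wt Z))) \<phi> L"
  by simp_all

lemma sem_gens:
  "sem Eta n \<phi> (k2 # k1 # k0 # R) = (if k2 = k0 then \<phi> (k0 # R) else 0)"
  "sem Eps n \<phi> (k0 # R) =
     (if vert (n + 1) k0 then qd (n + 1) k0 / qd n k0 * \<phi> (k0 # k0 # k0 # R) else 0)
     + (if vert (n + 1) (k0 + 1) then qd (n + 1) (k0 + 1) / qd n k0 * \<phi> (k0 # (k0 + 1) # k0 # R) else 0)"
  "sem Eta' n \<phi> (k2 # k1 # k0 # R) = (if k2 = k0 then qd (n - 1) k1 / qd n k0 * \<phi> (k0 # R) else 0)"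
  "sem Eps' n \<phi> (k0 # R) =
     (if vert (n - 1) k0 then \<phi> (k0 # k0 # k0 # R) else 0)
     + (if vert (n - 1) (k0 - 1) then \<phi> (k0 # (k0 - 1) # k0 # R) else 0)"
  "sem EE n \<phi> (k2 # k1 # k0 # R) =
     (if k2 = k0 + 1 then qd (n + 1) k1 / (qint 2 * qd n k0) *
       ((if vert (n + 1) k0 then \<phi> (k2 # k0 # k0 # R) else 0)
        + (if vert (n + 1) (k0 + 1) then \<phi> (k2 # (k0 + 1) # k0 # R) else 0)) else 0)"
  by simp_all

declare sem.simps(2-6,9) [simp del] valid.simps [simp del]

lemmas sem_rules = sem_whisk_left sem_whisk_right sem_gens
lemmas valid_iff = valid_Nil_iff valid_Cons_iff

lemma sound_zigzag:
  "sound n ((Eps' \<otimes>\<^sub>d idP) \<circ>\<^sub>d (idP \<otimes>\<^sub>d Eta)) idP"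
  "sound n ((idP \<otimes>\<^sub>d Eps) \<circ>\<^sub>d (Eta' \<otimes>\<^sub>d idP)) idP"
  "sound n ((idM \<otimes>\<^sub>d Eps') \<circ>\<^sub>d (Eta \<otimes>\<^sub>d idM)) idM"
  "sound n ((Eps \<otimes>\<^sub>d idM) \<circ>\<^sub>d (idM \<otimes>\<^sub>d Eta')) idM"
  by (rule soundI; clarsimp simp: valid_iff; auto simp: sem_rules qd_nonzero)+

text \<open>The parameter m is n - 2 * k0 + 1, so that \<open>qd n k0\<close> is [m] and the
  neighbouring dimensions become [m + i] with a small i. In this form the relations turn into
  cancellations of quantum integers.\<close>

lemma valid_1E:
  assumes "valid n [s1] L"
  obtains k1 k0 R m where "L = k1 # k0 # R" "n = m + 2 * k0 - 1" "1 \<le> m" "0 \<le> k0"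
    "adj s1 k1 k0" "vert (m + 2 * k0 - 1 + sgn_val s1) k1"
proof -
  from assms obtain k1 k0 R where *: "L = k1 # k0 # R" "adj s1 k1 k0" "vert (n + sgn_val s1) k1" "vert n k0"
    by (auto simp: valid_iff)
  then show thesis using that[of k1 k0 R "n - 2 * k0 + 1"] by (auto simp: vert_def)
qed

lemma valid_2E:
  assumes "valid n [s2, s1] L"
  obtains k2 k1 k0 R m where "L = k2 # k1 # k0 # R" "n = m + 2 * k0 - 1" "1 \<le> m" "0 \<le> k0"
    "adj s2 k2 k1" "adj s1 k1 k0" "vert (m + 2 * k0 - 1 + sgn_val s1) k1"
    "vert (m + 2 * k0 - 1 + (sgn_val s2 + sgn_val s1)) k2"
proof -
  from assms obtain k2 L' where *: "L = k2 # L'" "valid n [s1] L'" "adj s2 k2 (hd L')" "vert (n + (sgn_val s2 + sgn_val s1)) k2"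
    by (auto simp: valid_Cons_iff)
  from *(2) show thesis by (rule valid_1E) (use * that in auto)
qed

lemma valid_3E:
  assumes "valid n [s3, s2, s1] L"
  obtains k3 k2 k1 k0 R m where "L = k3 # k2 # k1 # k0 # R" "n = m + 2 * k0 - 1" "1 \<le> m" "0 \<le> k0"
    "adj s3 k3 k2" "adj s2 k2 k1" "adj s1 k1 k0" "vert (m + 2 * k0 - 1 + sgn_val s1) k1"
    "vert (m + 2 * k0 - 1 + (sgn_val s2 + sgn_val s1)) k2"
    "vert (m + 2 * k0 - 1 + (sgn_val s3 + (sgn_val s2 + sgn_val s1))) k3"
proof -
  from assms obtain k3 L' where *: "L = k3 # L'" "valid n [s2, s1] L'" "adj s3 k3 (hd L')"
      "vert (n + (sgn_val s3 + (sgn_val s2 + sgn_val s1))) k3"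
    by (auto simp: valid_Cons_iff)
  from *(2) show thesis by (rule valid_2E) (use * that in auto)
qed

lemmas sem_arith = qd_def qint_nonzero
lemmas sem_field = qint_nonzero power2_eq_square power3_eq_cube field_simps

lemma sound_r3a: "sound n (qint 2 *\<^sub>d (Eps \<otimes>\<^sub>d idP) \<circ>\<^sub>d (idM \<otimes>\<^sub>d EE) \<circ>\<^sub>d (Eta \<otimes>\<^sub>d idP)) idP"
  apply (rule soundI)
  apply simp
  apply (erule valid_1E)
  apply hypsubst
  apply (simp only: adj.simps; elim disjE; simp add: sem_rules vert_def; (simp add: sem_arith)?; (simp add: sem_field)?)
  done

lemma sound_r1a: "sound n (qint 2 ^ 3 *\<^sub>d (EE \<otimes>\<^sub>d idP) \<circ>\<^sub>d (idP \<otimes>\<^sub>d EE) \<circ>\<^sub>d (EE \<otimes>\<^sub>d idP)) (qint 2 *\<^sub>d EE \<otimes>\<^sub>d idP)"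
  apply (rule soundI)
  apply simp
  apply (erule valid_3E)
  apply hypsubst
  apply (simp only: adj.simps; elim disjE; simp add: sem_rules vert_def; (simp add: sem_arith)?; (simp add: sem_field)?)
  done

lemma sound_r2a: "sound n (qint 2 ^ 2 *\<^sub>d (EE \<otimes>\<^sub>d idM) \<circ>\<^sub>d (idP \<otimes>\<^sub>d (Eta' \<circ>\<^sub>d Eps')) \<circ>\<^sub>d (EE \<otimes>\<^sub>d idM))
                 (qint 2 *\<^sub>d EE \<otimes>\<^sub>d idM)"
  apply (rule soundI)
  apply simp
  apply (erule valid_3E)
  apply hypsubst
  apply (simp only: adj.simps; elim disjE; simp add: sem_rules vert_def; (simp add: sem_arith)?; (simp add: sem_field)?)
  done

lemma sound_r2b: "sound n (qint 2 ^ 2 *\<^sub>d (idM \<otimes>\<^sub>d EE) \<circ>\<^sub>d ((Eta \<circ>\<^sub>d Eps) \<otimes>\<^sub>d idP) \<circ>\<^sub>d (idM \<otimes>\<^sub>d EE))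
                 (qint 2 *\<^sub>d idM \<otimes>\<^sub>d EE)"
  apply (rule soundI)
  apply simp
  apply (erule valid_3E)
  apply hypsubst
  apply (simp only: adj.simps; elim disjE; simp add: sem_rules vert_def; (simp add: sem_arith)?; (simp add: sem_field)?)
  done

lemma sound_mates: "sound n mateL mateR"
  unfolding mateL_def mateR_def
  apply (rule soundI)
  apply simp
  apply (erule valid_2E)
  apply hypsubst
  apply (simp only: adj.simps; elim disjE; simp add: sem_rules vert_def; (simp add: sem_arith)?; (simp add: sem_field)?)
  done

lemma sound_r1b: "sound n (qint 2 ^ 3 *\<^sub>d (idP \<otimes>\<^sub>d EE) \<circ>\<^sub>d (EE \<otimes>\<^sub>d idP) \<circ>\<^sub>d (idP \<otimes>\<^sub>d EE)) (qint 2 *\<^sub>d idP \<otimes>\<^sub>d EE)"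
  apply (rule soundI)
  apply simp
  apply (erule valid_3E)
  apply hypsubst
  apply (simp only: adj.simps; elim disjE; simp add: sem_rules vert_def; (simp add: sem_arith)?; (simp add: sem_field)?)
  done

lemma vertE:
  fixes n k :: int
  assumes "0 \<le> k" "2 * k \<le> n"
  obtains m where "n = m + 2 * k - 1" "1 \<le> m"
  using assms that[of "n - 2 * k + 1"] by simp

text \<open>The recursion [m + 1] + [m - 1] = [2] [m] in the two shapes that arise when the vertices
  inside a circle are summed over.\<close>

lemma qint_sum':
  assumes "1 \<le> m"
  shows "qint (m - 1) * x / (qint 2 * qint m) + qint (m + 1) * x / (qint m * qint 2) = x"
    "qint (m + 1) * x / qint m + qint (m - 1) * x / qint m = qint 2 * x"
proof -
  have "(qint (m + 1) + qint (m - 1)) * x = (qint 2 * qint m) * x" by (simp only: qint_rec)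
  moreover have "qint m \<noteq> 0" "qint 2 \<noteq> 0" using assms by (simp_all add: qint_nonzero)
  ultimately show "qint (m - 1) * x / (qint 2 * qint m) + qint (m + 1) * x / (qint m * qint 2) = x"
    "qint (m + 1) * x / qint m + qint (m - 1) * x / qint m = qint 2 * x"
    by (simp_all add: field_simps)
qed

lemma sem_Eps_Eta:
  assumes "0 \<le> j" "2 * j \<le> n"
  shows "sem (Eps \<circ>\<^sub>d Eta) n \<phi> (j # R) = qint 2 * \<phi> (j # R)"
proof -
  from assms obtain m where m: "n = m + 2 * j - 1" "1 \<le> m" by (rule vertE)
  show ?thesis
  \<comment> \<open>For m = 1 the vertex j + 1 is missing at level n + 1; its weight would be [0] =
    0.\<close>
  proof (cases "m = 1")
    case True
    then show ?thesis using m assms by (simp add: sem_rules vert_def) (simp add: sem_arith)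
  next
    case False
    then show ?thesis using m assms qint_sum'(2)[OF m(2), of "\<phi> (j # R)"]
      by (simp add: sem_rules vert_def) (simp add: sem_arith)
  qed
qed

text \<open>\<open>EE\<close> forces the vertex inside the loop to be a - 1, which is a vertex
  unless a = 0. The dimensions in the weights of \<open>EE\<close> and \<open>Eta'\<close> cancel
  and leave 1/[2].\<close>

lemma sem_loop:
  assumes "0 \<le> b" "2 * b \<le> n" "a = b \<or> a = b + 1" "2 * a \<le> n + 1"
  shows "sem (qint 2 *\<^sub>d ((idP \<otimes>\<^sub>d Eps') \<circ>\<^sub>d (EE \<otimes>\<^sub>d idM) \<circ>\<^sub>d (idP \<otimes>\<^sub>d Eta'))) n \<phi> (a # b # R)
    = (if a = 0 then 0 else \<phi> (a # b # R))"
  apply (rule vertE[OF assms(1,2)])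
  subgoal premises p for m
    using assms(3) p assms(1,4)
    apply (elim disjE; simp add: sem_rules vert_def; (simp add: sem_arith)?; (simp add: sem_field)?)
    done
  done

lemma sem_PP:
  assumes "0 \<le> b" "2 * b \<le> n" "a = b \<or> a = b + 1" "2 * a \<le> n + 1"
  shows "sem PP n \<phi> (a # b # R) = (if a = 0 then \<phi> (a # b # R) else 0)"
  using sem_loop[OF assms, of \<phi> R] unfolding PP_def by (simp del: sem.simps(12) add: sem.simps(12)[of "-1"])

lemma sem_EE_tens: "sem (EE \<otimes>\<^sub>d f) n \<phi> (a # b # L) = sem EE (n + wt (dm f)) (\<lambda>M. sem f n (\<lambda>M'. \<phi> (take 2 M @ M')) (drop 2 M)) (a # b # L)"
  by (simp add: sem.simps(9) numeral_2_eq_2)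

text \<open>\<open>PP\<close> keeps only the vertex 0 in the region enclosed by the outer circle,
  and the weights of the two nested circles cancel.\<close>

lemma sem_cnat_0:
  assumes "0 \<le> j" "2 * j \<le> n"
  shows "sem (cnat 0) n \<phi> (j # R) = (if j = 0 then \<phi> (j # R) else 0)"
proof -
  from assms obtain m where m: "n = m + 2 * j - 1" "1 \<le> m" by (rule vertE)
  show ?thesis
    using m assms by (simp add: sem_rules vert_def sem_PP) (simp add: sem_arith)?
qed

lemma sem_E_cnat:
  assumes IH: "\<And>j n \<phi> R. 0 \<le> j \<Longrightarrow> 2 * j \<le> n \<Longrightarrow> sem (cnat k) n \<phi> (j # R) = (if j = int k then \<phi> (j # R) else 0)"
    and d: "0 \<le> d" "2 * d \<le> n - 2"
  shows "sem (EE \<otimes>\<^sub>d cnat k \<otimes>\<^sub>d idM \<otimes>\<^sub>d idM) n \<psi> (a # b # d # c # R) =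
    (if a = d + 1 \<and> d = int k then qd (n - 1) b / (qint 2 * qd (n - 2) d) *
       (\<psi> (a # d # d # c # R) + (if vert (n - 1) (d + 1) then \<psi> (a # (d + 1) # d # c # R) else 0)) else 0)"
  using d by (simp add: sem_EE_tens sem_rules cnat_typed IH vert_def)

text \<open>The innermost region has the vertex d = k by the induction hypothesis, and
  \<open>EE\<close> forces the outer vertex to be d + 1. The two choices b of the vertex in between
  contribute \<open>qd (n - 1) b / (qint 2 * qd n j)\<close>, which add up to 1 by
  \<open>qint_sum'\<close>; if one of them is not a vertex, it would contribute [0].\<close>

lemma sem_cnat_Suc:
  assumes IH: "\<And>j n \<phi> R. 0 \<le> j \<Longrightarrow> 2 * j \<le> n \<Longrightarrow> sem (cnat k) n \<phi> (j # R) = (if j = int k then \<phi> (j # R) else 0)"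
    and j: "0 \<le> j" "2 * j \<le> n"
  shows "sem (cnat (Suc k)) n \<phi> (j # R) = (if j = int (Suc k) then \<phi> (j # R) else 0)"
proof -
  from j obtain m where m: "n = m + 2 * j - 1" "1 \<le> m" by (rule vertE)
  define \<psi> where "\<psi> = sem ((idP \<otimes>\<^sub>d Eta' \<otimes>\<^sub>d idM) \<circ>\<^sub>d Eta') n \<phi>"
  have \<psi>: "\<psi> (a # b # d # c # j # R)
      = (if a = j \<and> b = c then qd (n - 2) d / qd (n - 1) c * (qd (n - 1) c / qd n j) * \<phi> (j # R) else 0)"
    for a b c d by (simp add: \<psi>_def sem_rules)
  define \<chi> where "\<chi> = sem (EE \<otimes>\<^sub>d cnat k \<otimes>\<^sub>d idM \<otimes>\<^sub>d idM) n \<psi>"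
  have \<chi>: "\<chi> (j # b # d # b # j # R) =
      (if j = d + 1 \<and> d = int k then qd (n - 1) b / (qint 2 * qd n j) * \<phi> (j # R) else 0)"
    if "0 \<le> d" "2 * d \<le> n - 2" "2 * b \<le> n - 1" "b = d \<or> b = d + 1" for b d
  proof -
    have E: "\<chi> (j # b # d # b # j # R) =
      (if j = d + 1 \<and> d = int k then qd (n - 1) b / (qint 2 * qd (n - 2) d) *
       (\<psi> (j # d # d # b # j # R) + (if vert (n - 1) (d + 1) then \<psi> (j # (d + 1) # d # b # j # R) else 0)) else 0)"
      unfolding \<chi>_def by (rule sem_E_cnat) (use that in \<open>simp_all add: IH\<close>)
    show ?thesis
  proof (cases "j = d + 1")
    case True
    have "qd (n - 2) d = qd n j" "qd (n - 2) d \<noteq> 0" "qd (n - 1) b \<noteq> 0"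
      using that True j by (auto simp: qd_def qint_nonzero)
    then show ?thesis using that unfolding E \<psi> by (auto simp: vert_def)
  next
    case False
    then show ?thesis unfolding E by simp
  qed
  qed
  have "sem (cnat (Suc k)) n \<phi> (j # R)
      = sem (Eps' \<circ>\<^sub>d (idP \<otimes>\<^sub>d Eps' \<otimes>\<^sub>d idM)) n \<chi> (j # R)"
    by (simp add: \<chi>_def \<psi>_def sem_comp)
  also have "\<dots> = (if vert (n - 1) j then (if vert (n - 2) j then \<chi> (j # j # j # j # j # R) else 0)
        + (if vert (n - 2) (j - 1) then \<chi> (j # j # (j - 1) # j # j # R) else 0) else 0)
      + (if vert (n - 1) (j - 1) then (if vert (n - 2) (j - 1) then \<chi> (j # (j - 1) # (j - 1) # (j - 1) # j # R) else 0)
        + (if vert (n - 2) (j - 2) then \<chi> (j # (j - 1) # (j - 2) # (j - 1) # j # R) else 0) else 0)"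
    by (simp add: sem_rules)
  also have "\<dots> = (if j = int k + 1 then (if vert (n - 1) j then qd (n - 1) j / (qint 2 * qd n j) * \<phi> (j # R) else 0)
      + qd (n - 1) (j - 1) / (qint 2 * qd n j) * \<phi> (j # R) else 0)"
  proof -
    have c: "vert (n - 2) j \<Longrightarrow> \<chi> (j # j # j # j # j # R) = 0"
      "vert (n - 2) (j - 2) \<Longrightarrow> \<chi> (j # (j - 1) # (j - 2) # (j - 1) # j # R) = 0"
      "vert (n - 1) j \<Longrightarrow> vert (n - 2) (j - 1) \<Longrightarrow> \<chi> (j # j # (j - 1) # j # j # R) =
        (if j = int k + 1 then qd (n - 1) j / (qint 2 * qd n j) * \<phi> (j # R) else 0)"
      "vert (n - 2) (j - 1) \<Longrightarrow> \<chi> (j # (j - 1) # (j - 1) # (j - 1) # j # R) =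
        (if j = int k + 1 then qd (n - 1) (j - 1) / (qint 2 * qd n j) * \<phi> (j # R) else 0)"
      using \<chi>[of j j] \<chi>[of "j - 2" "j - 1"] \<chi>[of "j - 1" j] \<chi>[of "j - 1" "j - 1"] j by (auto simp: vert_def)
    show ?thesis
    proof (cases "j = int k + 1")
      case True
      then have "vert (n - 1) (j - 1)" "vert (n - 2) (j - 1)" using j by (auto simp: vert_def)
      then show ?thesis by (simp add: c True[symmetric])
    next
      case False
      then show ?thesis by (simp add: c)
    qed
  qed
  also have "\<dots> = (if j = int k + 1 then \<phi> (j # R) else 0)"
  proof -
    have "(if vert (n - 1) j then qd (n - 1) j / (qint 2 * qd n j) * \<phi> (j # R) else 0)
        + qd (n - 1) (j - 1) / (qint 2 * qd n j) * \<phi> (j # R) = \<phi> (j # R)"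
    proof (cases "m = 1")
      case True
      then show ?thesis using m j by (auto simp: vert_def qd_def qint_nonzero)
    next
      case False
      have "qd (n - 1) j = qint (m - 1)" "qd (n - 1) (j - 1) = qint (m + 1)" "qd n j = qint m" "vert (n - 1) j"
        using m j False by (simp_all add: qd_def vert_def)
      then show ?thesis using qint_sum'(1)[OF m(2), of "\<phi> (j # R)"] by (simp add: mult.commute[of "qint 2"])
    qed
    then show ?thesis by (simp only:)
  qed
  finally show ?thesis by (simp add: add.commute)
qed

lemma sem_cc:
  assumes "0 \<le> j" "2 * j \<le> n"
  shows "sem (cc k) n \<phi> (j # R) = (if j = k then \<phi> (j # R) else 0)"
proof -
  have "sem (cnat i) n \<phi> (j # R) = (if j = int i then \<phi> (j # R) else 0)"
    if "0 \<le> j" "2 * j \<le> n" for i j n \<phi> R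
    using that
  proof (induction i arbitrary: j n \<phi> R)
    case 0
    then show ?case by (simp only: sem_cnat_0 of_nat_0)
  next
    case (Suc i)
    show ?case by (rule sem_cnat_Suc[OF Suc.IH Suc.prems])
  qed
  from this[OF assms, of "nat k"] show ?thesis using assms by (auto simp: cc_def)
qed

lemma sem_bdag:
  assumes "0 \<le> j" "2 * j \<le> n"
  shows "sem (bdag i) n \<phi> (j # R) = bdval (n + i) * \<phi> (j # R)"
  using sem_Eps_Eta[OF assms, of \<phi> R]
  by (simp add: bdag_def bdval_def left_diff_distrib add_diff_eq)

lemma sem_cc_tens: "dm z = [] \<Longrightarrow> sem (z \<otimes>\<^sub>d f) n \<phi> L = sem z (n + wt (dm f)) (sem f n \<phi>) L"
  by (simp add: sem.simps(9))

lemmas cc_rules = sem_rules sem_cc sem_bdag sem_cc_tens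

lemma sound_r3b: "sound n (qint 2 *\<^sub>d (idP \<otimes>\<^sub>d Eps') \<circ>\<^sub>d (EE \<otimes>\<^sub>d idM) \<circ>\<^sub>d (idP \<otimes>\<^sub>d Eta')) ((id0 -\<^sub>d cc 0) \<otimes>\<^sub>d idP)"
  apply (rule soundI)
  apply (simp del: sem.simps(8,12))
  apply (erule valid_1E)
  apply hypsubst
  apply (subst sem_loop)
  apply (simp_all add: vert_def)
  apply (auto simp: cc_rules)
  done

lemma sound_r4a: "sound n (Eps \<circ>\<^sub>d Eta) (qint 2 *\<^sub>d id0)"
  by (rule soundI) (auto simp: valid_iff vert_def sem_Eps_Eta simp del: sem.simps(8))

lemma valid_0E:
  assumes "valid n [] L"
  obtains k0 R m where "L = k0 # R" "n = m + 2 * k0 - 1" "1 \<le> m" "0 \<le> k0"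
proof -
  from assms obtain k0 R where "L = k0 # R" "vert n k0" by (auto simp: valid_iff)
  then show thesis using that[of k0 R "n - 2 * k0 + 1"] by (auto simp: vert_def)
qed

lemma sound_r4b:
  "0 \<le> k \<Longrightarrow> sound n (Eps \<circ>\<^sub>d (idM \<otimes>\<^sub>d cc k \<otimes>\<^sub>d idP) \<circ>\<^sub>d Eta) (Bk (- 2 * k + 1) \<circ>\<^sub>d cc (k - 1) +\<^sub>d bdag (- 2 * k) \<circ>\<^sub>d cc k)"
  apply (rule soundI)
  apply simp
  apply (erule valid_0E)
  apply hypsubst
  apply (simp add: cc_rules vert_def)
  apply (simp add: sem_arith bval_def bdval_eq add.commute[of _ 1])
  done

lemma sound_r5a: "sound n (Eps' \<circ>\<^sub>d Eta') (qint 2 *\<^sub>d id0 -\<^sub>d cc 0 \<circ>\<^sub>d bdag 0)"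
proof (rule soundI)
  fix \<phi> L assume "valid n (cd (Eps' \<circ>\<^sub>d Eta')) L"
  then have "valid n [] L" by simp
  then obtain k0 R m where L: "L = k0 # R" "n = m + 2 * k0 - 1" "1 \<le> m" "0 \<le> k0" by (rule valid_0E)
  note q = qint_sum'(2)[OF L(3), of "\<phi> (k0 # R)"]
  show "sem (Eps' \<circ>\<^sub>d Eta') n \<phi> L = sem (qint 2 *\<^sub>d id0 -\<^sub>d cc 0 \<circ>\<^sub>d bdag 0) n \<phi> L"
  proof (cases "m = 1")
    case True
    then show ?thesis using L q by (simp add: cc_rules vert_def) (simp add: sem_arith bdval_eq)
  next
    case False
    show ?thesis
    proof (cases "k0 = 0")
      case True
      then show ?thesis using False L q
        by (simp add: cc_rules vert_def) (simp add: sem_arith bdval_eq eq_diff_eq add.commute)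
    next
      case k0: False
      then show ?thesis using False L q
        by (simp add: cc_rules vert_def) (simp add: sem_arith bdval_eq eq_diff_eq add.commute)
    qed
  qed
qed

lemma sound_r5b: "0 \<le> k \<Longrightarrow> sound n (Eps' \<circ>\<^sub>d (idP \<otimes>\<^sub>d cc k \<otimes>\<^sub>d idM) \<circ>\<^sub>d Eta')
          (Bk (- 2 * k - 1) \<circ>\<^sub>d cc k +\<^sub>d bdag (- 2 * k - 2) \<circ>\<^sub>d cc (k + 1))"
  apply (rule soundI)
  apply simp
  apply (erule valid_0E)
  apply hypsubst
  apply (case_tac "k0 = k + 1"; simp add: cc_rules vert_def; (simp add: sem_arith bval_def bdval_eq add.commute[of _ 1])?)
  done

lemma sound_r6a: "0 \<le> k \<Longrightarrow> sound n (cc k \<otimes>\<^sub>d idP) (cc k \<otimes>\<^sub>d idP \<otimes>\<^sub>d (cc k +\<^sub>d cc (k - 1)))"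
  apply (rule soundI)
  apply simp
  apply (erule valid_1E)
  apply hypsubst
  apply (simp only: adj.simps; elim disjE; simp add: cc_rules vert_def)
  done

lemma sound_r6b: "0 \<le> k \<Longrightarrow> sound n (idP \<otimes>\<^sub>d cc k) ((cc k +\<^sub>d cc (k + 1)) \<otimes>\<^sub>d idP \<otimes>\<^sub>d cc k)"
  apply (rule soundI)
  apply simp
  apply (erule valid_1E)
  apply hypsubst
  apply (simp only: adj.simps; elim disjE; simp add: cc_rules vert_def)
  done

text \<open>Rotation transposes \<open>EE\<close>: the weight is that of the vertex summed over,
  where in \<open>EE\<close> it is that of the vertex k1 in the row.\<close>

lemma sem_mateL:
  assumes "valid n [Dn, Dn] (k2 # k1 # k0 # R)"
  shows "sem mateL n \<phi> (k2 # k1 # k0 # R) = (if k2 = k0 - 1 then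
    (if vert (n - 1) k0 then qd (n - 1) k0 / (qint 2 * qd (n - 2) k2) * \<phi> (k2 # k0 # k0 # R) else 0)
    + (if vert (n - 1) (k0 - 1) then qd (n - 1) (k0 - 1) / (qint 2 * qd (n - 2) k2) * \<phi> (k2 # (k0 - 1) # k0 # R) else 0)
    else 0)"
  using assms unfolding mateL_def
  apply -
  apply (erule valid_2E)
  apply (simp only: list.inject)
  apply (elim conjE)
  apply hypsubst
  apply (simp only: adj.simps; elim disjE; simp add: sem_rules vert_def)
  done

lemma valid_4E:
  assumes "valid n [s4, s3, s2, s1] L"
  obtains k4 k3 k2 k1 k0 R where "L = k4 # k3 # k2 # k1 # k0 # R" "vert n k0"
    "adj s4 k4 k3" "adj s3 k3 k2" "adj s2 k2 k1" "adj s1 k1 k0" "vert (n + sgn_val s1) k1"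
    "vert (n + (sgn_val s2 + sgn_val s1)) k2"
    "vert (n + (sgn_val s3 + (sgn_val s2 + sgn_val s1))) k3"
    "vert (n + (sgn_val s4 + (sgn_val s3 + (sgn_val s2 + sgn_val s1)))) k4"
  using assms by (auto simp: valid_iff)

text \<open>On paths with k2 = k0 + 1 and k4 = k0 both sides are the weight \<open>u k1\<close>
  times the same functional, the sum of \<open>u c * F c\<close> over the vertices c. On the left it
  comes from the lower half, on the right from the mate; otherwise both sides vanish.\<close>

lemma sound_r7a: "sound n (((idM \<otimes>\<^sub>d idM \<otimes>\<^sub>d EE) \<circ>\<^sub>d (idM \<otimes>\<^sub>d Eta \<otimes>\<^sub>d idP) \<circ>\<^sub>d Eta)
                  \<circ>\<^sub>d (Eps \<circ>\<^sub>d (idM \<otimes>\<^sub>d Eps \<otimes>\<^sub>d idP) \<circ>\<^sub>d (idM \<otimes>\<^sub>d idM \<otimes>\<^sub>d EE)))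
                 (mateL \<otimes>\<^sub>d EE)" (is "sound n (?T \<circ>\<^sub>d ?B) _")
proof (rule soundI)
  fix \<phi> :: "int list \<Rightarrow> Cq" and L assume "valid n (cd (?T \<circ>\<^sub>d ?B)) L"
  then have v: "valid n [Dn, Dn, Up, Up] L" by simp
  then obtain k4 k3 k2 k1 k0 R where L: "L = k4 # k3 # k2 # k1 # k0 # R" "vert n k0"
    "adj Dn k4 k3" "adj Dn k3 k2" "adj Up k2 k1" "adj Up k1 k0" "vert (n + sgn_val Up) k1"
    "vert (n + (sgn_val Up + sgn_val Up)) k2" "vert (n + (sgn_val Dn + (sgn_val Up + sgn_val Up))) k3"
    "vert (n + (sgn_val Dn + (sgn_val Dn + (sgn_val Up + sgn_val Up)))) k4"
    by (rule valid_4E)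
  define F where "F c = (if vert (n + 1) k0 then \<phi> (k0 # c # (k0 + 1) # k0 # k0 # R) else 0)
      + (if vert (n + 1) (k0 + 1) then \<phi> (k0 # c # (k0 + 1) # (k0 + 1) # k0 # R) else 0)" for c
  define u where "u c = qd (n + 1) c / (qint 2 * qd n k0)" for c
  have v0: "vert (n + 1) k0" "vert (n + 2) (k0 + 1)" using L(2) by (simp_all add: vert_def)
  have nz: "qd n k0 \<noteq> 0" using L(2) by (rule qd_nonzero)
  have q: "qd (n + 2) (k0 + 1) = qd n k0" "qd (2 + n) (k0 + 1) = qd n k0" by (simp_all add: qd_def)
  have T: "sem ?T n \<psi> L = (if k2 = k0 + 1 \<and> k4 = k0 then u k1 * \<psi> (k0 # R) else 0)" for \<psi>
    unfolding L(1) using L(2-) by (simp only: adj.simps; elim disjE; simp add: sem_rules u_def vert_def)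
  have B: "sem ?B n \<phi> (k0 # R) = u k0 * F k0 + (if vert (n + 1) (k0 + 1) then u (k0 + 1) * F (k0 + 1) else 0)"
    using v0 nz qd_nonzero[of "n + 1" k0] qd_nonzero[of "n + 1" "k0 + 1"]
    by (simp add: sem_rules F_def u_def q vert_def)
  have M: "valid (n + 2) [Dn, Dn] (k4 # k3 # k2 # k1 # k0 # R)"
    using L by (simp add: valid.simps vert_def)
  have "sem (mateL \<otimes>\<^sub>d EE) n \<phi> L = sem mateL (n + 2) (\<lambda>M. sem EE n (\<lambda>M'. \<phi> (take 2 M @ M')) (drop 2 M)) L"
    by (simp add: sem.simps(9) numeral_2_eq_2)
  also have "\<dots> = (if k2 = k0 + 1 \<and> k4 = k0 then u k1 * (u k0 * F k0 + (if vert (n + 1) (k0 + 1) then u (k0 + 1) * F (k0 + 1) else 0)) else 0)"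
  proof -
    have take2: "take 2 (a # b # M) = [a, b]" "drop 2 (a # b # M) = M" for a b :: int and M
      by (simp_all add: numeral_2_eq_2)
    have E0: "k2 \<noteq> k0 + 1 \<Longrightarrow> sem EE n \<psi> (k2 # k1 # k0 # R) = 0" for \<psi> by (simp add: sem_rules)
    have E: "sem EE n (\<lambda>M'. \<phi> (k0 # c # M')) ((k0 + 1) # k1 # k0 # R) = u k1 * F c" for c
      by (simp add: sem_rules u_def F_def)
    show ?thesis
    proof (cases "k2 = k0 + 1")
      case False
      then show ?thesis unfolding L(1) sem_mateL[OF M] take2 by (simp add: E0)
    next
      case True
      then show ?thesis unfolding L(1) sem_mateL[OF M] take2 using v0
        by (simp add: E u_def) (simp add: algebra_simps add_divide_distrib)
    qed
  qed
  finally show "sem (?T \<circ>\<^sub>d ?B) n \<phi> L = sem (mateL \<otimes>\<^sub>d EE) n \<phi> L"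
    by (simp only: sem_comp[of ?T ?B] T B)
qed

lemma sound_r7b: "sound n (cc 0 \<otimes>\<^sub>d EE) (Zero [Up, Up] [Up, Up])"
  apply (rule soundI)
  apply simp
  apply (erule valid_2E)
  apply hypsubst
  apply (simp only: adj.simps; elim disjE; simp add: cc_rules vert_def)
  done

lemma sound_r8a: "0 \<le> k \<Longrightarrow> 0 \<le> j \<Longrightarrow> sound n (cc k \<circ>\<^sub>d cc j) (if k = j then cc k else zero0)"
  by (rule soundI) (auto elim!: valid_0E simp: cc_rules)

lemma sound_r8b: "sound n (Bk k \<otimes>\<^sub>d idP) (idP \<otimes>\<^sub>d Bk (k + 1))"
  by (rule soundI) (auto elim!: valid_1E simp: cc_rules sem_cc_tens algebra_simps)

lemma sound_r9: "0 \<le> k \<Longrightarrow> sound n (bdag k \<circ>\<^sub>d Bk k) id0"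
  using bval_bdval
  by (intro soundI) (auto elim!: valid_0E simp: cc_rules algebra_simps)

lemma sound_r10a: "0 \<le> k \<Longrightarrow> sound n (cc k \<otimes>\<^sub>d idM \<otimes>\<^sub>d cc k \<otimes>\<^sub>d idP \<otimes>\<^sub>d cc k)
          ((idM \<otimes>\<^sub>d cc k \<otimes>\<^sub>d idP) \<circ>\<^sub>d Eta \<circ>\<^sub>d (cc k \<circ>\<^sub>d Bk (- 2 * k)) \<circ>\<^sub>d Eps \<circ>\<^sub>d (idM \<otimes>\<^sub>d cc k \<otimes>\<^sub>d idP))"
  apply (rule soundI)
  apply simp
  apply (erule valid_2E)
  apply hypsubst
  apply (simp only: adj.simps; elim disjE; simp add: cc_rules vert_def; (simp add: sem_arith bval_def bdval_eq add.commute[of _ 1])?)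
  done

lemma sound_r10b: "0 \<le> k \<Longrightarrow> sound n (cc (k - 1) \<otimes>\<^sub>d idM \<otimes>\<^sub>d cc k \<otimes>\<^sub>d idP \<otimes>\<^sub>d cc (k - 1))
          ((idM \<otimes>\<^sub>d cc k \<otimes>\<^sub>d idP) \<circ>\<^sub>d Eta \<circ>\<^sub>d (cc (k - 1) \<circ>\<^sub>d bdag (- 2 * k + 1)) \<circ>\<^sub>d Eps
            \<circ>\<^sub>d (idM \<otimes>\<^sub>d cc k \<otimes>\<^sub>d idP))"
  apply (rule soundI)
  apply simp
  apply (erule valid_2E)
  apply hypsubst
  apply (simp only: adj.simps; elim disjE; case_tac "k = k0 + 1"; simp add: cc_rules vert_def; (simp add: sem_arith bval_def bdval_eq)?)
  done

lemma sem_UpUp_cc: "dm g = [Up, Up] \<Longrightarrow> sem (g \<otimes>\<^sub>d cc k) n \<phi> L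
    = sem g n (\<lambda>M. sem (cc k) n (\<lambda>M'. \<phi> (take 2 M @ M')) (drop 2 M)) L"
  by (simp add: sem.simps(9) numeral_2_eq_2)

lemma sound_r11: "0 \<le> k \<Longrightarrow> sound n (qint 2 *\<^sub>d EE \<circ>\<^sub>d (idP \<otimes>\<^sub>d cc k \<otimes>\<^sub>d idP))
          (qint 2 *\<^sub>d ((idP \<otimes>\<^sub>d cc (k + 1) \<otimes>\<^sub>d idP) \<circ>\<^sub>d EE) \<otimes>\<^sub>d cc k
           +\<^sub>d qint 2 *\<^sub>d cc k \<otimes>\<^sub>d ((idP \<otimes>\<^sub>d cc (k - 1) \<otimes>\<^sub>d idP) \<circ>\<^sub>d EE)
           +\<^sub>d cc (k + 1) \<otimes>\<^sub>d idP \<otimes>\<^sub>d cc k \<otimes>\<^sub>d idP \<otimes>\<^sub>d cc k \<otimes>\<^sub>d bdag (- 2 * k)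
           +\<^sub>d cc k \<otimes>\<^sub>d idP \<otimes>\<^sub>d cc k \<otimes>\<^sub>d idP \<otimes>\<^sub>d cc (k - 1) \<otimes>\<^sub>d Bk (- 2 * k + 1)
           -\<^sub>d cc (k + 1) \<otimes>\<^sub>d idP \<otimes>\<^sub>d cc (k + 1) \<otimes>\<^sub>d idP \<otimes>\<^sub>d cc k \<otimes>\<^sub>d Bk (- 2 * k - 1)
           -\<^sub>d cc k \<otimes>\<^sub>d idP \<otimes>\<^sub>d cc (k - 1) \<otimes>\<^sub>d idP \<otimes>\<^sub>d cc (k - 1) \<otimes>\<^sub>d bdag (- 2 * k + 2))"
proof (rule soundI)
  fix \<phi> L assume k: "0 \<le> k" and "valid n (cd (qint 2 *\<^sub>d EE \<circ>\<^sub>d (idP \<otimes>\<^sub>d cc k \<otimes>\<^sub>d idP))) L"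
  then have "valid n [Up, Up] L" by simp
  then show "sem (qint 2 *\<^sub>d EE \<circ>\<^sub>d (idP \<otimes>\<^sub>d cc k \<otimes>\<^sub>d idP)) n \<phi> L = sem
          (qint 2 *\<^sub>d ((idP \<otimes>\<^sub>d cc (k + 1) \<otimes>\<^sub>d idP) \<circ>\<^sub>d EE) \<otimes>\<^sub>d cc k
           +\<^sub>d qint 2 *\<^sub>d cc k \<otimes>\<^sub>d ((idP \<otimes>\<^sub>d cc (k - 1) \<otimes>\<^sub>d idP) \<circ>\<^sub>d EE)
           +\<^sub>d cc (k + 1) \<otimes>\<^sub>d idP \<otimes>\<^sub>d cc k \<otimes>\<^sub>d idP \<otimes>\<^sub>d cc k \<otimes>\<^sub>d bdag (- 2 * k)
           +\<^sub>d cc k \<otimes>\<^sub>d idP \<otimes>\<^sub>d cc k \<otimes>\<^sub>d idP \<otimes>\<^sub>d cc (k - 1) \<otimes>\<^sub>d Bk (- 2 * k + 1)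
           -\<^sub>d cc (k + 1) \<otimes>\<^sub>d idP \<otimes>\<^sub>d cc (k + 1) \<otimes>\<^sub>d idP \<otimes>\<^sub>d cc k \<otimes>\<^sub>d Bk (- 2 * k - 1)
           -\<^sub>d cc k \<otimes>\<^sub>d idP \<otimes>\<^sub>d cc (k - 1) \<otimes>\<^sub>d idP \<otimes>\<^sub>d cc (k - 1) \<otimes>\<^sub>d bdag (- 2 * k + 2)) n \<phi> L"
    using k
    apply -
    apply (erule valid_2E)
    apply hypsubst
    subgoal for k2 k1 k0 R m
      \<comment> \<open>The bubble of the left-hand side sits at k1, which is k0 or k0 + 1. For
        every other k all terms vanish.\<close>
      apply (cases "k = k0")
       apply (simp only: adj.simps; elim disjE; simp add: cc_rules sem_UpUp_cc vert_def; (simp add: sem_arith bval_def bdval_eq add.commute[of _ 1])?; (simp add: distrib_left add_divide_distrib)?)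
      apply (cases "k = k0 + 1")
       apply (simp only: adj.simps; elim disjE; simp add: cc_rules sem_UpUp_cc vert_def; (simp add: sem_arith bval_def bdval_eq add.commute[of _ 1])?; (simp add: distrib_left add_divide_distrib)?)
      apply (simp only: adj.simps; elim disjE; simp add: cc_rules sem_UpUp_cc vert_def; (simp add: sem_arith bval_def bdval_eq add.commute[of _ 1])?; (simp add: distrib_left add_divide_distrib)?)
      done
    done
qed

lemma valid_prefix: "valid n (U @ V) L \<Longrightarrow> valid (n + wt V) U L"
proof (induction U arbitrary: L)
  case Nil
  then show ?case by (cases V; cases L) (auto simp: valid.simps)
next
  case (Cons s U)
  then show ?case by (auto simp: valid_Cons_iff add_ac)
qed

lemma weyl_rel_sound: "weyl_rel f g \<Longrightarrow> sound n f g"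
proof (induction rule: weyl_rel.induct)
  case (r5b k)
  then show ?case by (rule sound_r5b)
next
  case (r11 k)
  then show ?case by (rule sound_r11)
qed (rule sound_zigzag sound_mates sound_r1a sound_r1b sound_r2a sound_r2b sound_r3a sound_r3b
   sound_r4a sound_r4b sound_r5a sound_r6a sound_r6b sound_r7a sound_r7b sound_r8a sound_r8b
   sound_r9 sound_r10a sound_r10b; assumption?)+

lemma sem_bubble_sum:
  "0 \<le> j \<Longrightarrow> 2 * j \<le> n \<Longrightarrow> distinct ks \<Longrightarrow>
   sem (foldr Add (map cc ks) zero0) n \<phi> (j # R) = (if j \<in> set ks then \<phi> (j # R) else 0)"
  by (induction ks) (auto simp: sem_cc)

text \<open>At a negative label there is no vertex and hence no valid path, so the rule
  \<open>negative\<close> holds vacuously; this is why \<open>sound\<close> compares values on valid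
  paths only.\<close>

theorem weyl_eq_sound: "weyl_eq n f g \<Longrightarrow> sound n f g"
proof (induction rule: weyl_eq.induct)
  case (sym n f g)
  then show ?case using weyl_eq_typed[OF sym(1)] by (simp add: sound_def)
next
  case (trans n f g h)
  then show ?case using weyl_eq_typed[OF trans(1)] by (simp add: sound_def)
next
  case (cong_comp n g g' f f')
  note t = weyl_eq_typed[OF cong_comp(1)] weyl_eq_typed[OF cong_comp(2)]
  show ?case
  proof (rule soundI)
    fix \<phi> L assume "valid n (cd (g \<circ>\<^sub>d f)) L"
    then have v: "valid n (cd g) L" by simp
    have "sem g n (sem f n \<phi>) L = sem g' n (sem f n \<phi>) L"
      using cong_comp v by (simp add: sound_def)
    also have "\<dots> = sem g' n (sem f' n \<phi>) L"
    proof (rule sem_cong)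
      fix M assume "valid n (dm g') M"
      then show "sem f n \<phi> M = sem f' n \<phi> M" using cong_comp t by (simp add: sound_def)
    qed (use t v in simp_all)
    finally show "sem (g \<circ>\<^sub>d f) n \<phi> L = sem (g' \<circ>\<^sub>d f') n \<phi> L" by simp
  qed
next
  case (cong_tens n f g g' f')
  then show ?case by (intro sound_tens)
next
  case (cong_add n f f' g g')
  then show ?case by (simp add: sound_def)
next
  case (tens_assoc h g f n)
  then show ?case by (rule sound_tens_assoc)
next
  case (tens_unit_left f n)
  show ?case by (simp add: sound_def sem.simps(9))
next
  case (tens_unit_right f n)
  show ?case by (simp add: sound_def sem.simps(9))
next
  case (tens_id n U V)
  show ?case by (simp add: sound_def sem.simps(9))
next
  case (interchange g' g f' f n)
  then show ?case by (rule sound_interchange)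
next
  case (comp_add_right g f f' n)
  then show ?case
    using sem_linear(1)[of g n] by (auto simp: sound_def sem_add_ext)
next
  case (comp_scal_right g f n a)
  then show ?case using sem_linear(2)[of g n] by (auto simp: sound_def sem_scal_ext)
next
  case (tens_add_left g g' f n)
  then show ?case by (simp add: sound_def sem.simps(9))
next
  case (tens_scal_left g f n a)
  then show ?case by (simp add: sound_def sem.simps(9))
next
  case (tens_add_right g f f' n)
  then show ?case
    using sem_linear(1)[of g "n + wt (dm f')"] valid_prefix[of n "cd g" "cd f'"] weight_cd[of f']
    by (auto simp: sound_def sem.simps(9))
next
  case (tens_scal_right g f n a)
  then show ?case
    using sem_linear(2)[of g "n + wt (dm f)"] valid_prefix[of n "cd g" "cd f"] weight_cd[of f]
    by (auto simp: sound_def sem.simps(9))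
next
  case (relation f g n)
  then show ?case by (rule weyl_rel_sound)
next
  case (negative n)
  then show ?case by (auto simp: sound_def valid_iff vert_def)
next
  case (bubble_zero n k)
  then show ?case by (auto simp: sound_def valid_iff vert_def sem_cc)
next
  case (bubble_sum n)
  then show ?case by (auto simp: sound_def valid_iff vert_def sem_bubble_sum simp del: foldr_map)
next
  case (b_pos n k)
  then show ?case by (simp add: sound_def bval_def)
next
  case (b_neg n k)
  then show ?case by (simp add: sound_def bval_def)
qed (simp_all add: sound_def sem_comp sem_Ident_ext algebra_simps)

theorem bubble_nonzero:
  assumes "0 \<le> k" "2 * k \<le> n"
  shows "\<not> weyl_eq n (cc k) zero0"
proof
  assume "weyl_eq n (cc k) zero0"
  from weyl_eq_sound[OF this] have "sem (cc k) n (\<lambda>_. 1) [k] = 0"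
    using assms by (simp add: sound_def valid_iff vert_def)
  then show False using assms by (simp add: sem_cc)
qed

section \<open>The endomorphism algebra in coordinates\<close>

text \<open>The axioms of a commutative algebra are equations, so they pass from functions with
  pointwise operations to any image of them. This serves both algebras, whose elements depend on the
  coordinates up to n div 2.\<close>

lemma coordinate_algebra:
  fixes S :: "(Cq, 'x) module" and E :: "(nat \<Rightarrow> Cq) \<Rightarrow> 'x"
  assumes carrier: "carrier S = range E"
    and mult: "\<And>a b. E a \<otimes>\<^bsub>S\<^esub> E b = E (\<lambda>k. a k * b k)"
    and add: "\<And>a b. E a \<oplus>\<^bsub>S\<^esub> E b = E (\<lambda>k. a k + b k)"
    and one: "\<one>\<^bsub>S\<^esub> = E (\<lambda>_. 1)" and zero: "\<zero>\<^bsub>S\<^esub> = E (\<lambda>_. 0)"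
    and smult: "\<And>c a. c \<odot>\<^bsub>S\<^esub> E a = E (\<lambda>k. c * a k)"
  shows "algebra Cq_ring S"
proof -
  have R: "cring Cq_ring" by (rule cring_from_type_algebra)
  have A: "abelian_group S"
  proof (rule abelian_groupI)
    fix x assume "x \<in> carrier S"
    then obtain a where "x = E a" using carrier by auto
    then show "\<exists>y\<in>carrier S. y \<oplus>\<^bsub>S\<^esub> x = \<zero>\<^bsub>S\<^esub>"
      by (intro bexI[of _ "E (\<lambda>k. - a k)"]) (simp_all add: carrier add zero)
  qed (auto simp: carrier add zero add_ac)
  have M: "comm_monoid S"
    by (rule comm_monoidI) (auto simp: carrier mult one mult_ac)
  have C: "cring S"
    by (rule cringI[OF A M]) (auto simp: carrier mult add distrib_right)
  interpret C: cring S by (rule C)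
  interpret R: cring Cq_ring by (rule R)
  show ?thesis
    by unfold_locales
      (auto simp: carrier mult add smult ring_of_type_algebra_def distrib_left distrib_right mult.assoc)
qed

text \<open>Endomorphisms of a single word as 1-by-1 matrices in the additive closure.\<close>

definition emb :: "diag set \<Rightarrow> diag set matrix_mor" where
  "emb S = mk_mat 1 1 (\<lambda>_ _. S)"

lemma emb_0 [simp]: "emb S 0 0 = S"
  by (simp add: emb_def mk_mat_def)

lemma mk_mat_eq_emb: "mk_mat (Suc 0) (Suc 0) M = emb (M 0 0)"
  by (rule ext)+ (simp add: emb_def mk_mat_def)

context
  fixes n :: nat
begin

abbreviation W where "W \<equiv> weyl_words (Reg n) (Reg n)"
abbreviation W' where "W' \<equiv> Weyl2' (Reg n) (Reg n)"

definition clo :: "diag \<Rightarrow> bool" where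
  "clo f \<longleftrightarrow> typed f \<and> dm f = [] \<and> cd f = []"

definition elt :: "diag \<Rightarrow> diag set matrix_mor" where
  "elt f = emb (weyl_cls (int n) f)"

lemma elt_eq_iff: "clo f \<Longrightarrow> clo g \<Longrightarrow> elt f = elt g \<longleftrightarrow> mk (int n) f = mk (int n) g"
  unfolding elt_def clo_def by (metis emb_0 mk_eq_iff weyl_cls_eq_iff)

lemma Hom_W': "Hom W' [[]] [[]] = elt ` Collect clo"
proof -
  let ?H = "Hom W [] [] :: diag set set"
  have "Hom W' [[]] [[]] = {emb (M 0 0) | M :: diag set matrix_mor. M 0 0 \<in> ?H}"
    by (simp add: Weyl2'_def additive_closure_def mk_mat_eq_emb)
  moreover have "\<exists>M :: diag set matrix_mor. emb x = emb (M 0 0) \<and> M 0 0 \<in> ?H" if "x \<in> ?H" for x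
    using that by (intro exI[of _ "\<lambda>_ _. x"]) simp
  ultimately have "Hom W' [[]] [[]] = emb ` ?H" by auto
  moreover have "?H = weyl_cls (int n) ` Collect clo" by (auto simp: clo_def)
  ultimately show ?thesis by (simp add: image_image elt_def)
qed

lemma Cmp_W': "clo g \<Longrightarrow> clo f \<Longrightarrow> Cmp W' [[]] [[]] [[]] (elt g) (elt f) = elt (g \<circ>\<^sub>d f)"
proof -
  assume *: "clo g" "clo f"
  \<comment> \<open>A product of 1-by-1 matrices is a sum over one index, that is, the composite
    plus the zero with which the fold starts.\<close>
  have "Cmp W' [[]] [[]] [[]] (elt g) (elt f)
      = emb (cls_add (int n) (cls_comp (int n) (weyl_cls (int n) g) (weyl_cls (int n) f)) (cls_zero (int n) [] []))"
    by (simp add: Weyl2'_def additive_closure_def mk_mat_eq_emb elt_def cls_add_def cls_comp_def cls_zero_def)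
  also have "\<dots> = elt (g \<circ>\<^sub>d f)"
  proof -
    have h: "weyl_cls (int n) (g \<circ>\<^sub>d f) \<in> cls_hom (int n) [] []"
      using * cls_in_hom[of "g \<circ>\<^sub>d f" "int n"] by (simp add: clo_def)
    show ?thesis
      using * cls_add_zero[OF h] cls_add_commute[OF h cls_zero_in_hom]
      by (simp add: clo_def cls_comp_cls elt_def)
  qed
  finally show ?thesis .
qed

lemma Pls_W': "clo g \<Longrightarrow> clo f \<Longrightarrow> Pls W' [[]] [[]] (elt g) (elt f) = elt (g +\<^sub>d f)"
  by (simp add: Weyl2'_def additive_closure_def mk_mat_eq_emb elt_def clo_def cls_add_cls flip: cls_add_def)

lemma Scl_W': "clo f \<Longrightarrow> Scl W' [[]] [[]] a (elt f) = elt (a *\<^sub>d f)"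
  by (simp add: Weyl2'_def additive_closure_def mk_mat_eq_emb elt_def clo_def cls_scal_cls flip: cls_scal_def)

lemma Zer_W': "Zer W' [[]] [[]] = elt zero0"
  by (simp add: Weyl2'_def additive_closure_def mk_mat_eq_emb elt_def)

lemma Idm_W': "Idm W' [[]] = elt id0"
  by (simp add: Weyl2'_def additive_closure_def mk_mat_eq_emb elt_def)

lemma clo_simps [simp]: "clo id0" "clo zero0" "clo (cc k)"
  "clo f \<Longrightarrow> clo g \<Longrightarrow> clo (f \<circ>\<^sub>d g)" "clo f \<Longrightarrow> clo g \<Longrightarrow> clo (f +\<^sub>d g)" "clo f \<Longrightarrow> clo (a *\<^sub>d f)"
  by (simp_all add: clo_def)

lemma mk_clo: "clo f \<Longrightarrow> mk (int n) f \<in> homs (int n) [] []"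
  by (simp add: mk_homs clo_def)

lemma End_unit_simps:
  "carrier (End_unit n) = elt ` Collect clo"
  "clo f \<Longrightarrow> clo g \<Longrightarrow> elt f \<otimes>\<^bsub>End_unit n\<^esub> elt g = elt (f \<circ>\<^sub>d g)"
  "clo f \<Longrightarrow> clo g \<Longrightarrow> elt f \<oplus>\<^bsub>End_unit n\<^esub> elt g = elt (f +\<^sub>d g)"
  "clo f \<Longrightarrow> a \<odot>\<^bsub>End_unit n\<^esub> elt f = elt (a *\<^sub>d f)"
  "\<one>\<^bsub>End_unit n\<^esub> = elt id0" "\<zero>\<^bsub>End_unit n\<^esub> = elt zero0"
proof -
  \<comment> \<open>The idempotent of \<open>unit_mor n\<close> is an identity, so the condition of
    the Karoubi envelope holds for every closed diagram.\<close>
  have "Cmp W' [[]] [[]] [[]] (Cmp W' [[]] [[]] [[]] (elt id0) (elt f)) (elt id0) = elt f" if "clo f" for f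
  proof -
    have "mk (int n) ((id0 \<circ>\<^sub>d f) \<circ>\<^sub>d id0) = mk (int n) f"
      using that ident_mult_left[OF mk_clo[OF that]] ident_mult_right[OF mk_clo[OF that]]
      by (simp add: mk_comp clo_def)
    then show ?thesis using that by (simp add: Cmp_W' elt_eq_iff)
  qed
  then show "carrier (End_unit n) = elt ` Collect clo"
    by (auto simp: End_unit_def End_alg_def Weyl2_def karoubi_def unit_mor_def Hom_W' Idm_W')
qed (simp_all add: End_unit_def End_alg_def Weyl2_def karoubi_def unit_mor_def Cmp_W' Pls_W' Scl_W' Zer_W' Idm_W')

definition dsum :: "(nat \<Rightarrow> Cq) \<Rightarrow> diag" where
  "dsum a = foldr Add (map (\<lambda>k. a k *\<^sub>d cc (int k)) [0..<Suc (n div 2)]) zero0"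

lemma clo_dsum [simp]: "clo (dsum a)"
proof -
  have "clo (foldr Add (map (\<lambda>k. a k *\<^sub>d cc (int k)) ks) zero0)" for ks by (induction ks) simp_all
  then show ?thesis by (simp only: dsum_def)
qed

lemma mk_dsum: "mk (int n) (dsum a) = (\<Sum>k\<le>n div 2. a k *\<^sub>m mk (int n) (cc (int k)))"
proof -
  have 1: "clo (foldr Add (map (\<lambda>k. a k *\<^sub>d cc (int k)) ks) zero0)" for ks by (induction ks) simp_all
  have "mk (int n) (foldr Add (map (\<lambda>k. a k *\<^sub>d cc (int k)) ks) zero0) = (\<Sum>k\<leftarrow>ks. a k *\<^sub>m mk (int n) (cc (int k)))" for ks
  proof (induction ks)
    case (Cons k ks)
    have "typed (a k *\<^sub>d cc (int k) +\<^sub>d foldr Add (map (\<lambda>k. a k *\<^sub>d cc (int k)) ks) zero0)"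
      using 1[of "k # ks"] by (simp add: clo_def)
    then show ?case using Cons by (simp add: mk_add mk_scal del: foldr_map)
  qed simp
  then show ?thesis unfolding dsum_def
    by (simp only: sum_list_distinct_conv_sum_set distinct_upt set_upt atLeast0LessThan lessThan_Suc_atMost)
qed

definition Ee :: "(nat \<Rightarrow> Cq) \<Rightarrow> diag set matrix_mor" where
  "Ee a = elt (dsum a)"

text \<open>A composite of closed diagrams equals their tensor product, to which
  \<open>cc_cc\<close> applies.\<close>

lemma mk_cc_mult: "mk (int n) (cc i) * mk (int n) (cc j) = (if i = j then mk (int n) (cc i) else 0)"
proof -
  have "mk (int n) (cc i) * mk (int n) (cc j) = mk (int n) (cc i \<circ>\<^sub>d cc j)" by (simp add: mk_comp)
  also have "\<dots> = mk (int n) (cc i \<otimes>\<^sub>d cc j)"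
    by (rule mk_cong[symmetric], rule closed_tens_comp) simp_all
  also have "\<dots> = cc i \<rhd> cc j \<rhd> mk (int n) id0"
    using mk_cong[OF weyl_eq.tens_unit_right[of "cc i \<otimes>\<^sub>d cc j" "int n"]]
      mk_cong[OF weyl_eq.tens_assoc[of "cc i" "cc j" id0 "int n"]]
    by (simp add: wh_mk)
  also have "\<dots> = (if i = j then cc i \<rhd> mk (int n) id0 else 0)" by (simp add: cc_cc)
  also have "cc i \<rhd> mk (int n) id0 = mk (int n) (cc i)"
    using mk_cong[OF weyl_eq.tens_unit_right[of "cc i" "int n"]] by (simp add: wh_mk)
  finally show ?thesis .
qed

lemma mk_dsum_mult: "mk (int n) (dsum a) * mk (int n) (dsum b) = mk (int n) (dsum (\<lambda>k. a k * b k))"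
proof -
  have "mk (int n) (dsum a) * mk (int n) (dsum b)
      = (\<Sum>i\<le>n div 2. \<Sum>j\<le>n div 2. if i = j then (a i * b i) *\<^sub>m mk (int n) (cc (int i)) else 0)"
    unfolding mk_dsum sum_product by (rule sum.cong[OF HOL.refl], rule sum.cong[OF HOL.refl]) (simp add: mk_cc_mult mult.commute)
  then show ?thesis unfolding mk_dsum by simp
qed

lemma Ee_props:
  "carrier (End_unit n) = range Ee"
  "Ee a \<otimes>\<^bsub>End_unit n\<^esub> Ee b = Ee (\<lambda>k. a k * b k)"
  "Ee a \<oplus>\<^bsub>End_unit n\<^esub> Ee b = Ee (\<lambda>k. a k + b k)"
  "\<one>\<^bsub>End_unit n\<^esub> = Ee (\<lambda>_. 1)" "\<zero>\<^bsub>End_unit n\<^esub> = Ee (\<lambda>_. 0)"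
  "c \<odot>\<^bsub>End_unit n\<^esub> Ee a = Ee (\<lambda>k. c * a k)"
proof -
  show "carrier (End_unit n) = range Ee"
  proof -
    have "elt f \<in> range Ee" if c: "clo f" for f
    proof -
      obtain a where "mk (int n) f = (\<Sum>k\<le>n div 2. a k *\<^sub>m mk (int n) (cc (int k)))"
        using closed_span[of f n] c unfolding clo_def by blast
      then have "elt f = Ee a" using c by (simp add: Ee_def elt_eq_iff mk_dsum)
      then show ?thesis by blast
    qed
    then show ?thesis by (auto simp: End_unit_simps Ee_def)
  qed
  have t: "typed (dsum a)" "dm (dsum a) = []" "cd (dsum a) = []" for a
    using clo_dsum[of a] by (simp_all add: clo_def)
  show "Ee a \<otimes>\<^bsub>End_unit n\<^esub> Ee b = Ee (\<lambda>k. a k * b k)"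
    by (simp add: Ee_def End_unit_simps elt_eq_iff mk_comp t mk_dsum_mult)
  show "Ee a \<oplus>\<^bsub>End_unit n\<^esub> Ee b = Ee (\<lambda>k. a k + b k)"
    by (simp add: Ee_def End_unit_simps elt_eq_iff mk_add t) (simp add: mk_dsum smul_add_left sum.distrib)
  show "\<one>\<^bsub>End_unit n\<^esub> = Ee (\<lambda>_. 1)"
    by (simp add: Ee_def End_unit_simps elt_eq_iff mk_dsum bubble_sum_mk)
  show "\<zero>\<^bsub>End_unit n\<^esub> = Ee (\<lambda>_. 0)"
    by (simp add: Ee_def End_unit_simps elt_eq_iff mk_dsum)
  show "c \<odot>\<^bsub>End_unit n\<^esub> Ee a = Ee (\<lambda>k. c * a k)"
    by (simp add: Ee_def End_unit_simps elt_eq_iff mk_scal) (simp add: mk_dsum smul_sum)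
qed

text \<open>Multiplication by the bubble k isolates the k-th coefficient, and that bubble is nonzero
  because of the representation on paths.\<close>

lemma Ee_eq_iff: "Ee a = Ee b \<longleftrightarrow> (\<forall>k\<le>n div 2. a k = b k)"
proof
  assume "Ee a = Ee b"
  then have eq: "mk (int n) (dsum a) = mk (int n) (dsum b)" by (simp add: Ee_def elt_eq_iff)
  show "\<forall>k\<le>n div 2. a k = b k"
  proof (intro allI impI)
    fix k assume k: "k \<le> n div 2"
    have *: "mk (int n) (dsum a) * mk (int n) (cc (int k)) = a k *\<^sub>m mk (int n) (cc (int k))" for a
    proof -
      have "mk (int n) (dsum a) * mk (int n) (cc (int k))
          = (\<Sum>i\<le>n div 2. if i = k then a i *\<^sub>m mk (int n) (cc (int i)) else 0)"
        unfolding mk_dsum sum_distrib_right by (rule sum.cong[OF HOL.refl]) (simp add: mk_cc_mult)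
      then show ?thesis using k by simp
    qed
    have "a k *\<^sub>m mk (int n) (cc (int k)) = b k *\<^sub>m mk (int n) (cc (int k))"
      using eq *[of a] *[of b] by simp
    then have "(a k - b k) *\<^sub>m mk (int n) (cc (int k)) = 0"
      using smul_add_left[of "a k" "- b k" "mk (int n) (cc (int k))"] by simp
    moreover have "mk (int n) (cc (int k)) \<noteq> 0"
      using bubble_nonzero[of "int k" "int n"] mk_eq_iff[of "cc (int k)" zero0 "int n"] k by simp
    ultimately show "a k = b k" by simp
  qed
next
  assume "\<forall>k\<le>n div 2. a k = b k"
  then have "mk (int n) (dsum a) = mk (int n) (dsum b)"
    unfolding mk_dsum by (intro sum.cong) simp_all
  then show "Ee a = Ee b" by (simp add: Ee_def elt_eq_iff)
qed

lemma bubble_Ee: "k \<le> n div 2 \<Longrightarrow> bubble n k = Ee (\<lambda>i. if i = k then 1 else 0)"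
proof -
  assume k: "k \<le> n div 2"
  have "(\<Sum>i\<le>n div 2. (if i = k then 1 else 0) *\<^sub>m mk (int n) (cc (int i)))
      = (\<Sum>i\<le>n div 2. if i = k then mk (int n) (cc (int i)) else 0)"
    by (intro sum.cong) simp_all
  then have "mk (int n) (dsum (\<lambda>i. if i = k then 1 else 0)) = mk (int n) (cc (int k))"
    using k by (simp add: mk_dsum)
  then have "elt (cc (int k)) = Ee (\<lambda>i. if i = k then 1 else 0)"
    by (simp add: Ee_def elt_eq_iff)
  then show ?thesis by (simp add: bubble_def elt_def emb_def)
qed

end

section \<open>The algebra given by generators and relations in coordinates\<close>

text \<open>In the case of a single monomial, m is known to occur in p; thus the restriction to the
  variables up to n div 2 survives the induction. The principle is used for polynomials and for
  their exponents.\<close>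

lemma poly_mapping_sum_induct [case_names zero single add]:
  fixes p :: "'a \<Rightarrow>\<^sub>0 'b::comm_monoid_add"
  assumes "Q 0" and "\<And>m c. m \<in> Poly_Mapping.keys p \<Longrightarrow> Q (Poly_Mapping.single m c)"
    and "\<And>f g. Q f \<Longrightarrow> Q g \<Longrightarrow> Q (f + g)"
  shows "Q p"
proof -
  have "p = (\<Sum>m\<in>Poly_Mapping.keys p. Poly_Mapping.single m (Poly_Mapping.lookup p m))"
    by (rule poly_mapping_eqI) (simp add: lookup_sum lookup_single when_def in_keys_iff)
  moreover have "Q (\<Sum>m\<in>A. Poly_Mapping.single m (Poly_Mapping.lookup p m))" if "A \<subseteq> Poly_Mapping.keys p" for A
    using finite_subset[OF that finite_keys] that by (induction A rule: finite_induct) (auto simp: assms)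
  ultimately show ?thesis by (metis subset_refl)
qed

lemma keys_add_nat: "Poly_Mapping.keys (a + b :: nat \<Rightarrow>\<^sub>0 nat) = Poly_Mapping.keys a \<union> Poly_Mapping.keys b"
  by (auto simp: in_keys_iff lookup_add)

text \<open>Evaluation at the point whose only nonzero coordinate is the \<open>k\<close>-th one, which is \<open>1\<close>.\<close>

definition peval :: "nat \<Rightarrow> mpol \<Rightarrow> Cq" where
  "peval k p = (\<Sum>m\<in>Poly_Mapping.keys p. if Poly_Mapping.keys m \<subseteq> {k} then Poly_Mapping.lookup p m else 0)"

lemma peval_superset:
  assumes "finite A" "Poly_Mapping.keys p \<subseteq> A"
  shows "peval k p = (\<Sum>m\<in>A. if Poly_Mapping.keys m \<subseteq> {k} then Poly_Mapping.lookup p m else 0)"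
  unfolding peval_def by (rule sum.mono_neutral_left) (use assms in \<open>auto simp: in_keys_iff\<close>)

lemma peval_add [simp]: "peval k (p + q) = peval k p + peval k q"
proof -
  let ?A = "Poly_Mapping.keys p \<union> Poly_Mapping.keys q"
  have "peval k r = (\<Sum>m\<in>?A. if Poly_Mapping.keys m \<subseteq> {k} then Poly_Mapping.lookup r m else 0)"
    if "Poly_Mapping.keys r \<subseteq> ?A" for r
    using that by (intro peval_superset) simp_all
  then show ?thesis by (simp add: keys_add lookup_add if_distrib flip: sum.distrib cong: if_cong)
qed

lemma peval_single [simp]: "peval k (Poly_Mapping.single m c) = (if Poly_Mapping.keys m \<subseteq> {k} then c else 0)"
  by (subst peval_superset[of "{m}"]) auto

lemma peval_0 [simp]: "peval k 0 = 0" by (simp add: peval_def)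

lemma peval_gvar [simp]: "peval k (gvar l) = (if k = l then 1 else 0)"
  by (simp add: gvar_def)

lemma peval_gconst [simp]: "peval k (gconst a) = a" and peval_1 [simp]: "peval k 1 = 1"
  by (simp_all add: gconst_def flip: single_one)

lemma peval_mult [simp]: "peval k (p * q) = peval k p * peval k q"
proof (induction p rule: poly_mapping_sum_induct)
  case (single m c)
  show ?case
    by (induction q rule: poly_mapping_sum_induct) (simp_all add: mult_single keys_add_nat distrib_left)
qed (simp_all add: distrib_right)

lemma peval_uminus [simp]: "peval k (- p) = - peval k p"
  using peval_add[of k "- p" p] by (simp add: eq_neg_iff_add_eq_0)

lemma peval_diff [simp]: "peval k (p - q) = peval k p - peval k q"
  using peval_add[of k p "- q"] by simp

lemma peval_sum [simp]: "peval k (sum f A) = (\<Sum>x\<in>A. peval k (f x))"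
  by (induction A rule: infinite_finite_induct) simp_all

context
  fixes n :: nat
begin

abbreviation PR where "PR \<equiv> carrier (gpoly_ring n)"
abbreviation II where "II \<equiv> grel_ideal n"

lemma gpoly_ring_simps [simp]:
  "x \<otimes>\<^bsub>gpoly_ring n\<^esub> y = x * y" "x \<oplus>\<^bsub>gpoly_ring n\<^esub> y = x + y"
  "\<one>\<^bsub>gpoly_ring n\<^esub> = 1" "\<zero>\<^bsub>gpoly_ring n\<^esub> = 0"
  by (simp_all add: gpoly_ring_def ring_of_type_algebra_def)

lemma carrier_gpoly_ring: "p \<in> PR \<longleftrightarrow> (\<forall>m\<in>Poly_Mapping.keys p. Poly_Mapping.keys m \<subseteq> {..n div 2})"
  by (simp add: gpoly_ring_def)

lemma PR_closed [simp]:
  "0 \<in> PR" "1 \<in> PR" "gconst a \<in> PR" "k \<le> n div 2 \<Longrightarrow> gvar k \<in> PR"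
  "p \<in> PR \<Longrightarrow> - p \<in> PR" "p \<in> PR \<Longrightarrow> q \<in> PR \<Longrightarrow> p + q \<in> PR"
  "p \<in> PR \<Longrightarrow> q \<in> PR \<Longrightarrow> p * q \<in> PR"
proof -
  show "gconst a \<in> PR" "1 \<in> PR"
    by (simp_all add: carrier_gpoly_ring gconst_def flip: single_one)
  show "p \<in> PR \<Longrightarrow> q \<in> PR \<Longrightarrow> p + q \<in> PR"
    using keys_add[of p q] by (auto simp: carrier_gpoly_ring)
  show "p \<in> PR \<Longrightarrow> q \<in> PR \<Longrightarrow> p * q \<in> PR"
    using keys_mult[of p q] by (fastforce simp: carrier_gpoly_ring keys_add_nat)
qed (auto simp: carrier_gpoly_ring gvar_def)

lemma PR_diff [simp]: "p \<in> PR \<Longrightarrow> q \<in> PR \<Longrightarrow> p - q \<in> PR"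
  using PR_closed(6)[of p "- q"] by simp

lemma PR_sum: "(\<And>x. x \<in> A \<Longrightarrow> f x \<in> PR) \<Longrightarrow> sum f A \<in> PR"
  by (induction A rule: infinite_finite_induct) simp_all

lemma cring_gpoly_ring: "cring (gpoly_ring n)"
proof (rule cringI)
  show "abelian_group (gpoly_ring n)"
  proof (rule abelian_groupI)
    fix x assume "x \<in> PR"
    then show "\<exists>y\<in>PR. y \<oplus>\<^bsub>gpoly_ring n\<^esub> x = \<zero>\<^bsub>gpoly_ring n\<^esub>" by (intro bexI[of _ "- x"]) simp_all
  qed (simp_all add: add_ac)
  show "comm_monoid (gpoly_ring n)" by (rule comm_monoidI) (simp_all add: mult_ac)
qed (simp add: distrib_right)

interpretation gp: cring "gpoly_ring n" by (rule cring_gpoly_ring)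

definition gen :: "mpol set" where
  "gen = {gvar k * gvar l - (if k = l then gvar k else 0) | k l. k \<le> n div 2 \<and> l \<le> n div 2}
      \<union> {(\<Sum>k\<le>n div 2. gvar k) - 1}"

lemma gen_PR: "gen \<subseteq> PR" by (auto simp: gen_def intro!: PR_diff PR_sum)

lemma II_gen: "II = Idl\<^bsub>gpoly_ring n\<^esub> gen" by (simp add: grel_ideal_def gen_def)

interpretation I: ideal II "gpoly_ring n"
  unfolding II_gen by (rule gp.genideal_ideal[OF gen_PR])

lemma II_closed:
  "gen \<subseteq> II" "0 \<in> II" "p \<in> II \<Longrightarrow> q \<in> II \<Longrightarrow> p + q \<in> II"
  "p \<in> II \<Longrightarrow> q \<in> PR \<Longrightarrow> q * p \<in> II" "p \<in> II \<Longrightarrow> - p \<in> II"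
proof -
  show "gen \<subseteq> II" unfolding II_gen by (rule gp.genideal_self[OF gen_PR])
  show "0 \<in> II" "p \<in> II \<Longrightarrow> q \<in> II \<Longrightarrow> p + q \<in> II" using I.zero_closed I.a_closed by simp_all
  show l: "p \<in> II \<Longrightarrow> q \<in> PR \<Longrightarrow> q * p \<in> II" for p q using I.I_l_closed by simp
  show "p \<in> II \<Longrightarrow> - p \<in> II" using l[of p "- 1"] by simp
qed

lemma II_sum: "(\<And>x. x \<in> A \<Longrightarrow> f x \<in> II) \<Longrightarrow> sum f A \<in> II"
  by (induction A rule: infinite_finite_induct) (simp_all add: II_closed)

definition lcomb :: "(nat \<Rightarrow> Cq) \<Rightarrow> mpol" where
  "lcomb a = (\<Sum>k\<le>n div 2. gconst (a k) * gvar k)"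

lemma lcomb_PR [simp]: "lcomb a \<in> PR" unfolding lcomb_def by (rule PR_sum) simp

lemma peval_lcomb [simp]: "k \<le> n div 2 \<Longrightarrow> peval k (lcomb a) = a k"
  by (simp add: lcomb_def if_distrib cong: if_cong)

lemma gconst_add: "gconst (a + b) = gconst a + gconst b"
  and gconst_mult: "gconst (a * b) = gconst a * gconst b"
  by (simp_all add: gconst_def single_add mult_single)

lemma lcomb_add: "lcomb (\<lambda>k. a k + b k) = lcomb a + lcomb b"
  by (simp add: lcomb_def gconst_add distrib_right sum.distrib)

lemma lcomb_mult: "lcomb (\<lambda>k. c * a k) = gconst c * lcomb a"
  by (simp add: lcomb_def gconst_mult sum_distrib_left mult.assoc)

text \<open>The property starts at 1, which is congruent to the sum of all generators, and it passes
  to multiples by \<open>gvar l\<close> because each \<open>gvar l * gvar k\<close> is congruent to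
  \<open>gvar l\<close> or 0. The coefficients of the reduced form are the values of p at the
  coordinate points.\<close>

lemma reduce_II:
  assumes "p \<in> PR"
  shows "p - lcomb (\<lambda>k. peval k p) \<in> II"
proof -
  have rel: "gvar k * gvar l - (if k = l then gvar k else 0) \<in> II" if "k \<le> n div 2" "l \<le> n div 2" for k l
    using II_closed(1) that unfolding gen_def by blast
  define C where "C p \<longleftrightarrow> p - lcomb (\<lambda>k. peval k p) \<in> II" for p
  have C_add: "C (p + q)" if "C p" "C q" for p q
    using II_closed(3)[of "p - lcomb (\<lambda>k. peval k p)" "q - lcomb (\<lambda>k. peval k q)"] that
    by (simp add: C_def lcomb_add algebra_simps)
  have C_const: "C (gconst c * p)" if "C p" for c p
    using II_closed(4)[of "p - lcomb (\<lambda>k. peval k p)" "gconst c"] that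
    by (simp add: C_def lcomb_mult algebra_simps)
  have C_var: "C (gvar l * p)" if "C p" "l \<le> n div 2" for l p
  proof -
    have "gvar l * (p - lcomb (\<lambda>k. peval k p))
        + (\<Sum>k\<le>n div 2. gconst (peval k p) * (gvar l * gvar k - (if l = k then gvar l else 0))) \<in> II"
      using that rel by (intro II_closed(3,4) II_sum) (auto simp only: C_def PR_closed atMost_iff)
    moreover have "(\<Sum>k\<le>n div 2. gconst (peval k p) * (if l = k then gvar l else 0)) = lcomb (\<lambda>k. peval k (gvar l * p))"
      unfolding lcomb_def by (rule sum.cong) (auto simp: gconst_def)
    moreover have "gvar l * lcomb (\<lambda>k. peval k p) = (\<Sum>k\<le>n div 2. gconst (peval k p) * (gvar l * gvar k))"
      by (simp add: lcomb_def sum_distrib_left mult_ac)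
    ultimately show ?thesis by (simp add: C_def right_diff_distrib sum_subtractf)
  qed
  have C_1: "C 1"
  proof -
    have "lcomb (\<lambda>k. peval k 1) = (\<Sum>k\<le>n div 2. gvar k)" by (simp add: lcomb_def gconst_def)
    moreover have "- ((\<Sum>k\<le>n div 2. gvar k) - 1) \<in> II"
      by (rule II_closed(5)) (use II_closed(1) in \<open>simp add: gen_def\<close>)
    ultimately show ?thesis by (simp add: C_def)
  qed
  have C_mono: "\<forall>q. C q \<longrightarrow> C (Poly_Mapping.single m 1 * q)" if m: "Poly_Mapping.keys m \<subseteq> {..n div 2}" for m
  proof (induction m rule: poly_mapping_sum_induct)
    case zero
    then show ?case by simp
  next
    case (single i v)
    then have i: "i \<le> n div 2" using m by auto
    show ?case
    proof (induction v)
      case (Suc v)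
      have "Poly_Mapping.single (Poly_Mapping.single i (Suc v)) 1
          = gvar i * Poly_Mapping.single (Poly_Mapping.single i v) 1"
        by (simp add: gvar_def mult_single flip: single_add)
      then show ?case using Suc C_var[OF _ i] by (simp add: mult.assoc)
    qed simp
  next
    case (add f g)
    have "Poly_Mapping.single (f + g) 1 = Poly_Mapping.single f (1::Cq) * Poly_Mapping.single g 1"
      by (simp add: mult_single)
    then show ?case using add by (simp add: mult.assoc)
  qed
  have "C p"
  proof (induction p rule: poly_mapping_sum_induct)
    case zero
    then show ?case by (simp add: C_def lcomb_def gconst_def II_closed)
  next
    case (single m c)
    have "C (gconst c * (Poly_Mapping.single m 1 * 1))"
      using single assms C_mono[of m] C_1 by (intro C_const) (auto simp: carrier_gpoly_ring)
    then show ?case by (simp add: gconst_def mult_single)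
  qed (rule C_add)
  then show ?thesis by (simp add: C_def)
qed

text \<open>The vanishing ideal of the unit points: the generators of the ideal vanish there, and a
  polynomial vanishing at all of them reduces to the zero combination by
  \<open>reduce_II\<close>.\<close>

lemma II_eq: "II = {p \<in> PR. \<forall>k\<le>n div 2. peval k p = 0}"
proof
  let ?J = "{p \<in> PR. \<forall>k\<le>n div 2. peval k p = 0}"
  have "ideal ?J (gpoly_ring n)"
  proof (rule idealI[OF gp.ring_axioms])
    have inv: "\<ominus>\<^bsub>gpoly_ring n\<^esub> p = - p" if "p \<in> PR" for p
      using that by (intro gp.minus_equality) simp_all
    show "subgroup ?J (add_monoid (gpoly_ring n))"
      by (rule gp.add.subgroupI) (use inv in \<open>auto simp: a_inv_def\<close>)
  qed auto
  moreover have "gen \<subseteq> ?J"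
  proof
    fix p assume p: "p \<in> gen"
    have "peval j (gvar k * gvar l - (if k = l then gvar k else 0)) = 0" for j k l
      by (cases "k = l") (simp_all only: if_True if_False peval_diff peval_mult peval_gvar peval_0, simp_all)
    then have "\<forall>j\<le>n div 2. peval j p = 0" using p unfolding gen_def by auto
    then show "p \<in> ?J" using p gen_PR by blast
  qed
  ultimately show "II \<subseteq> ?J" unfolding II_gen by (rule gp.genideal_minimal)
  show "?J \<subseteq> II"
  proof
    fix p assume p: "p \<in> ?J"
    then have "lcomb (\<lambda>k. peval k p) = 0" by (simp add: lcomb_def gconst_def)
    then show "p \<in> II" using reduce_II[of p] p by simp
  qed
qed

text \<open>A level set of the evaluations. By \<open>II_eq\<close> these sets are the cosets of the
  ideal, which makes the operations of the quotient pointwise.\<close>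

definition lev :: "(nat \<Rightarrow> Cq) \<Rightarrow> mpol set" where
  "lev a = {p \<in> PR. \<forall>k\<le>n div 2. peval k p = a k}"

lemma lcomb_in_lev: "lcomb a \<in> lev a" by (simp add: lev_def)

lemma lev_eq_iff: "lev a = lev b \<longleftrightarrow> (\<forall>k\<le>n div 2. a k = b k)"
proof
  assume "lev a = lev b"
  then have "lcomb a \<in> lev b" using lcomb_in_lev[of a] by simp
  then show "\<forall>k\<le>n div 2. a k = b k" by (simp add: lev_def)
qed (simp add: lev_def)

lemma gcoset_lev: "p \<in> PR \<Longrightarrow> gcoset n p = lev (\<lambda>k. peval k p)"
proof -
  assume p: "p \<in> PR"
  have "q \<in> gcoset n p" if q: "q \<in> lev (\<lambda>k. peval k p)" for q
  proof -
    have "q - p \<in> II" unfolding II_eq using p q by (simp add: lev_def)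
    then show ?thesis unfolding gcoset_def a_r_coset_def' by (rule UN_I) simp
  qed
  moreover have "gcoset n p \<subseteq> lev (\<lambda>k. peval k p)"
  proof
    fix t assume "t \<in> gcoset n p"
    then have "\<exists>h\<in>II. t = h + p" unfolding gcoset_def a_r_coset_def' by simp
    then obtain h where h: "h \<in> II" and t: "t = h + p" by blast
    have "peval k t = peval k p" if "k \<le> n div 2" for k
      unfolding t peval_add using h that unfolding II_eq by simp
    moreover have "t \<in> PR" unfolding t using h p unfolding II_eq by simp
    ultimately show "t \<in> lev (\<lambda>k. peval k p)" unfolding lev_def by blast
  qed
  ultimately show ?thesis by blast
qed

lemma Calg_props:
  "carrier (Calg n) = range lev"
  "lev a \<otimes>\<^bsub>Calg n\<^esub> lev b = lev (\<lambda>k. a k * b k)"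
  "lev a \<oplus>\<^bsub>Calg n\<^esub> lev b = lev (\<lambda>k. a k + b k)"
  "\<one>\<^bsub>Calg n\<^esub> = lev (\<lambda>_. 1)" "\<zero>\<^bsub>Calg n\<^esub> = lev (\<lambda>_. 0)"
  "c \<odot>\<^bsub>Calg n\<^esub> lev a = lev (\<lambda>k. c * a k)"
proof -
  have gl: "gcoset n p = lev a" if "p \<in> lev a" for p a
    using that by (auto simp: gcoset_lev lev_def)
  have m: "rcoset_mult (gpoly_ring n) II (lev a) (lev b) = lev (\<lambda>k. a k * b k)" for a b
  proof -
    have "gcoset n (p * q) = lev (\<lambda>k. a k * b k)" if "p \<in> lev a" "q \<in> lev b" for p q
      using that by (intro gl) (simp add: lev_def)
    then have "rcoset_mult (gpoly_ring n) II (lev a) (lev b) = (\<Union>p\<in>lev a. \<Union>q\<in>lev b. lev (\<lambda>k. a k * b k))"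
      unfolding rcoset_mult_def by (intro SUP_cong) (simp_all add: gcoset_def)
    moreover have "lev a \<noteq> {}" for a using lcomb_in_lev[of a] by blast
    ultimately show ?thesis by simp
  qed
  show "carrier (Calg n) = range lev"
  proof -
    have "carrier (Calg n) = gcoset n ` PR"
      by (auto simp: Calg_def ring.defs FactRing_def A_RCOSETS_def' gcoset_def Let_def)
    moreover have "lev a \<in> gcoset n ` PR" for a
      using gl[OF lcomb_in_lev[of a]] by (metis imageI lcomb_PR)
    ultimately show ?thesis by (auto simp: gcoset_lev)
  qed
  show "lev a \<otimes>\<^bsub>Calg n\<^esub> lev b = lev (\<lambda>k. a k * b k)"
    by (simp add: Calg_def ring.defs FactRing_def Let_def m)
  show "lev a \<oplus>\<^bsub>Calg n\<^esub> lev b = lev (\<lambda>k. a k + b k)"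
  proof -
    \<comment> \<open>An element with values a + b is split as \<open>lcomb a\<close> plus the
      remainder, which has the values b.\<close>
    have "q \<in> lev a <+>\<^bsub>gpoly_ring n\<^esub> lev b" if "q \<in> lev (\<lambda>k. a k + b k)" for q
      unfolding set_add_def' using that lcomb_in_lev[of a]
      by (intro UN_I[of "lcomb a"] UN_I[of "q - lcomb a"]) (auto simp: lev_def)
    moreover have "lev a <+>\<^bsub>gpoly_ring n\<^esub> lev b \<subseteq> lev (\<lambda>k. a k + b k)"
      unfolding set_add_def' by (auto simp: lev_def)
    ultimately have "lev a <+>\<^bsub>gpoly_ring n\<^esub> lev b = lev (\<lambda>k. a k + b k)" by blast
    then show ?thesis by (simp add: Calg_def ring.defs FactRing_def Let_def)
  qed
  show "\<one>\<^bsub>Calg n\<^esub> = lev (\<lambda>_. 1)"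
    using gcoset_lev[of 1] by (simp add: Calg_def ring.defs FactRing_def Let_def gcoset_def)
  have "\<zero>\<^bsub>Calg n\<^esub> = II"
    by (simp add: Calg_def ring.defs FactRing_def Let_def)
  then show "\<zero>\<^bsub>Calg n\<^esub> = lev (\<lambda>_. 0)"
    by (simp only: II_eq lev_def)
  show "c \<odot>\<^bsub>Calg n\<^esub> lev a = lev (\<lambda>k. c * a k)"
    using m[of "\<lambda>_. c" a] by (simp add: Calg_def ring.defs module.defs FactRing_def Let_def gcoset_lev)
qed

lemma gamma_lev: "k \<le> n div 2 \<Longrightarrow> gamma n k = lev (\<lambda>i. if i = k then 1 else 0)"
  by (simp add: gamma_def gcoset_lev)

text \<open>Linearity and the values on the generators determine the map. The family a is built up
  one coordinate at a time, and the coordinates beyond n div 2 affect neither side.\<close>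

lemma natural_map_lev:
  assumes "is_natural_map n \<psi>"
  shows "\<psi> (lev a) = Ee n a"
proof -
  have add: "\<psi> (lev a \<oplus>\<^bsub>Calg n\<^esub> lev b) = \<psi> (lev a) \<oplus>\<^bsub>End_unit n\<^esub> \<psi> (lev b)"
    and smult: "\<psi> (c \<odot>\<^bsub>Calg n\<^esub> lev a) = c \<odot>\<^bsub>End_unit n\<^esub> \<psi> (lev a)" for a b c
    using assms by (auto simp: is_natural_map_def algebra_hom_def ring_hom_def Calg_props(1))
  have delta: "\<psi> (lev (\<lambda>i. if i = k then c else 0)) = Ee n (\<lambda>i. if i = k then c else 0)"
    if "k \<le> n div 2" for k c
  proof -
    have "\<psi> (lev (\<lambda>i. if i = k then 1 else 0)) = Ee n (\<lambda>i. if i = k then 1 else 0)"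
      using assms that by (simp add: is_natural_map_def gamma_lev bubble_Ee)
    then show ?thesis
      using smult[of c "\<lambda>i. if i = k then 1 else 0"]
      by (simp add: Calg_props Ee_props if_distrib cong: if_cong)
  qed
  have "\<psi> (lev (\<lambda>i. if i < m then a i else 0)) = Ee n (\<lambda>i. if i < m then a i else 0)"
    if "m \<le> Suc (n div 2)" for m
    using that
  proof (induction m)
    case 0
    show ?case using smult[of 0 "\<lambda>_. 0"] delta[of 0 0] by simp
  next
    case (Suc m)
    have "(\<lambda>i. if i < Suc m then a i else 0)
        = (\<lambda>i. (if i < m then a i else 0) + (if i = m then a m else 0))"
      by (auto simp: less_Suc_eq)
    then show ?case
      using Suc delta[of m "a m"] add[of "\<lambda>i. if i < m then a i else 0" "\<lambda>i. if i = m then a m else 0"]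
      by (simp add: Calg_props Ee_props)
  qed
  from this[of "Suc (n div 2)"]
  have "\<psi> (lev (\<lambda>i. if i < Suc (n div 2) then a i else 0)) = Ee n (\<lambda>i. if i < Suc (n div 2) then a i else 0)"
    by simp
  moreover have "lev (\<lambda>i. if i < Suc (n div 2) then a i else 0) = lev a"
    "Ee n (\<lambda>i. if i < Suc (n div 2) then a i else 0) = Ee n a"
    by (simp_all add: lev_eq_iff Ee_eq_iff less_Suc_eq_le)
  ultimately show ?thesis by simp
qed

lemma natural_map_exists: "\<exists>\<psi>. is_natural_map n \<psi>"
proof
  define \<psi> where "\<psi> = (\<lambda>x \<in> carrier (Calg n). Ee n (SOME a. x = lev a))"
  have \<psi>: "\<psi> (lev a) = Ee n a" for a
  proof -
    have "lev a = lev (SOME b. lev a = lev b)" by (rule someI[of _ a]) (rule HOL.refl)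
    \<comment> \<open>Well-definedness: \<open>lev_eq_iff\<close> and \<open>Ee_eq_iff\<close>
      characterize equality by the same coordinates.\<close>
    then have "Ee n a = Ee n (SOME b. lev a = lev b)" unfolding lev_eq_iff Ee_eq_iff .
    then show ?thesis by (simp add: \<psi>_def Calg_props(1))
  qed
  show "is_natural_map n \<psi>"
    unfolding is_natural_map_def algebra_hom_def ring_hom_def
    by (auto simp: Calg_props Ee_props \<psi> gamma_lev bubble_Ee) (simp add: \<psi>_def Calg_props)
qed

end

theorem proposition7p10:
  fixes n :: nat
  shows "algebra Cq_ring (Calg n) \<and> algebra Cq_ring (End_unit n) \<and>
    (\<exists>!\<psi>. is_natural_map n \<psi>) \<and>
    (\<forall>\<psi>. is_natural_map n \<psi> \<longrightarrow> bij_betw \<psi> (carrier (Calg n)) (carrier (End_unit n)))"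
proof (intro conjI allI impI)
  show "algebra Cq_ring (Calg n)" by (rule coordinate_algebra[OF Calg_props])
  show "algebra Cq_ring (End_unit n)" by (rule coordinate_algebra[OF Ee_props])
  show "\<exists>!\<psi>. is_natural_map n \<psi>"
  proof (rule ex_ex1I[OF natural_map_exists])
    fix \<psi> \<psi>' assume *: "is_natural_map n \<psi>" "is_natural_map n \<psi>'"
    show "\<psi> = \<psi>'"
    proof (rule extensionalityI)
      show "\<psi> \<in> extensional (carrier (Calg n))" "\<psi>' \<in> extensional (carrier (Calg n))"
        using * by (simp_all add: is_natural_map_def)
      show "\<psi> x = \<psi>' x" if "x \<in> carrier (Calg n)" for x
        using that * by (auto simp: Calg_props natural_map_lev)
    qed
  qed
  show "bij_betw \<psi> (carrier (Calg n)) (carrier (End_unit n))" if "is_natural_map n \<psi>" for \<psi>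
    \<comment> \<open>The map sends \<open>lev n a\<close> to \<open>Ee n a\<close>, and the same
      coordinates decide equality on both sides.\<close>
    using natural_map_lev[OF that]
    by (auto simp: bij_betw_def inj_on_def Calg_props Ee_props Ee_eq_iff lev_eq_iff image_image)
qed

end
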